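(* Let $n\ge 5$ and $p$ be integers with $1\le p<\frac n2-1$. Then for every odd integer $m\ge 3$, the carpet $F_{n,p}$ is not quasisymmetrically equivalent to the standard Sierpiński carpet $S_m$; that is, there is no quasisymmetric homeomorphism from $F_{n,p}$ onto $S_m$.
   Context: Construction of $F_{n,p}$ ($n\ge5$, $1\le p<\frac n2-1$ integers): Let $Q^{(0)}_{n,p}=[0,1]\times[0,1]\subset\mathbb{R}^2$. Subdivide it into $n^2$ closed subsquares of side length $1/n$ and remove the interiors of the four subsquares $[a,a+\frac1n]\times[b,b+\frac1n]$ with $a,b\in\{\frac pn,\,1-\frac{p+1}{n}\}$ (each is at distance $\sqrt2\,p/n$ from one of the four corners of the unit square). The result is $Q^{(1)}_{n,p}$, a union of $n^2-4$ squares of side length $1/n$. Inductively, $Q^{(k+1)}_{n,p}$ is obtained from $Q^{(k)}_{n,p}$ by applying the same (scaled) subdivision and removal to each of the remaining squares of side length $1/n^k$. Then $F_{n,p}=\bigcap_{k\ge0}Q^{(k)}_{n,p}$. Standard carpet $S_m$ ($m\ge3$ odd): start with $[0,1]\times[0,1]$, subdivide into $m^2$ subsquares of equal size, remove the interior of the middle subsquare, repeat these operations on every remaining subsquare inductively, and take the intersection of all the resulting sets. Both sets carry the Euclidean metric (which on a compact subset of the plane is bi-Lipschitz equivalent to the spherical metric). A homeomorphism $f:X\to Y$ of metric spaces is quasisymmetric if there is a homeomorphism $\eta:[0,\infty)\to[0,\infty)$ with $\frac{d_Y(f(x),f(y))}{d_Y(f(x),f(z))}\le\eta\left(\frac{d_X(x,y)}{d_X(x,z)}\right)$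 for all $x,y,z\in X$, $x\ne z$. *)

theory Defs
  imports "HOL-Analysis.Analysis"
begin

(* The metric on real \<times> real is the Euclidean one, see dist_prod_def. *)
type_synonym plane = "real \<times> real"

definition square :: "plane \<Rightarrow> real \<Rightarrow> plane set" where
  "square c s = {fst c .. fst c + s} \<times> {snd c .. snd c + s}"

(* Subdividing a square with lower left corner c and side length s * n into n^2 squares of
   side length s, the subsquare in column i and row j (both counted from 0) has lower left
   corner subcorner s c (i, j). *)
definition subcorner :: "real \<Rightarrow> plane \<Rightarrow> nat \<times> nat \<Rightarrow> plane" where
  "subcorner s c ij = (fst c + real (fst ij) * s, snd c + real (snd ij) * s)"

(* R is the set of index pairs of the subsquares to be removed; corners n R k is the set of
   lower left corners of the squares of side length 1 / n^k that remain after k steps. *)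
primrec corners :: "nat \<Rightarrow> (nat \<times> nat) set \<Rightarrow> nat \<Rightarrow> plane set" where
  "corners n R 0 = {(0, 0)}"
| "corners n R (Suc k) =
     {subcorner (1 / real n ^ Suc k) c ij | c ij.
        c \<in> corners n R k \<and> ij \<in> {..<n} \<times> {..<n} - R}"

primrec carpet_stage :: "nat \<Rightarrow> (nat \<times> nat) set \<Rightarrow> nat \<Rightarrow> plane set" where
  "carpet_stage n R 0 = {0..1} \<times> {0..1}"
| "carpet_stage n R (Suc k) = carpet_stage n R k -
     (\<Union>c \<in> corners n R k. \<Union>ij \<in> R.
        interior (square (subcorner (1 / real n ^ Suc k) c ij) (1 / real n ^ Suc k)))"

definition carpet :: "nat \<Rightarrow> (nat \<times> nat) set \<Rightarrow> plane set" where
  "carpet n R = (\<Inter>k. carpet_stage n R k)"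

(* The coordinates p / n and 1 - (p + 1) / n correspond to the indices p and n - (p + 1). *)
definition four_hole_carpet :: "nat \<Rightarrow> nat \<Rightarrow> plane set" where
  "four_hole_carpet n p = carpet n ({p, n - (p + 1)} \<times> {p, n - (p + 1)})"

definition standard_carpet :: "nat \<Rightarrow> plane set" where
  "standard_carpet m = carpet m {((m - 1) div 2, (m - 1) div 2)}"

definition quasisymmetric_homeomorphism ::
    "'a::metric_space set \<Rightarrow> 'b::metric_space set \<Rightarrow> ('a \<Rightarrow> 'b) \<Rightarrow> bool" where
  "quasisymmetric_homeomorphism X Y f \<longleftrightarrow>
     (\<exists>g. homeomorphism X Y f g) \<and>
     (\<exists>\<eta> \<theta> :: real \<Rightarrow> real. homeomorphism {0..} {0..} \<eta> \<theta> \<and>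
        (\<forall>x\<in>X. \<forall>y\<in>X. \<forall>z\<in>X. x \<noteq> z \<longrightarrow>
           dist (f x) (f y) / dist (f x) (f z) \<le> \<eta> (dist x y / dist x z)))"

definition quasisymmetrically_equivalent ::
    "'a::metric_space set \<Rightarrow> 'b::metric_space set \<Rightarrow> bool" where
  "quasisymmetrically_equivalent X Y \<longleftrightarrow> (\<exists>f. quasisymmetric_homeomorphism X Y f)"

end

theory Submission imports Defs begin

text \<open>
  Call a pair of peripheral circles of a carpet admissible with constant \<open>K\<close> if there is a function that is 1 on
  the first circle, 0 on the second, has no energy on the carpet itself, and whose squared oscillations over
  all peripheral circles sum up to at most \<open>K\<close>. The infimum of \<open>K\<close> is a transboundary modulus, and it is
  invariant under quasisymmetric homeomorphisms because it is defined by covers with quasi-balls.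

  In the standard carpet the outer and the middle circle \<open>O\<close>, \<open>M\<close> form the only pair of maximal modulus.
  Given another pair, let \<open>C2\<close> be the smaller circle and \<open>Q\<close> the square whose middle circle it is. A potential
  for \<open>(O, M)\<close>, transplanted to \<open>Q\<close> and continued by 1, is a potential for the pair. As \<open>C1\<close> misses the left or
  the right side of \<open>Q\<close>, the potential may be lowered near that side, and this saves a fixed amount of energy:
  lines from \<open>C2\<close> to the side force the potential to spend much energy in thin layers.

  Let \<open>f\<close> be a quasisymmetric homeomorphism from \<open>F\<close> onto the standard carpet and \<open>r\<close> the rotation of \<open>F\<close> by a right
  angle. The conjugate of \<open>r\<close> by \<open>f\<close> preserves the pair \<open>{O, M}\<close>, so the half-turn \<open>r\<^sup>2\<close> preserves the two distinct
  preimages of \<open>O\<close> and \<open>M\<close> under \<open>f\<close>. But no hole of \<open>F\<close> is centred at the centre of the unit square.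
\<close>

section \<open>Oscillation, energy and admissible pairs\<close>

text \<open>Collapsing every peripheral disc to a point yields a sphere, so there are continuous
  functions that separate two circles and are constant on each circle. The condition that
  \<open>S\<close> itself carries no energy excludes them. It is phrased with covers because a
  quasisymmetric map controls the images of balls, but neither lengths nor areas. Conversely
  \<open>S\<close> has area zero, so Lipschitz functions satisfy it, which provides potentials and
  cutoffs.

  Neither a minimiser nor an infimum occurs. Maximality of \<open>(O, M)\<close> is strict in a
  uniform sense: the saving \<open>del\<close> is chosen before \<open>K\<close>. If the conjugated
  rotation moved the pair, any admissible \<open>K\<close> could be lowered by \<open>del\<close>
  again and again until it is negative. The obstacle is this uniformity: how fast a potential leaves
  the value 1 is not known, so no cutting height can be fixed in advance. A pigeonhole argument over
  finitely many dyadic heights finds one.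

  A half-turn alone would be too weak, since its conjugate might exchange \<open>O\<close> and
  \<open>M\<close>. As the square of a quarter-turn it fixes each of them.\<close>

definition osc :: "('a \<Rightarrow> real) \<Rightarrow> 'a set \<Rightarrow> real" where
  "osc u A = diameter (u ` A)"

lemma osc_alt: "osc u A = (if A = {} then 0 else Sup ((\<lambda>(p, q). \<bar>u p - u q\<bar>) ` (A \<times> A)))"
proof -
  have "(\<lambda>(x, y). dist x y) ` (u ` A \<times> u ` A) = (\<lambda>(p, q). \<bar>u p - u q\<bar>) ` (A \<times> A)"
    by (force simp: dist_real_def)
  then show ?thesis by (simp add: osc_def diameter_def)
qed

text \<open>The diameter of an unbounded set is an unspecified real, hence the boundedness
  hypotheses here and below. They hold on every subset of a compact carpet for a continuous
  function.\<close>

lemma osc_nonneg: "bounded (u ` A) \<Longrightarrow> 0 \<le> osc u A"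
  by (simp add: osc_def diameter_ge_0)

lemma osc_le:
  assumes "\<And>x y. x \<in> A \<Longrightarrow> y \<in> A \<Longrightarrow> \<bar>u x - u y\<bar> \<le> d" and "A \<noteq> {} \<or> 0 \<le> d"
  shows "osc u A \<le> d"
  unfolding osc_def using assms by (intro diameter_le) auto

lemma osc_bound:
  assumes "bounded (u ` A)" "x \<in> A" "y \<in> A"
  shows "\<bar>u x - u y\<bar> \<le> osc u A"
  using diameter_bounded_bound[OF assms(1), of "u x" "u y"] assms
  by (simp add: osc_def dist_real_def)

lemma osc_cong: "(\<And>x. x \<in> A \<Longrightarrow> u x = v x) \<Longrightarrow> osc u A = osc v A"
  by (simp add: osc_def cong: image_cong)

lemma osc_image: "osc u (g ` A) = osc (u \<circ> g) A"
  by (simp add: osc_def image_comp)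

lemma osc_const: "(\<And>x. x \<in> A \<Longrightarrow> u x = c) \<Longrightarrow> osc u A = 0"
proof (cases "A = {}")
  case False
  moreover assume "\<And>x. x \<in> A \<Longrightarrow> u x = c"
  ultimately have "u ` A = {c}" by auto
  then show ?thesis by (simp add: osc_def)
qed (simp add: osc_def)

lemma bounded_min:
  fixes u v :: "'a \<Rightarrow> real"
  assumes "bounded (u ` A)" "bounded (v ` A)"
  shows "bounded ((\<lambda>z. min (u z) (v z)) ` A)"
proof -
  obtain a b where "\<And>x. x \<in> A \<Longrightarrow> \<bar>u x\<bar> \<le> a" "\<And>x. x \<in> A \<Longrightarrow> \<bar>v x\<bar> \<le> b"
    using assms unfolding bounded_iff by (metis imageI real_norm_def)
  then show ?thesis
    unfolding bounded_iff by (intro exI[of _ "max a b"]) fastforce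
qed

lemma bounded_max:
  fixes u v :: "'a \<Rightarrow> real"
  assumes "bounded (u ` A)" "bounded (v ` A)"
  shows "bounded ((\<lambda>z. max (u z) (v z)) ` A)"
proof -
  obtain a b where "\<And>x. x \<in> A \<Longrightarrow> \<bar>u x\<bar> \<le> a" "\<And>x. x \<in> A \<Longrightarrow> \<bar>v x\<bar> \<le> b"
    using assms unfolding bounded_iff by (metis imageI real_norm_def)
  then show ?thesis
    unfolding bounded_iff by (intro exI[of _ "max a b"]) fastforce
qed

text \<open>The minimum oscillates at most as much as the more oscillating of the two functions.
  Bounding this maximum by the sum makes energies subadditive, which is sharp enough when the second
  function is Lipschitz with a controlled constant.\<close>

lemma osc_min_sq_le:
  assumes "bounded (u ` A)" "bounded (v ` A)"
  shows "(osc (\<lambda>z. min (u z) (v z)) A)\<^sup>2 \<le> (osc u A)\<^sup>2 + (osc v A)\<^sup>2"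
proof -
  let ?m = "max (osc u A) (osc v A)"
  have nn: "0 \<le> osc u A" "0 \<le> osc v A" using assms osc_nonneg by auto
  have "osc (\<lambda>z. min (u z) (v z)) A \<le> ?m"
  proof (rule osc_le)
    fix x y assume xy: "x \<in> A" "y \<in> A"
    show "\<bar>min (u x) (v x) - min (u y) (v y)\<bar> \<le> ?m"
      using osc_bound[OF assms(1) xy] osc_bound[OF assms(2) xy] by linarith
  qed (use nn in auto)
  then have "(osc (\<lambda>z. min (u z) (v z)) A)\<^sup>2 \<le> ?m\<^sup>2"
    using osc_nonneg[OF bounded_min[OF assms]] by (intro power_mono) auto
  also have "\<dots> \<le> (osc u A)\<^sup>2 + (osc v A)\<^sup>2" by (simp add: max_def)
  finally show ?thesis .
qed

lemma osc_max_const_le: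
  assumes "bounded (u ` A)"
  shows "osc (\<lambda>z. max (u z) c) A \<le> osc u A"
proof (rule osc_le)
  fix x y assume xy: "x \<in> A" "y \<in> A"
  show "\<bar>max (u x) c - max (u y) c\<bar> \<le> osc u A"
    using osc_bound[OF assms xy] by linarith
qed (use osc_nonneg[OF assms] in auto)

text \<open>Cutting at height \<open>c\<close> splits the range of \<open>u\<close> into two parts
  that meet at most in \<open>c\<close>, so the two oscillations add up to at most
  \<open>osc u A\<close>, and squares are superadditive. Hence passing from \<open>u\<close> to
  \<open>min u c\<close> releases at least the energy of the part above \<open>c\<close>.\<close>

lemma osc_min_max_const:
  assumes b: "bounded (u ` A)"
  shows "(osc (\<lambda>z. min (u z) c) A)\<^sup>2 + (osc (\<lambda>z. max (u z) c) A)\<^sup>2 \<le> (osc u A)\<^sup>2"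
proof (cases "A = {}")
  case True then show ?thesis by (simp add: osc_def)
next
  case ne: False
  have bc: "bounded ((\<lambda>z. c) ` A)" using ne by (simp add: image_constant_conv)
  have bmin: "bounded ((\<lambda>z. min (u z) c) ` A)" and bmax: "bounded ((\<lambda>z. max (u z) c) ` A)"
    using bounded_min[OF b bc] bounded_max[OF b bc] by auto
  let ?a = "osc (\<lambda>z. min (u z) c) A" and ?b = "osc (\<lambda>z. max (u z) c) A"
  have nn: "0 \<le> ?a" "0 \<le> ?b" using bmin bmax osc_nonneg by auto
  \<comment> \<open>The extremal pairs of the two truncations may differ, so four independent points
    are compared.\<close>
  have four: "\<bar>min (u p) c - min (u q) c\<bar> + \<bar>max (u r) c - max (u s) c\<bar> \<le> osc u A"
    if "p \<in> A" "q \<in> A" "r \<in> A" "s \<in> A" for p q r s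
    using osc_bound[OF b, of p q] osc_bound[OF b, of p r] osc_bound[OF b, of p s]
      osc_bound[OF b, of q r] osc_bound[OF b, of q s] osc_bound[OF b, of r s] that
    by (auto simp: min_def max_def abs_if split: if_splits)
  have "?b \<le> osc u A - \<bar>min (u p) c - min (u q) c\<bar>" if "p \<in> A" "q \<in> A" for p q
    by (rule osc_le) (use four[OF that] ne in fastforce)+
  then have "?a \<le> osc u A - ?b"
    by (intro osc_le) (use ne in fastforce)+
  then have "?a + ?b \<le> osc u A" by simp
  then have "(?a + ?b)\<^sup>2 \<le> (osc u A)\<^sup>2" using nn by (intro power_mono) auto
  moreover have "?a\<^sup>2 + ?b\<^sup>2 \<le> (?a + ?b)\<^sup>2" using nn by (simp add: power2_sum)
  ultimately show ?thesis by linarith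
qed

text \<open>A quasi-cover consists of triples \<open>(U, x, r)\<close> where \<open>U\<close> may be much smaller than the ball it is
  compared with, and the balls \<open>B(x, r)\<close> overlap at most \<open>mu\<close> times. The radius \<open>r = 0\<close> is allowed: then the
  ball is empty and \<open>U\<close> has at most one point.\<close>

definition quasi_cover ::
    "'a::metric_space set \<Rightarrow> real \<Rightarrow> nat \<Rightarrow> real \<Rightarrow> ('a set \<times> 'a \<times> real) set \<Rightarrow> bool" where
  "quasi_cover S lam mu del P \<longleftrightarrow> finite P \<and> S \<subseteq> (\<Union>(U, x, r)\<in>P. U) \<and>
     (\<forall>(U, x, r)\<in>P. U \<subseteq> S \<and> x \<in> S \<and> 0 \<le> r \<and> r \<le> del \<and> U \<subseteq> cball x (lam * r)) \<and>
     (\<forall>z\<in>S. card {(U, x, r) \<in> P. dist x z < r} \<le> mu)"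

text \<open>Functions that carry no energy on \<open>S\<close> itself. This plays the role of "up to families of curves of
  modulus zero" in the theory of quasiconformal maps, but only refers to the metric of \<open>S\<close>.\<close>

definition null_osc :: "'a::metric_space set \<Rightarrow> ('a \<Rightarrow> real) \<Rightarrow> bool" where
  "null_osc S u \<longleftrightarrow> continuous_on S u \<and>
     (\<exists>lam mu. \<forall>e>0. \<exists>P. quasi_cover S lam mu e P \<and> (\<Sum>(U, x, r)\<in>P. (osc u U)\<^sup>2) \<le> e)"

text \<open>Non-separating circles: Whyburn's topological description of the boundary circles of a
  carpet. Being topological, it is carried along by every homeomorphism.\<close>

definition peripheral :: "plane set \<Rightarrow> plane set \<Rightarrow> bool" where
  "peripheral S J \<longleftrightarrow> J \<subseteq> S \<and> J homeomorphic sphere (0::plane) 1 \<and> connected (S - J)"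

definition energy_le :: "plane set \<Rightarrow> (plane \<Rightarrow> real) \<Rightarrow> real \<Rightarrow> bool" where
  "energy_le S u K \<longleftrightarrow>
     (\<forall>F. finite F \<and> F \<subseteq> Collect (peripheral S) \<longrightarrow> (\<Sum>C\<in>F. (osc u C)\<^sup>2) \<le> K)"

text \<open>The infimum of the admissible \<open>K\<close> is the transboundary modulus of the curves joining \<open>C1\<close> to \<open>C2\<close>.\<close>

definition adm :: "plane set \<Rightarrow> plane set \<Rightarrow> plane set \<Rightarrow> real \<Rightarrow> bool" where
  "adm S C1 C2 K \<longleftrightarrow> (\<exists>u. null_osc S u \<and> energy_le S u K \<and> (\<forall>z\<in>C1. u z = 1) \<and> (\<forall>z\<in>C2. u z = 0))"

text \<open>One constant \<open>H\<close> for each ratio \<open>lam\<close> instead of a distortion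
  function. This is what the transport of covers consumes, and it can be checked directly for a
  conjugated isometry.\<close>

definition weak_qs :: "'a::metric_space set \<Rightarrow> ('a \<Rightarrow> 'b::metric_space) \<Rightarrow> bool" where
  "weak_qs S g \<longleftrightarrow> (\<forall>lam. \<exists>H. \<forall>x\<in>S. \<forall>y\<in>S. \<forall>z\<in>S.
     dist x y \<le> lam * dist x z \<longrightarrow> dist (g x) (g y) \<le> H * dist (g x) (g z))"

section \<open>Transport of covers, circles and admissibility\<close>

lemma quasi_coverD:
  assumes "quasi_cover S lam mu del P"
  shows "finite P" "S \<subseteq> (\<Union>(U, x, r)\<in>P. U)"
    "\<And>U x r. (U, x, r) \<in> P \<Longrightarrow> U \<subseteq> S \<and> x \<in> S \<and> 0 \<le> r \<and> r \<le> del \<and> U \<subseteq> cball x (lam * r)"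
    "\<And>z. z \<in> S \<Longrightarrow> card {(U, x, r) \<in> P. dist x z < r} \<le> mu"
  using assms unfolding quasi_cover_def by blast+

lemma quasi_cover_mono:
  assumes "quasi_cover S lam mu del P" "lam \<le> lam'" "del \<le> del'" "mu \<le> mu'"
  shows "quasi_cover S lam' mu' del' P"
proof -
  note P = quasi_coverD[OF assms(1)]
  have c: "U \<subseteq> cball x (lam' * r)" if "(U, x, r) \<in> P" for U x r
  proof -
    have "lam * r \<le> lam' * r" using P(3)[OF that] assms(2) by (intro mult_right_mono) auto
    then show ?thesis using P(3)[OF that] by (meson order_trans subset_cball)
  qed
  have "case q of (U, x, r) \<Rightarrow> U \<subseteq> S \<and> x \<in> S \<and> 0 \<le> r \<and> r \<le> del' \<and> U \<subseteq> cball x (lam' * r)"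
    if "q \<in> P" for q
  proof (cases q)
    case (fields U x r)
    then show ?thesis using P(3)[of U x r] c[of U x r] that assms(3) by simp
  qed
  then show ?thesis
    unfolding quasi_cover_def using P(1,2) P(4) assms(4) by (meson order_trans)
qed

text \<open>The new radius is essentially the distance from \<open>g x\<close> to the image of the
  complement of \<open>B(x, r)\<close>. So the new ball pulls back into the old one, and the
  multiplicity survives. As \<open>U\<close> lies in \<open>cball x (lam * r)\<close>, weak
  quasisymmetry bounds the image of \<open>U\<close> by \<open>H\<close> times each of these
  distances.\<close>

lemma quasi_cover_image:
  assumes hom: "homeomorphism S T g h" and S: "compact S" and qs: "weak_qs S g" and lam: "0 \<le> lam"
  shows "\<exists>lam'. \<forall>e>0. \<exists>d>0. \<forall>P. quasi_cover S lam mu d P \<longrightarrow>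
     (\<exists>s. quasi_cover T lam' mu e ((\<lambda>(U, x, r). (g ` U, g x, s U x r)) ` P))"
proof -
  have gS: "g ` S = T" and cg: "continuous_on S g" and inj: "\<And>x. x \<in> S \<Longrightarrow> h (g x) = x"
    using hom by (auto simp: homeomorphism_def)
  obtain H where H: "\<And>x y z. x \<in> S \<Longrightarrow> y \<in> S \<Longrightarrow> z \<in> S \<Longrightarrow> dist x y \<le> lam * dist x z
      \<Longrightarrow> dist (g x) (g y) \<le> H * dist (g x) (g z)"
    using qs unfolding weak_qs_def by meson
  \<comment> \<open>\<open>R\<close> encloses the image of \<open>U\<close> around
    \<open>g x\<close>. As an additional candidate it keeps the infimum meaningful when no point
    lies outside the ball, and it keeps the new radius below \<open>e\<close>; this is the origin of
    the 1 in \<open>max 1 H\<close>. For \<open>U = {x}\<close> the new radius is 0.\<close>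
  define R where "R = (\<lambda>U x. if U = {} then 0 else Sup ((\<lambda>y. dist (g x) (g y)) ` U))"
  define I where "I = (\<lambda>U x r. insert (R U x) ((\<lambda>z. dist (g x) (g z)) ` {z\<in>S. r \<le> dist x z}))"
  define s where "s = (\<lambda>U x r. Inf (I U x r))"
  have uc: "uniformly_continuous_on S g"
    using compact_uniformly_continuous[OF cg S] .
  have bT: "bounded T" using compact_continuous_image[OF cg S] gS compact_imp_bounded by auto
  show ?thesis
  proof (rule exI[of _ "max 1 H"], intro allI impI)
    fix e :: real assume e: "0 < e"
    obtain d0 where d0: "d0 > 0" "\<And>x y. x \<in> S \<Longrightarrow> y \<in> S \<Longrightarrow> dist x y < d0 \<Longrightarrow> dist (g x) (g y) < e"
      using uc e unfolding uniformly_continuous_on_def by (metis dist_commute)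
    define d where "d = d0 / (2 * (\<bar>lam\<bar> + 1))"
    have d: "d > 0" using d0 by (simp add: d_def)
    have ld: "lam * d < d0"
    proof -
      have "lam * d \<le> (\<bar>lam\<bar> + 1) * d" using d by (intro mult_right_mono) auto
      also have "\<dots> = d0 / 2" by (simp add: d_def field_simps)
      finally show ?thesis using d0(1) by simp
    qed
    show "\<exists>d>0. \<forall>P. quasi_cover S lam mu d P \<longrightarrow>
       (\<exists>s. quasi_cover T (max 1 H) mu e ((\<lambda>(U, x, r). (g ` U, g x, s U x r)) ` P))"
    proof (intro exI[of _ d] conjI allI impI exI[of _ s])
      fix P assume qc: "quasi_cover S lam mu d P"
      note P = quasi_coverD[OF qc]
      let ?F = "\<lambda>(U, x, r). (g ` U, g x, s U x r)"
      have main: "0 \<le> s U x r \<and> s U x r \<le> e \<and> g ` U \<subseteq> cball (g x) (max 1 H * s U x r) \<and>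
          (\<forall>z\<in>S. dist (g x) (g z) < s U x r \<longrightarrow> dist x z < r)"
        if mem: "(U, x, r) \<in> P" for U x r
      proof -
        have U: "U \<subseteq> S" "x \<in> S" "0 \<le> r" "r \<le> d" "U \<subseteq> cball x (lam * r)" using P(3)[OF mem] by auto
        have bdd: "bdd_above ((\<lambda>y. dist (g x) (g y)) ` U)"
        proof -
          obtain b where "\<And>p q. p \<in> T \<Longrightarrow> q \<in> T \<Longrightarrow> dist p q \<le> b"
            using bT unfolding bounded_two_points by blast
          then show ?thesis using U gS by (intro bdd_aboveI[of _ b]) auto
        qed
        have Rub: "dist (g x) (g y) \<le> R U x" if "y \<in> U" for y
          using that bdd by (auto simp: R_def intro: cSup_upper)
        have Rnn: "0 \<le> R U x"
        proof (cases "U = {}")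
          case False
          then obtain y where "y \<in> U" by blast
          then show ?thesis using Rub[of y] zero_le_dist[of "g x" "g y"] by linarith
        qed (simp add: R_def)
        have Rle: "R U x \<le> e"
        proof (cases "U = {}")
          case False
          have "dist (g x) (g y) \<le> e" if "y \<in> U" for y
          proof -
            have "dist x y \<le> lam * r" using U that by auto
            moreover have "lam * r \<le> max 0 (lam * d)"
            proof (cases "lam \<ge> 0")
              case True then show ?thesis using U mult_left_mono[of r d lam] by auto
            next
              case False then show ?thesis using U mult_nonpos_nonneg[of lam r] by auto
            qed
            ultimately have "dist x y < d0" using ld d0(1) by auto
            then show ?thesis using d0(2)[of x y] U that by fastforce
          qed
          then show ?thesis using False by (auto simp: R_def intro!: cSup_least)
        qed (use e in \<open>simp add: R_def\<close>)
        have Ibdd: "bdd_below (I U x r)" using Rnn by (intro bdd_belowI[of _ 0]) (auto simp: I_def)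
        have nn: "0 \<le> s U x r" unfolding s_def by (rule cInf_greatest) (auto simp: I_def Rnn)
        have "s U x r \<le> R U x" unfolding s_def by (rule cInf_lower[OF _ Ibdd]) (simp add: I_def)
        then have le: "s U x r \<le> e" using Rle by simp
        have "g ` U \<subseteq> cball (g x) (max 1 H * s U x r)"
        proof
          fix w assume "w \<in> g ` U"
          then obtain y where y: "y \<in> U" "w = g y" by auto
          have "dist (g x) w / max 1 H \<le> s U x r"
            unfolding s_def
          proof (rule cInf_greatest)
            fix q assume "q \<in> I U x r"
            then consider "q = R U x" | z where "z \<in> S" "r \<le> dist x z" "q = dist (g x) (g z)"
              by (auto simp: I_def)
            then show "dist (g x) w / max 1 H \<le> q"
            proof cases
              case 1
              have "dist (g x) w / max 1 H \<le> dist (g x) w"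
                by (simp add: divide_le_eq mult_le_cancel_left1)
              then show ?thesis using 1 Rub[OF y(1)] y by simp
            next
              case 2
              have "dist x y \<le> lam * r" using U y by auto
              also have "\<dots> \<le> lam * dist x z"
                using 2 lam by (simp add: mult_left_mono)
              finally have "dist (g x) (g y) \<le> H * dist (g x) (g z)" using H U y 2 by auto
              also have "\<dots> \<le> max 1 H * dist (g x) (g z)" by (intro mult_right_mono) auto
              finally show ?thesis using y 2 by (simp add: pos_divide_le_eq less_max_iff_disj mult.commute)
            qed
          qed (simp add: I_def)
          then show "w \<in> cball (g x) (max 1 H * s U x r)"
            by (simp add: pos_divide_le_eq less_max_iff_disj mult.commute)
        qed
        moreover have "dist x z < r" if "z \<in> S" "dist (g x) (g z) < s U x r" for z
        proof (rule ccontr)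
          assume "\<not> dist x z < r"
          then have "s U x r \<le> dist (g x) (g z)"
            unfolding s_def using that by (intro cInf_lower[OF _ Ibdd]) (auto simp: I_def)
          then show False using that by simp
        qed
        ultimately show ?thesis using nn le by auto
      qed
      show "quasi_cover T (max 1 H) mu e (?F ` P)"
        unfolding quasi_cover_def
      proof (intro conjI ballI)
        show "finite (?F ` P)" using P(1) by simp
        show "T \<subseteq> (\<Union>(U, x, r)\<in>?F ` P. U)"
        proof
          fix w assume "w \<in> T"
          then obtain z where "z \<in> S" "w = g z" using gS by auto
          then obtain q where q: "q \<in> P" "z \<in> fst q" using P(2) by fastforce
          then have "w \<in> fst (?F q)" using \<open>w = g z\<close> by (auto simp: case_prod_beta)
          then show "w \<in> (\<Union>(U, x, r)\<in>?F ` P. U)" using q(1) by (auto simp: case_prod_beta)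
        qed
        fix q assume "q \<in> ?F ` P"
        then obtain U x r where q: "(U, x, r) \<in> P" "q = (g ` U, g x, s U x r)" by auto
        show "case q of (U, x, r) \<Rightarrow> U \<subseteq> T \<and> x \<in> T \<and> 0 \<le> r \<and> r \<le> e \<and> U \<subseteq> cball x (max 1 H * r)"
          using main[OF q(1)] P(3)[OF q(1)] gS q(2) by auto
      next
        fix w assume "w \<in> T"
        then obtain z where z: "z \<in> S" "w = g z" using gS by auto
        have "{(U, x, r) \<in> ?F ` P. dist x w < r} \<subseteq> ?F ` {(U, x, r) \<in> P. dist x z < r}"
        proof
          fix q assume q0: "q \<in> {(U, x, r) \<in> ?F ` P. dist x w < r}"
          then obtain U x r where q: "(U, x, r) \<in> P" "q = (g ` U, g x, s U x r)" by auto
          then have "dist (g x) (g z) < s U x r" using q0 z by auto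
          then have "dist x z < r" using main[OF q(1)] z by auto
          then have "(U, x, r) \<in> {(U, x, r) \<in> P. dist x z < r}" using q by simp
          then show "q \<in> ?F ` {(U, x, r) \<in> P. dist x z < r}"
            by (rule image_eqI[rotated]) (simp add: q)
        qed
        moreover have "finite {(U, x, r) \<in> P. dist x z < r}"
          by (rule finite_subset[OF _ P(1)]) blast
        ultimately have "card {(U, x, r) \<in> ?F ` P. dist x w < r} \<le> card {(U, x, r) \<in> P. dist x z < r}"
          by (rule surj_card_le[rotated])
        then show "card {(U, x, r) \<in> ?F ` P. dist x w < r} \<le> mu" using P(4)[OF z(1)] by simp
      qed
    qed (rule d)
  qed
qed


lemma null_osc_transfer:
  assumes hom: "homeomorphism S T g h" and S: "compact S" and qs: "weak_qs S g"
    and u: "null_osc S u"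
  shows "null_osc T (u \<circ> h)"
proof -
  obtain lam mu where lm: "\<And>e. e > 0 \<Longrightarrow>
      \<exists>P. quasi_cover S lam mu e P \<and> (\<Sum>(U, x, r)\<in>P. (osc u U)\<^sup>2) \<le> e"
    and cu: "continuous_on S u"
    using u unfolding null_osc_def by blast
  have hg: "\<And>x. x \<in> S \<Longrightarrow> h (g x) = x" using hom by (auto simp: homeomorphism_def)
  have "continuous_on T (u \<circ> h)"
    using hom cu by (intro continuous_on_compose) (auto simp: homeomorphism_def)
  moreover
  obtain lam' where lam': "\<And>e. e > 0 \<Longrightarrow> \<exists>d>0. \<forall>P. quasi_cover S (max 0 lam) mu d P \<longrightarrow>
     (\<exists>s. quasi_cover T lam' mu e ((\<lambda>(U, x, r). (g ` U, g x, s U x r)) ` P))"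
    using quasi_cover_image[OF hom S qs, of "max 0 lam" mu] by auto
  have "\<exists>P. quasi_cover T lam' mu e P \<and> (\<Sum>(U, x, r)\<in>P. (osc (u \<circ> h) U)\<^sup>2) \<le> e" if e: "e > 0" for e
  proof -
    obtain d where d: "d > 0" "\<And>P. quasi_cover S (max 0 lam) mu d P \<Longrightarrow>
        \<exists>s. quasi_cover T lam' mu e ((\<lambda>(U, x, r). (g ` U, g x, s U x r)) ` P)"
      using lam'[OF e] by blast
    obtain P where P: "quasi_cover S lam mu (min d e) P"
        "(\<Sum>(U, x, r)\<in>P. (osc u U)\<^sup>2) \<le> min d e"
      using lm[of "min d e"] d e by auto
    obtain s where s: "quasi_cover T lam' mu e ((\<lambda>(U, x, r). (g ` U, g x, s U x r)) ` P)"
      using d(2)[OF quasi_cover_mono[OF P(1)]] by auto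
    let ?F = "\<lambda>(U, x, r). (g ` U, g x, s U x r)"
    \<comment> \<open>Only an inequality, because triples that differ in the radius alone may have
      the same image.\<close>
    have "(\<Sum>(U, x, r)\<in>?F ` P. (osc (u \<circ> h) U)\<^sup>2)
        \<le> (\<Sum>q\<in>P. ((\<lambda>(U, x, r). (osc (u \<circ> h) U)\<^sup>2) \<circ> ?F) q)"
      by (rule sum_image_le) (use quasi_coverD(1)[OF P(1)] in auto)
    also have "\<dots> = (\<Sum>(U, x, r)\<in>P. (osc u U)\<^sup>2)"
    proof (rule sum.cong)
      fix q assume q: "q \<in> P"
      obtain U x r where qq: "q = (U, x, r)" by (cases q)
      have "U \<subseteq> S" using quasi_coverD(3)[OF P(1)] q qq by blast
      then have "osc (u \<circ> h) (g ` U) = osc u U"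
        unfolding osc_image by (intro osc_cong) (auto simp: hg)
      then show "((\<lambda>(U, x, r). (osc (u \<circ> h) U)\<^sup>2) \<circ> ?F) q = (case q of (U, x, r) \<Rightarrow> (osc u U)\<^sup>2)"
        by (simp add: qq)
    qed simp
    finally show ?thesis using s P(2) by (intro exI[of _ "?F ` P"]) auto
  qed
  ultimately show ?thesis unfolding null_osc_def by blast
qed

lemma peripheral_image:
  assumes hom: "homeomorphism S T g h" and J: "peripheral S J"
  shows "peripheral T (g ` J)"
proof -
  have JS: "J \<subseteq> S" and con: "connected (S - J)" using J by (auto simp: peripheral_def)
  have gS: "g ` S = T" and hg: "\<And>x. x \<in> S \<Longrightarrow> h (g x) = x" and cg: "continuous_on S g"
    using hom by (auto simp: homeomorphism_def)
  have inj: "inj_on g S" using hg by (metis inj_onI)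
  have "homeomorphism J (g ` J) g h"
    using homeomorphism_of_subsets[OF hom JS, of "g ` J"] JS gS by auto
  then have "g ` J homeomorphic sphere (0::plane) 1"
    using J by (meson homeomorphic_def homeomorphic_sym homeomorphic_trans peripheral_def)
  moreover have "T - g ` J = g ` (S - J)"
    using inj_on_image_set_diff[OF inj, of S J] JS gS by auto
  then have "connected (T - g ` J)"
    using connected_continuous_image[OF continuous_on_subset[OF cg] con] by auto
  ultimately show ?thesis using JS gS unfolding peripheral_def by blast
qed

lemma adm_transfer:
  assumes hom: "homeomorphism S T g h" and S: "compact S" and qs: "weak_qs S g"
    and C: "C1 \<subseteq> S" "C2 \<subseteq> S" and a: "adm S C1 C2 K"
  shows "adm T (g ` C1) (g ` C2) K"
proof -
  obtain u where u: "null_osc S u" "energy_le S u K" "\<And>z. z \<in> C1 \<Longrightarrow> u z = 1" "\<And>z. z \<in> C2 \<Longrightarrow> u z = 0"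
    using a unfolding adm_def by auto
  have hg: "\<And>x. x \<in> S \<Longrightarrow> h (g x) = x" and gh: "\<And>x. x \<in> T \<Longrightarrow> g (h x) = x"
    using hom by (auto simp: homeomorphism_def)
  have "energy_le T (u \<circ> h) K"
    unfolding energy_le_def
  proof (intro allI impI, elim conjE)
    fix F assume F: "finite F" "F \<subseteq> Collect (peripheral T)"
    have FT: "C \<subseteq> T" if "C \<in> F" for C using that F by (meson mem_Collect_eq peripheral_def subsetD)
    have ghC: "g ` (h ` C) = C" if "C \<in> F" for C
      using FT[OF that] gh by force
    have "inj_on (image h) F" using ghC by (metis inj_onI)
    then have "(\<Sum>C\<in>F. (osc (u \<circ> h) C)\<^sup>2) = (\<Sum>C\<in>image h ` F. (osc u C)\<^sup>2)"
      by (simp add: sum.reindex osc_image)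
    also have "\<dots> \<le> K"
      using u(2) F peripheral_image[OF homeomorphism_symD[OF hom]] unfolding energy_le_def
      by (metis (no_types, lifting) finite_imageI image_subset_iff mem_Collect_eq subset_iff)
    finally show "(\<Sum>C\<in>F. (osc (u \<circ> h) C)\<^sup>2) \<le> K" .
  qed
  moreover have "null_osc T (u \<circ> h)" by (rule null_osc_transfer[OF hom S qs u(1)])
  ultimately show ?thesis
    unfolding adm_def using u(3,4) C hg by (intro exI[of _ "u \<circ> h"]) (auto simp: subset_iff)
qed

lemma adm_swap:
  assumes "adm S C1 C2 K"
  shows "adm S C2 C1 K"
proof -
  obtain u where u: "null_osc S u" "energy_le S u K" "\<And>z. z \<in> C1 \<Longrightarrow> u z = 1" "\<And>z. z \<in> C2 \<Longrightarrow> u z = 0"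
    using assms unfolding adm_def by auto
  have o: "osc (\<lambda>z. 1 - u z) A = osc u A" for A
    unfolding osc_alt by (simp add: abs_minus_commute)
  show ?thesis
    unfolding adm_def
  proof (intro exI[of _ "\<lambda>z. 1 - u z"] conjI)
    show "null_osc S (\<lambda>z. 1 - u z)" using u(1) unfolding null_osc_def o
      by (auto intro: continuous_intros)
    show "energy_le S (\<lambda>z. 1 - u z) K" using u(2) unfolding energy_le_def o .
  qed (use u in auto)
qed

section \<open>Complementary domains of planar sets\<close>

lemma frontier_subset_complement:
  assumes "\<And>H. H \<in> G \<Longrightarrow> open H" and "pairwise disjnt G" and "H \<in> G"
  shows "frontier H \<subseteq> - \<Union>G"
proof
  fix z assume z: "z \<in> frontier H"
  have "z \<notin> H'" if H': "H' \<in> G" for H'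
  proof
    assume zH: "z \<in> H'"
    show False
    proof (cases "H' = H")
      case True then show ?thesis using assms z zH by (simp add: frontier_def interior_open)
    next
      case False
      then have "H' \<inter> H = {}" using assms(2,3) H' by (auto simp: pairwise_def disjnt_def)
      then have "H' \<inter> closure H = {}" using assms(1)[OF H'] by (simp add: open_Int_closure_eq_empty)
      then show ?thesis using z zH by (auto simp: frontier_def)
    qed
  qed
  then show "z \<in> - \<Union>G" by auto
qed

text \<open>By Jordan-Brouwer the complement of \<open>J\<close> has at least two components, and
  the connected rest of the set occupies at most one of them. Another component \<open>T\<close>
  consists of gap points only. It cannot cross the frontier of a gap, so it lies in a single gap
  \<open>H\<close>; and \<open>H\<close> cannot cross \<open>J\<close>, the frontier of
  \<open>T\<close>, so both agree.\<close>

lemma nonseparating_circle_is_frontier: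
  fixes G :: "'a::euclidean_space set set"
  assumes dim: "2 \<le> DIM('a)"
    and op: "\<And>H. H \<in> G \<Longrightarrow> open H" and con: "\<And>H. H \<in> G \<Longrightarrow> connected H"
    and disj: "pairwise disjnt G"
    and J: "J \<subseteq> - \<Union>G" "J homeomorphic sphere (a::'a) 1" "connected (- \<Union>G - J)"
  shows "\<exists>H\<in>G. J = frontier H"
proof -
  define S where "S = - \<Union>G"
  have nc: "\<not> connected (- J)" using Jordan_Brouwer_separation[OF J(2)] by simp
  obtain T where T: "T \<in> components (- J)" "T \<inter> S = {}"
  proof (cases "S - J = {}")
    case True
    have "- J \<noteq> {}" using nc by auto
    then obtain T where "T \<in> components (- J)" by (metis components_eq_empty ex_in_conv)
    moreover have "T \<inter> S = {}" using in_components_subset[OF \<open>T \<in> components (- J)\<close>] True by blast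
    ultimately show ?thesis using that by blast
  next
    case False
    then obtain T0 where T0: "T0 \<in> components (- J)" "S - J \<subseteq> T0"
      using exists_component_superset[of "S - J" "- J"] J(3) S_def nc by auto
    have "\<exists>T \<in> components (- J). T \<noteq> T0"
    proof (rule ccontr)
      assume "\<not> ?thesis"
      then have "components (- J) = {T0}" using T0 by blast
      then have "- J = T0" by (metis Union_components ccpo_Sup_singleton)
      then show False using nc T0(1) in_components_connected by auto
    qed
    then obtain T where "T \<in> components (- J)" "T \<noteq> T0" by blast
    then have "T \<inter> T0 = {}" using T0(1) components_nonoverlap by blast
    then have "T \<inter> S = {}" using T0(2) in_components_subset[OF \<open>T \<in> components (- J)\<close>] by blast
    then show ?thesis using that \<open>T \<in> components (- J)\<close> by blast
  qed
  have fT: "frontier T = J" by (rule Jordan_Brouwer_frontier[OF J(2) T(1) dim])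
  have conT: "connected T" and neT: "T \<noteq> {}"
    using T(1) in_components_connected in_components_nonempty by auto
  obtain H where H: "H \<in> G" "T \<inter> H \<noteq> {}" using T(2) neT unfolding S_def by blast
  have "T \<inter> frontier H = {}"
    using frontier_subset_complement[OF op disj H(1)] T(2) S_def by blast
  then have "T \<subseteq> H" using connected_Int_frontier[OF conT H(2)] by blast
  moreover have "H \<inter> frontier T = {}" using fT J(1) H(1) by blast
  then have "H \<subseteq> T" using connected_Int_frontier[OF con[OF H(1)], of T] H(2) by blast
  ultimately show ?thesis using H(1) fT by auto
qed

text \<open>A separation of the set extends over the filled gaps to a separation of the complement
  of \<open>closure H\<close>, which is connected. Disjointness of the closures keeps the frontiers
  of the other gaps inside the set that is separated.\<close>

lemma connected_minus_frontier:
  fixes G :: "'a::euclidean_space set set"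
  assumes op: "\<And>H. H \<in> G \<Longrightarrow> open H"
    and cf: "\<And>H. H \<in> G \<Longrightarrow> connected (frontier H) \<and> frontier H \<noteq> {}"
    and disj: "\<And>H H'. H \<in> G \<Longrightarrow> H' \<in> G \<Longrightarrow> H \<noteq> H' \<Longrightarrow> closure H \<inter> closure H' = {}"
    and H: "H \<in> G" and con: "connected (- closure H)"
  shows "connected (- \<Union>G - frontier H)"
proof (rule connectedI)
  define X where "X = - \<Union>G - frontier H"
  define P where "P = - closure H"
  have pd: "pairwise disjnt G"
    unfolding pairwise_def disjnt_def using disj closure_subset by blast
  have oP: "open P" unfolding P_def by (intro open_Compl closed_closure)
  have X: "X = P - \<Union>G"
    using H op unfolding X_def P_def frontier_def by (auto simp: interior_open)
  have fX: "frontier H' \<subseteq> X" if "H' \<in> G" "H' \<noteq> H" for H'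
    using frontier_subset_complement[OF op pd that(1)] disj[OF H that(1)] that(2)
    unfolding X P_def frontier_def by blast
  fix A B assume A: "open A" and B: "open B" and nA: "A \<inter> (- \<Union>G - frontier H) \<noteq> {}"
    and nB: "B \<inter> (- \<Union>G - frontier H) \<noteq> {}"
    and dj: "A \<inter> B \<inter> (- \<Union>G - frontier H) = {}" and cov: "- \<Union>G - frontier H \<subseteq> A \<union> B"
  note fold = X_def[symmetric]
  \<comment> \<open>Each gap is given to the side that contains its frontier; a connected frontier
    lies on one side.\<close>
  define ext where "ext = (\<lambda>A. {p\<in>P. (p \<in> X \<and> p \<in> A) \<or> (\<exists>H'\<in>G. p \<in> H' \<and> frontier H' \<subseteq> A)})"
  have either: "frontier H' \<subseteq> A \<or> frontier H' \<subseteq> B" if H': "H' \<in> G" "H' \<noteq> H" for H'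
  proof -
    have "frontier H' \<subseteq> A \<union> B" "A \<inter> B \<inter> frontier H' = {}" using fX[OF H'] cov dj fold by blast+
    then have "A \<inter> frontier H' = {} \<or> B \<inter> frontier H' = {}"
      using connectedD[of "frontier H'" A B] cf[OF H'(1)] A B by blast
    then show ?thesis using \<open>frontier H' \<subseteq> A \<union> B\<close> by blast
  qed
  have openext: "open (ext A)"
    if A: "open A" and dj: "A \<inter> B \<inter> X = {}" and
      either: "\<And>H'. H' \<in> G \<Longrightarrow> H' \<noteq> H \<Longrightarrow> frontier H' \<subseteq> A \<or> frontier H' \<subseteq> B" for A B
    unfolding open_contains_ball
  proof
    fix p assume p: "p \<in> ext A"
    then have pP: "p \<in> P" by (simp add: ext_def)
    consider "p \<in> X" "p \<in> A" | H' where "H' \<in> G" "p \<in> H'" "frontier H' \<subseteq> A"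
      using p by (auto simp: ext_def)
    then show "\<exists>e>0. ball p e \<subseteq> ext A"
    proof cases
      case 1
      obtain e where e: "e > 0" "ball p e \<subseteq> A \<inter> P"
        using open_contains_ball[of "A \<inter> P"] A oP 1(2) pP by blast
      have "q \<in> ext A" if q: "q \<in> ball p e" for q
      proof (cases "q \<in> X")
        case True then show ?thesis using q e X by (auto simp: ext_def)
      next
        case False
        have qP: "q \<in> P" using q e by blast
        then obtain H' where H': "H' \<in> G" "q \<in> H'" using False X by blast
        have "H' \<noteq> H" using qP H' closure_subset unfolding P_def by blast
        have "p \<notin> H'" using 1 X H' by blast
        \<comment> \<open>On the way from \<open>p\<close> into the gap the segment meets the
          frontier of the gap inside the small ball, hence inside \<open>A\<close>. This decides the
          side of the whole gap.\<close>
        then have "closed_segment p q \<inter> frontier H' \<noteq> {}"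
          using H' by (intro connected_Int_frontier) auto
        then obtain z where z: "z \<in> closed_segment p q" "z \<in> frontier H'" by blast
        have "closed_segment p q \<subseteq> ball p e"
          using q e by (intro closed_segment_subset) auto
        then have "z \<in> A" using z e by blast
        then have "\<not> frontier H' \<subseteq> B" using dj z fX[OF H'(1) \<open>H' \<noteq> H\<close>] by blast
        then have "frontier H' \<subseteq> A" using either[OF H'(1) \<open>H' \<noteq> H\<close>] by blast
        then show ?thesis using qP H' by (auto simp: ext_def)
      qed
      then show ?thesis using e by blast
    next
      case 2
      have "open (H' \<inter> P)" using op 2 oP by blast
      then obtain e where "e > 0" "ball p e \<subseteq> H' \<inter> P" using pP 2 open_contains_ball by blast
      moreover have "H' \<inter> P \<subseteq> ext A" using 2 by (auto simp: ext_def)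
      ultimately show ?thesis by blast
    qed
  qed
  have oA: "open (ext A)" using openext[OF A _ either] dj fold by blast
  have oB: "open (ext B)" using openext[OF B, of A] dj either fold by blast
  have c: "P \<subseteq> ext A \<union> ext B"
  proof
    fix p assume p: "p \<in> P"
    show "p \<in> ext A \<union> ext B"
    proof (cases "p \<in> X")
      case True then show ?thesis using p cov fold by (auto simp: ext_def)
    next
      case False
      then obtain H' where H': "H' \<in> G" "p \<in> H'" using p X by blast
      then have "H' \<noteq> H" using p closure_subset unfolding P_def by blast
      then show ?thesis using either[OF H'(1)] H' p by (auto simp: ext_def)
    qed
  qed
  have d: "ext A \<inter> ext B \<inter> P = {}"
  proof (rule ccontr)
    assume "\<not> ?thesis"
    then obtain p where p: "p \<in> ext A" "p \<in> ext B" "p \<in> P" by blast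
    show False
    proof (cases "p \<in> X")
      case True
      then have "p \<in> A" "p \<in> B" using p X by (auto simp: ext_def)
      then show False using True dj fold by blast
    next
      case False
      then obtain H1 H2 where H12: "H1 \<in> G" "p \<in> H1" "frontier H1 \<subseteq> A" "H2 \<in> G" "p \<in> H2" "frontier H2 \<subseteq> B"
        using p by (auto simp: ext_def)
      then have "H1 = H2" using pd unfolding pairwise_def disjnt_def by blast
      have "H1 \<noteq> H" using p(3) H12(2) closure_subset unfolding P_def by blast
      then show False using fX[OF H12(1)] cf[OF H12(1)] H12 \<open>H1 = H2\<close> dj fold by blast
    qed
  qed
  have "ext A \<inter> P \<noteq> {}" "ext B \<inter> P \<noteq> {}" using nA nB X fold by (auto simp: ext_def)
  then show False using connectedD[OF con, of "ext A" "ext B"] oA oB c d unfolding P_def by blast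
qed

section \<open>Grid squares and carpets\<close>

definition cell :: "nat \<Rightarrow> nat \<Rightarrow> nat \<Rightarrow> nat \<Rightarrow> plane set" where
  "cell n k a b = {real a / real n ^ k .. (real a + 1) / real n ^ k} \<times> {real b / real n ^ k .. (real b + 1) / real n ^ k}"

definition ocell :: "nat \<Rightarrow> nat \<Rightarrow> nat \<Rightarrow> nat \<Rightarrow> plane set" where
  "ocell n k a b = {real a / real n ^ k <..< (real a + 1) / real n ^ k} \<times> {real b / real n ^ k <..< (real b + 1) / real n ^ k}"

definition rim :: "nat \<Rightarrow> nat \<Rightarrow> nat \<Rightarrow> nat \<Rightarrow> plane set" where
  "rim n k a b = cell n k a b - ocell n k a b"

text \<open>In base \<open>n\<close> a square survives iff no position carries a pair of digits in
  \<open>R\<close>; \<open>div n\<close> passes to the parent square. The recursion ends at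
  \<open>(0, 0)\<close>, which for positive \<open>n\<close> forces both indices below
  \<open>n ^ k\<close>.\<close>

fun kept :: "nat \<Rightarrow> (nat \<times> nat) set \<Rightarrow> nat \<Rightarrow> nat \<Rightarrow> nat \<Rightarrow> bool" where
  "kept n R 0 a b \<longleftrightarrow> a = 0 \<and> b = 0"
| "kept n R (Suc k) a b \<longleftrightarrow> kept n R k (a div n) (b div n) \<and> (a mod n, b mod n) \<notin> R"

fun hole :: "nat \<Rightarrow> (nat \<times> nat) set \<Rightarrow> nat \<Rightarrow> nat \<Rightarrow> nat \<Rightarrow> bool" where
  "hole n R 0 a b \<longleftrightarrow> False"
| "hole n R (Suc k) a b \<longleftrightarrow> kept n R k (a div n) (b div n) \<and> (a mod n, b mod n) \<in> R"

text \<open>The exterior of the unit square counts as a gap, so that the outer circle is treated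
  like the boundary of a hole.\<close>

definition gaps :: "nat \<Rightarrow> (nat \<times> nat) set \<Rightarrow> plane set set" where
  "gaps n R = insert (- cell n 0 0 0) {ocell n k a b | k a b. hole n R k a b}"

lemma open_ocell: "open (ocell n k a b)"
  unfolding ocell_def by (intro open_Times) auto

lemma closed_cell: "closed (cell n k a b)"
  unfolding cell_def by (intro closed_Times) auto

lemma compact_cell: "compact (cell n k a b)"
  unfolding cell_def by (intro compact_Times) auto

lemma interior_cell: "interior (cell n k a b) = ocell n k a b"
  unfolding ocell_def cell_def by (simp add: interior_Times)

lemma grid_step: "0 < n \<Longrightarrow> real a / real n ^ k < (real a + 1) / real n ^ k"
  by (intro divide_strict_right_mono) auto

lemma ocell_nonempty: "0 < n \<Longrightarrow> ocell n k a b \<noteq> {}"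
  unfolding ocell_def using grid_step[of n a k] grid_step[of n b k] by simp

lemma closure_ocell: "0 < n \<Longrightarrow> closure (ocell n k a b) = cell n k a b"
  unfolding ocell_def cell_def using grid_step[of n a k] grid_step[of n b k] by (simp add: closure_Times)

lemma ocell_subset_cell: "ocell n k a b \<subseteq> cell n k a b"
  unfolding ocell_def cell_def by auto

lemma convex_cell: "convex (cell n k a b)" and convex_ocell: "convex (ocell n k a b)"
  unfolding ocell_def cell_def by (intro convex_Times; simp)+

lemma frontier_cell: "frontier (cell n k a b) = rim n k a b"
  by (simp add: frontier_def rim_def interior_cell closed_cell)

lemma frontier_ocell: "0 < n \<Longrightarrow> frontier (ocell n k a b) = rim n k a b"
  by (simp add: frontier_def rim_def closure_ocell interior_open open_ocell)

lemma homeomorphic_rim_sphere: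
  assumes "0 < n" shows "rim n k a b homeomorphic sphere (0::plane) 1"
proof -
  have ne: "interior (cell n k a b) \<noteq> {}" using ocell_nonempty[OF assms] by (simp add: interior_cell)
  have "rel_frontier (cell n k a b) homeomorphic rel_frontier (cball (0::plane) 1)"
    using ne aff_dim_nonempty_interior[OF ne]
    by (intro homeomorphic_rel_frontiers_convex_bounded_sets)
       (auto simp: convex_cell compact_cell compact_imp_bounded aff_dim_cball)
  then show ?thesis
    using ne by (simp add: rel_frontier_nonempty_interior frontier_cell)
qed

lemma cell_0: "cell n 0 0 0 = {0..1} \<times> {0..1}"
  by (simp add: cell_def)

lemma kept_less: "0 < n \<Longrightarrow> kept n R k a b \<Longrightarrow> a < n ^ k \<and> b < n ^ k"
proof (induction k arbitrary: a b)
  case (Suc k)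
  then have "a div n < n ^ k" "b div n < n ^ k" by auto
  then show ?case using Suc.prems(1) by (simp add: div_less_iff_less_mult mult.commute)
qed simp

lemma hole_less: "0 < n \<Longrightarrow> hole n R k a b \<Longrightarrow> a < n ^ k \<and> b < n ^ k"
proof (cases k)
  case (Suc j)
  assume "0 < n" "hole n R k a b"
  then have "a div n < n ^ j" "b div n < n ^ j" using Suc kept_less by auto
  then show ?thesis using \<open>0 < n\<close> Suc by (simp add: div_less_iff_less_mult mult.commute)
qed simp

lemma grid_div:
  fixes n k e a c :: nat
  assumes "0 < n" "real a / real n ^ k < (real c + 1) / real n ^ (k + e)" "real c / real n ^ (k + e) < (real a + 1) / real n ^ k"
  shows "c div n ^ e = a"
proof -
  have "real a * n ^ e < real c + 1" "real c < (real a + 1) * n ^ e"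
    using assms by (simp_all add: power_add field_simps)
  then have "real (a * n ^ e) < real (c + 1)" "real c < real ((a + 1) * n ^ e)" by (simp_all add: algebra_simps)
  then have "a * n ^ e < c + 1" "c < (a + 1) * n ^ e" unfolding of_nat_less_iff by auto
  then show ?thesis by (intro div_nat_eqI) (auto simp: mult.commute)
qed

text \<open>One of the two squares has to be open, since closed grid squares also meet their
  neighbours.\<close>

lemma cell_Int_ocell_div:
  assumes n: "0 < n" and ne: "cell n k a b \<inter> ocell n (k + e) c d \<noteq> {} \<or> ocell n k a b \<inter> cell n (k + e) c d \<noteq> {}"
  shows "c div n ^ e = a \<and> d div n ^ e = b"
proof -
  have "real a / real n ^ k < (real c + 1) / real n ^ (k + e) \<and> real c / real n ^ (k + e) < (real a + 1) / real n ^ k \<and>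
      real b / real n ^ k < (real d + 1) / real n ^ (k + e) \<and> real d / real n ^ (k + e) < (real b + 1) / real n ^ k"
    using ne unfolding cell_def ocell_def by auto
  then show ?thesis using grid_div[OF n] by blast
qed

lemma grid_nested:
  fixes n k e c :: nat
  assumes "0 < n"
  shows "real (c div n ^ e) / real n ^ k \<le> real c / real n ^ (k + e)"
    "(real c + 1) / real n ^ (k + e) \<le> (real (c div n ^ e) + 1) / real n ^ k"
proof -
  let ?q = "c div n ^ e"
  have p: "0 < n ^ e" using assms by simp
  have "?q * n ^ e \<le> c" by simp
  then have 1: "real ?q * n ^ e \<le> c" by (metis of_nat_le_iff of_nat_mult of_nat_power)
  have "c + 1 \<le> (?q + 1) * n ^ e"
    using dividend_less_div_times[OF p, of c] by (simp add: algebra_simps)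
  then have "real (c + 1) \<le> real ((?q + 1) * n ^ e)" by (rule of_nat_mono)
  then have 2: "real c + 1 \<le> (real ?q + 1) * n ^ e" by (simp add: algebra_simps)
  have eq: "x / real n ^ k = x * n ^ e / real n ^ (k + e)" for x :: real
    using assms by (simp add: power_add)
  show "real ?q / real n ^ k \<le> real c / real n ^ (k + e)" "(real c + 1) / real n ^ (k + e) \<le> (real ?q + 1) / real n ^ k"
    unfolding eq using 1 2 by (simp_all add: divide_right_mono)
qed

lemma cell_nested:
  assumes "0 < n"
  shows "cell n (k + e) c d \<subseteq> cell n k (c div n ^ e) (d div n ^ e)"
    "ocell n (k + e) c d \<subseteq> ocell n k (c div n ^ e) (d div n ^ e)"
  using grid_nested[OF assms, where c = c and e = e and k = k]
    grid_nested[OF assms, where c = d and e = e and k = k]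
  unfolding cell_def ocell_def by auto

lemma kept_ancestor: "kept n R (k + e) c d \<Longrightarrow> kept n R k (c div n ^ e) (d div n ^ e)"
proof (induction e arbitrary: c d)
  case (Suc e)
  then have "kept n R (k + e) (c div n) (d div n)" by simp
  then have "kept n R k (c div n div n ^ e) (d div n div n ^ e)" by (rule Suc.IH)
  then show ?case by (simp add: div_mult2_eq)
qed simp

lemma hole_ancestor: "hole n R (k + Suc e) c d \<Longrightarrow> kept n R k (c div n ^ Suc e) (d div n ^ Suc e)"
  using kept_ancestor[of n R k e "c div n" "d div n"] by (simp add: div_mult2_eq)

lemma hole_not_kept: "hole n R k a b \<Longrightarrow> \<not> kept n R k a b"
  by (cases k) auto

lemma hole_disjoint:
  assumes "0 < n" "hole n R k a b" "hole n R k' a' b'" "(k, a, b) \<noteq> (k', a', b')"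
  shows "ocell n k a b \<inter> ocell n k' a' b' = {}"
proof -
  have main: "ocell n k a b \<inter> ocell n (k + e) c d = {}"
    if "hole n R k a b" "hole n R (k + e) c d" "(k, a, b) \<noteq> (k + e, c, d)" for k a b e c d
  proof (rule ccontr)
    assume "\<not> ?thesis"
    then have dv: "c div n ^ e = a \<and> d div n ^ e = b"
      using ocell_subset_cell by (intro cell_Int_ocell_div[OF assms(1)]) blast
    show False
    proof (cases e)
      case 0 then show ?thesis using dv that by simp
    next
      case (Suc e')
      then have "kept n R k a b" using dv hole_ancestor that(2) by blast
      then show ?thesis using hole_not_kept that(1) by blast
    qed
  qed
  show ?thesis
  proof (cases "k \<le> k'")
    case True
    then obtain e where "k' = k + e" using le_Suc_ex by blast
    then show ?thesis using main assms by blast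
  next
    case False
    then obtain e where "k = k' + e" using le_Suc_ex nat_le_linear by blast
    then have "ocell n k' a' b' \<inter> ocell n k a b = {}" using main[of k' a' b' e a b] assms(2-4) by metis
    then show ?thesis by blast
  qed
qed

lemma kept_cell_hole_disjoint:
  assumes "0 < n" "kept n R (k + e) c d" "hole n R k a b"
  shows "cell n (k + e) c d \<inter> ocell n k a b = {}"
proof (rule ccontr)
  assume "\<not> ?thesis"
  then have "c div n ^ e = a \<and> d div n ^ e = b"
    by (intro cell_Int_ocell_div[OF assms(1)]) blast
  then show False using kept_ancestor[OF assms(2)] hole_not_kept[OF assms(3)] by blast
qed

lemma corners_eq:
  assumes "0 < n"
  shows "corners n R k = {(real a / real n ^ k, real b / real n ^ k) | a b. kept n R k a b}"
proof (induction k)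
  case (Suc k)
  have e: "real a / real n ^ k + real i * (1 / real n ^ Suc k) = real (a * n + i) / real n ^ Suc k" for a i
    using assms by (simp add: field_simps)
  have "corners n R (Suc k) = {subcorner (1 / real n ^ Suc k) (real a / real n ^ k, real b / real n ^ k) ij |
      a b ij. kept n R k a b \<and> ij \<in> {..<n} \<times> {..<n} - R}"
    unfolding corners.simps Suc.IH by blast
  also have "\<dots> = {(real a / real n ^ Suc k, real b / real n ^ Suc k) | a b. kept n R (Suc k) a b}"
  proof (intro set_eqI iffI)
    fix z assume "z \<in> {subcorner (1 / real n ^ Suc k) (real a / real n ^ k, real b / real n ^ k) ij |
      a b ij. kept n R k a b \<and> ij \<in> {..<n} \<times> {..<n} - R}"
    then obtain a b ij where h0: "kept n R k a b" "ij \<in> {..<n} \<times> {..<n} - R"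
      "z = subcorner (1 / real n ^ Suc k) (real a / real n ^ k, real b / real n ^ k) ij" by blast
    obtain i j where ij: "ij = (i, j)" by (cases ij)
    have h: "i < n" "j < n" "(i, j) \<notin> R" using h0(2) unfolding ij by auto
    have z: "z = (real (a * n + i) / real n ^ Suc k, real (b * n + j) / real n ^ Suc k)"
      using h0(3) e[of a i] e[of b j] by (simp only: ij subcorner_def fst_conv snd_conv of_nat_power)
    have "kept n R (Suc k) (a * n + i) (b * n + j)" using assms h h0(1) by simp
    then show "z \<in> {(real a / real n ^ Suc k, real b / real n ^ Suc k) | a b. kept n R (Suc k) a b}"
      using z by blast
  next
    fix z assume "z \<in> {(real a / real n ^ Suc k, real b / real n ^ Suc k) | a b. kept n R (Suc k) a b}"
    then obtain a b where h: "kept n R (Suc k) a b" "z = (real a / real n ^ Suc k, real b / real n ^ Suc k)" by blast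
    have "z = subcorner (1 / real n ^ Suc k) (real (a div n) / real n ^ k, real (b div n) / real n ^ k) (a mod n, b mod n)"
      using h(2) e[of "a div n" "a mod n"] e[of "b div n" "b mod n"]
      by (simp only: subcorner_def fst_conv snd_conv of_nat_power div_mult_mod_eq)
    moreover have "(a mod n, b mod n) \<in> {..<n} \<times> {..<n} - R" using h assms by simp
    ultimately show "z \<in> {subcorner (1 / real n ^ Suc k) (real a / real n ^ k, real b / real n ^ k) ij |
      a b ij. kept n R k a b \<and> ij \<in> {..<n} \<times> {..<n} - R}" using h(1) by auto
  qed
  finally show ?case .
qed auto

lemma carpet_stage_eq:
  assumes n: "0 < n" and R: "R \<subseteq> {..<n} \<times> {..<n}"
  shows "carpet_stage n R k = {0..1} \<times> {0..1} - \<Union>{ocell n j a b | j a b. hole n R j a b \<and> j \<le> k}"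
proof (induction k)
  case 0
  have "{ocell n j a b | j a b. hole n R j a b \<and> j \<le> 0} = {}" by auto
  then show ?case by (simp only: carpet_stage.simps) simp
next
  case (Suc k)
  let ?s = "1 / real n ^ Suc k"
  have e: "real a / real n ^ k + real i * ?s = real (a * n + i) / real n ^ Suc k" for a i
    using n by (simp add: field_simps)
  have sq: "interior (square (subcorner ?s (real a / real n ^ k, real b / real n ^ k) (i, j)) ?s)
      = ocell n (Suc k) (a * n + i) (b * n + j)" for a b i j
    unfolding square_def subcorner_def fst_conv snd_conv e
    by (simp add: interior_Times ocell_def add_divide_distrib del: power_Suc)
  have "(\<Union>c \<in> corners n R k. \<Union>ij \<in> R. interior (square (subcorner ?s c ij) ?s))
      = \<Union>{ocell n (Suc k) a b | a b. hole n R (Suc k) a b}" (is "?L = ?R")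
  proof (intro set_eqI iffI)
    fix z assume "z \<in> ?L"
    then obtain a b i j where h: "kept n R k a b" "(i, j) \<in> R"
        "z \<in> interior (square (subcorner ?s (real a / real n ^ k, real b / real n ^ k) (i, j)) ?s)"
      unfolding corners_eq[OF n] by auto
    then have "i < n" "j < n" using R by auto
    then have "hole n R (Suc k) (a * n + i) (b * n + j)" using h n by simp
    then show "z \<in> ?R" using h(3) unfolding sq by blast
  next
    fix z assume "z \<in> ?R"
    then obtain a b where h: "hole n R (Suc k) a b" "z \<in> ocell n (Suc k) a b" by blast
    have "z \<in> interior (square (subcorner ?s (real (a div n) / real n ^ k, real (b div n) / real n ^ k) (a mod n, b mod n)) ?s)"
      unfolding sq using h(2) by simp
    then show "z \<in> ?L" unfolding corners_eq[OF n] using h(1) by (auto simp del: power_Suc)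
  qed
  then have st: "carpet_stage n R (Suc k) = ({0..1} \<times> {0..1} - \<Union>{ocell n j a b | j a b. hole n R j a b \<and> j \<le> k})
      - \<Union>{ocell n (Suc k) a b | a b. hole n R (Suc k) a b}"
    unfolding carpet_stage.simps Suc.IH by (rule arg_cong)
  have "\<Union>{ocell n j a b | j a b. hole n R j a b \<and> j \<le> Suc k}
     = \<Union>{ocell n j a b | j a b. hole n R j a b \<and> j \<le> k} \<union> \<Union>{ocell n (Suc k) a b | a b. hole n R (Suc k) a b}"
    unfolding le_Suc_eq by blast
  then show ?case unfolding st by (simp only: Diff_Un Diff_Int2 set_diff_eq) blast
qed

text \<open>The complement of a family of open connected gaps is the form in which the planar
  topology above applies.\<close>

lemma carpet_eq:
  assumes n: "0 < n" and R: "R \<subseteq> {..<n} \<times> {..<n}"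
  shows "carpet n R = - \<Union>(gaps n R)"
proof -
  have "carpet n R = {0..1} \<times> {0..1} - \<Union>{ocell n j a b | j a b. hole n R j a b}"
    unfolding carpet_def carpet_stage_eq[OF n R] by blast
  then show ?thesis unfolding gaps_def cell_0 by auto
qed

lemma hole_subset_unit: "0 < n \<Longrightarrow> hole n R k a b \<Longrightarrow> cell n k a b \<subseteq> cell n 0 0 0"
  using cell_nested(1)[of n 0 k a b] hole_less[of n R k a b] by simp

lemma kept_subset_unit: "0 < n \<Longrightarrow> kept n R k a b \<Longrightarrow> cell n k a b \<subseteq> cell n 0 0 0"
  using cell_nested(1)[of n 0 k a b] kept_less[of n R k a b] by simp

lemma gaps_open: "H \<in> gaps n R \<Longrightarrow> open H"
  unfolding gaps_def using open_ocell closed_cell by (auto simp: open_Compl)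

lemma gaps_connected: "H \<in> gaps n R \<Longrightarrow> connected H"
  unfolding gaps_def using convex_connected[OF convex_ocell]
    connected_complement_bounded_convex[OF compact_imp_bounded[OF compact_cell] convex_cell]
  by auto

lemma gaps_disjoint: "0 < n \<Longrightarrow> pairwise disjnt (gaps n R)"
proof -
  assume n: "0 < n"
  have u: "ocell n k a b \<inter> - cell n 0 0 0 = {}" if "hole n R k a b" for k a b
    using hole_subset_unit[OF n that] ocell_subset_cell by blast
  show ?thesis
    unfolding pairwise_def disjnt_def
  proof (intro ballI impI)
    fix X Y assume XY: "X \<in> gaps n R" "Y \<in> gaps n R" "X \<noteq> Y"
    consider "X = - cell n 0 0 0" "\<exists>k a b. hole n R k a b \<and> Y = ocell n k a b"
      | "Y = - cell n 0 0 0" "\<exists>k a b. hole n R k a b \<and> X = ocell n k a b"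
      | k a b k' a' b' where "hole n R k a b" "X = ocell n k a b" "hole n R k' a' b'" "Y = ocell n k' a' b'"
      using XY unfolding gaps_def by blast
    then show "X \<inter> Y = {}"
    proof cases
      case 3
      then show ?thesis using hole_disjoint[OF n 3(1) 3(3)] XY(3) by blast
    qed (use u in blast)+
  qed
qed

text \<open>There is no hole of level 0, so the index \<open>(0, 0, 0)\<close> is free for the outer
  circle.\<close>

definition rim_index :: "nat \<Rightarrow> (nat \<times> nat) set \<Rightarrow> nat \<Rightarrow> nat \<Rightarrow> nat \<Rightarrow> bool" where
  "rim_index n R k a b \<longleftrightarrow> hole n R k a b \<or> k = 0 \<and> a = 0 \<and> b = 0"

lemma frontier_gap:
  assumes n: "0 < n" and H: "H \<in> gaps n R"
  shows "\<exists>k a b. rim_index n R k a b \<and> frontier H = rim n k a b"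
proof (cases "H = - cell n 0 0 0")
  case True
  then have "frontier H = rim n 0 0 0" by (simp only: frontier_complement frontier_cell)
  then show ?thesis unfolding rim_index_def by blast
next
  case False
  then obtain k a b where "hole n R k a b" "H = ocell n k a b" using H unfolding gaps_def by blast
  then show ?thesis using frontier_ocell[OF n] unfolding rim_index_def by metis
qed

lemma rim_is_frontier_gap:
  assumes n: "0 < n" and r: "rim_index n R k a b"
  shows "\<exists>H\<in>gaps n R. frontier H = rim n k a b"
proof (cases "hole n R k a b")
  case True
  then have "ocell n k a b \<in> gaps n R" unfolding gaps_def by blast
  then show ?thesis using frontier_ocell[OF n] by blast
next
  case False
  then have "k = 0" "a = 0" "b = 0" using r unfolding rim_index_def by auto
  moreover have "- cell n 0 0 0 \<in> gaps n R" unfolding gaps_def by blast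
  ultimately show ?thesis using frontier_complement frontier_cell by metis
qed

lemma rim_subset_carpet:
  assumes n: "0 < n" and R: "R \<subseteq> {..<n} \<times> {..<n}" and "rim_index n R k a b"
  shows "rim n k a b \<subseteq> carpet n R"
proof -
  obtain H where "H \<in> gaps n R" "frontier H = rim n k a b" using rim_is_frontier_gap[OF n assms(3)] by blast
  then show ?thesis
    using frontier_subset_complement[of "gaps n R" H] gaps_open gaps_disjoint[OF n] carpet_eq[OF n R]
    by metis
qed

text \<open>Valid for every pattern \<open>R\<close>, in particular for that of \<open>F\<close>.
  The converse relies on disjoint closed holes and is shown for the odd carpets in
  \<open>rim_peripheral\<close>.\<close>

lemma peripheral_carpet_imp:
  assumes n: "0 < n" and R: "R \<subseteq> {..<n} \<times> {..<n}" and J: "peripheral (carpet n R) J"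
  shows "\<exists>k a b. rim_index n R k a b \<and> J = rim n k a b"
proof -
  have "\<exists>H\<in>gaps n R. J = frontier H"
    using J unfolding peripheral_def carpet_eq[OF n R]
    by (intro nonseparating_circle_is_frontier[OF _ gaps_open gaps_connected gaps_disjoint[OF n]]) auto
  then show ?thesis using frontier_gap[OF n] by metis
qed

lemma compact_carpet:
  assumes n: "0 < n" and R: "R \<subseteq> {..<n} \<times> {..<n}"
  shows "compact (carpet n R)"
proof -
  have "closed (carpet n R)" unfolding carpet_eq[OF n R] using gaps_open by (intro closed_Compl open_Union) auto
  moreover have "carpet n R \<subseteq> cell n 0 0 0" unfolding carpet_eq[OF n R] gaps_def by auto
  ultimately show ?thesis using compact_cell by (metis Int_absorb1 closed_Int_compact inf_commute)
qed

section \<open>Self-similarity and the standard carpet\<close>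

lemma kept_split:
  assumes "a < n ^ e" "b < n ^ e"
  shows "kept n R (k + e) (i * n ^ e + a) (j * n ^ e + b) \<longleftrightarrow> kept n R k i j \<and> kept n R e a b"
  using assms
proof (induction e arbitrary: a b)
  case (Suc e)
  have n: "0 < n" using Suc.prems by (cases n) auto
  have s: "(i * n ^ Suc e + a) div n = i * n ^ e + a div n" "(i * n ^ Suc e + a) mod n = a mod n" for i a
    using n by (simp_all add: mult.left_commute[of _ n])
  have l: "a div n < n ^ e" "b div n < n ^ e"
    using Suc.prems n by (simp_all add: div_less_iff_less_mult mult.commute)
  show ?case unfolding add_Suc_right kept.simps s Suc.IH[OF l] by auto
qed simp

text \<open>Digit strings are concatenated. The second string must be nonempty because the last
  digit decides about being a hole.\<close>

lemma hole_split:
  assumes "a < n ^ Suc e" "b < n ^ Suc e"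
  shows "hole n R (k + Suc e) (i * n ^ Suc e + a) (j * n ^ Suc e + b) \<longleftrightarrow> kept n R k i j \<and> hole n R (Suc e) a b"
proof -
  have n: "0 < n" using assms by (cases n) auto
  have s: "(i * n ^ Suc e + a) div n = i * n ^ e + a div n" "(i * n ^ Suc e + a) mod n = a mod n" for i a
    using n by (simp_all add: mult.left_commute[of _ n])
  have l: "a div n < n ^ e" "b div n < n ^ e"
    using assms n by (simp_all add: div_less_iff_less_mult mult.commute)
  show ?thesis unfolding add_Suc_right hole.simps s kept_split[OF l] by auto
qed

definition zoom :: "nat \<Rightarrow> nat \<Rightarrow> nat \<Rightarrow> nat \<Rightarrow> plane \<Rightarrow> plane" where
  "zoom n k i j z = ((real i + fst z) / real n ^ k, (real j + snd z) / real n ^ k)"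

definition unzoom :: "nat \<Rightarrow> nat \<Rightarrow> nat \<Rightarrow> nat \<Rightarrow> plane \<Rightarrow> plane" where
  "unzoom n k i j z = (real n ^ k * fst z - real i, real n ^ k * snd z - real j)"

lemma unzoom_zoom: "0 < n \<Longrightarrow> unzoom n k i j (zoom n k i j z) = z"
  by (simp add: zoom_def unzoom_def)

lemma zoom_unzoom: "0 < n \<Longrightarrow> zoom n k i j (unzoom n k i j z) = z"
  by (simp add: zoom_def unzoom_def)

lemma dist_zoom: "0 < n \<Longrightarrow> dist (zoom n k i j x) (zoom n k i j y) = dist x y / real n ^ k"
proof -
  assume n: "0 < n"
  have "dist ((real i + a) / real n ^ k) ((real i + b) / real n ^ k) = dist a b / real n ^ k" for i :: nat and a b :: real
    using n by (simp add: dist_real_def diff_divide_distrib[symmetric])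
  then show ?thesis
    using n unfolding zoom_def dist_prod_def
    by (simp add: power_divide add_divide_distrib[symmetric] real_sqrt_divide)
qed

lemma continuous_zoom: "0 < n \<Longrightarrow> continuous_on X (zoom n k i j)"
  unfolding zoom_def by (intro continuous_intros) auto

lemma continuous_unzoom: "continuous_on X (unzoom n k i j)"
  unfolding unzoom_def by (intro continuous_intros)

lemma zoom_coord:
  fixes x :: real
  assumes "0 < n"
  shows "real (i * n ^ e + a) / real n ^ (k + e) \<le> (real i + x) / real n ^ k \<longleftrightarrow> real a / real n ^ e \<le> x"
    "real (i * n ^ e + a) / real n ^ (k + e) < (real i + x) / real n ^ k \<longleftrightarrow> real a / real n ^ e < x"
    "(real i + x) / real n ^ k \<le> (real (i * n ^ e + a) + 1) / real n ^ (k + e) \<longleftrightarrow> x \<le> (real a + 1) / real n ^ e"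
    "(real i + x) / real n ^ k < (real (i * n ^ e + a) + 1) / real n ^ (k + e) \<longleftrightarrow> x < (real a + 1) / real n ^ e"
proof -
  have e: "(real (i * n ^ e + a) + t) / real n ^ (k + e) = (real i + (real a + t) / real n ^ e) / real n ^ k" for t :: real
    using assms by (simp add: power_add field_simps)
  have p: "0 < real n ^ k" using assms by simp
  show "real (i * n ^ e + a) / real n ^ (k + e) \<le> (real i + x) / real n ^ k \<longleftrightarrow> real a / real n ^ e \<le> x"
    "real (i * n ^ e + a) / real n ^ (k + e) < (real i + x) / real n ^ k \<longleftrightarrow> real a / real n ^ e < x"
    using e[of 0] p by (simp_all add: divide_le_cancel divide_less_cancel)
  show "(real i + x) / real n ^ k \<le> (real (i * n ^ e + a) + 1) / real n ^ (k + e) \<longleftrightarrow> x \<le> (real a + 1) / real n ^ e"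
    "(real i + x) / real n ^ k < (real (i * n ^ e + a) + 1) / real n ^ (k + e) \<longleftrightarrow> x < (real a + 1) / real n ^ e"
    unfolding e using p by (simp_all add: divide_le_cancel divide_less_cancel)
qed

lemma zoom_mem_cell:
  "0 < n \<Longrightarrow> zoom n k i j z \<in> cell n (k + e) (i * n ^ e + a) (j * n ^ e + b) \<longleftrightarrow> z \<in> cell n e a b"
  by (simp only: cell_def zoom_def mem_Times_iff fst_conv snd_conv atLeastAtMost_iff zoom_coord)

lemma zoom_mem_ocell:
  "0 < n \<Longrightarrow> zoom n k i j z \<in> ocell n (k + e) (i * n ^ e + a) (j * n ^ e + b) \<longleftrightarrow> z \<in> ocell n e a b"
  by (simp only: ocell_def zoom_def mem_Times_iff fst_conv snd_conv greaterThanLessThan_iff zoom_coord)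

lemma zoom_image_eqI:
  assumes "0 < n" "\<And>z. zoom n k i j z \<in> B \<longleftrightarrow> z \<in> A"
  shows "zoom n k i j ` A = B"
proof (intro set_eqI iffI)
  fix w assume "w \<in> B"
  then show "w \<in> zoom n k i j ` A"
    using assms(2)[of "unzoom n k i j w"] zoom_unzoom[OF assms(1), of k i j w] by (metis image_eqI)
qed (use assms in auto)

lemma zoom_rim:
  "0 < n \<Longrightarrow> zoom n k i j ` rim n e a b = rim n (k + e) (i * n ^ e + a) (j * n ^ e + b)"
  by (rule zoom_image_eqI) (auto simp: rim_def zoom_mem_cell zoom_mem_ocell)

lemma zoom_mem_cell0: "0 < n \<Longrightarrow> zoom n k i j z \<in> cell n k i j \<longleftrightarrow> z \<in> cell n 0 0 0"
  using zoom_mem_cell[of n k i j z 0 0 0] by simp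

lemma zoom_mem_ocell0: "0 < n \<Longrightarrow> zoom n k i j z \<in> ocell n k i j \<longleftrightarrow> z \<in> ocell n 0 0 0"
  using zoom_mem_ocell[of n k i j z 0 0 0] by simp

text \<open>Neither a kept square nor an ancestor of it is a hole. A hole that overlaps the square
  is therefore a proper descendant, and its trailing digits describe a hole of the whole
  carpet.\<close>

lemma hole_zoom_cases:
  assumes n: "0 < n" and R: "kept n R k i j" and h: "hole n R k' a b"
    and ne: "cell n k i j \<inter> ocell n k' a b \<noteq> {} \<or> ocell n k i j \<inter> cell n k' a b \<noteq> {}"
  obtains e a0 b0 where "hole n R e a0 b0" "k' = k + e" "a = i * n ^ e + a0" "b = j * n ^ e + b0"
proof (cases "k' \<le> k")
  case True
  then obtain e where e: "k = k' + e" using le_Suc_ex by blast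
  have "i div n ^ e = a \<and> j div n ^ e = b" using ne unfolding e by (intro cell_Int_ocell_div[OF n]) blast
  then have "kept n R k' a b" using kept_ancestor[of n R k' e i j] R e by auto
  then show ?thesis using hole_not_kept[OF h] by blast
next
  case False
  then obtain e where e: "k' = k + Suc e" by (metis add_Suc_right less_iff_Suc_add not_le)
  have dv: "a div n ^ Suc e = i \<and> b div n ^ Suc e = j" using ne unfolding e by (intro cell_Int_ocell_div[OF n])
  have p: "0 < n ^ Suc e" using n by simp
  have ab: "a = i * n ^ Suc e + a mod n ^ Suc e" "b = j * n ^ Suc e + b mod n ^ Suc e"
    using dv div_mult_mod_eq by metis+
  have "hole n R (Suc e) (a mod n ^ Suc e) (b mod n ^ Suc e)"
    using h ab hole_split[of "a mod n ^ Suc e" n e "b mod n ^ Suc e" R k i j] p e by auto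
  then show ?thesis using that e ab by blast
qed

lemma carpet_Int_cell:
  assumes n: "0 < n" and R: "R \<subseteq> {..<n} \<times> {..<n}" and k: "kept n R k i j"
  shows "carpet n R \<inter> cell n k i j = zoom n k i j ` carpet n R"
proof (rule zoom_image_eqI[OF n, symmetric])
  have iff: "z \<in> carpet n R \<longleftrightarrow> z \<in> cell n 0 0 0 \<and> (\<forall>k a b. hole n R k a b \<longrightarrow> z \<notin> ocell n k a b)" for z
    unfolding carpet_eq[OF n R] gaps_def by blast
  fix z
  show "zoom n k i j z \<in> carpet n R \<inter> cell n k i j \<longleftrightarrow> z \<in> carpet n R"
  proof
    assume l: "zoom n k i j z \<in> carpet n R \<inter> cell n k i j"
    have "z \<notin> ocell n e a b" if h: "hole n R e a b" for e a b
    proof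
      assume "z \<in> ocell n e a b"
      then have z: "zoom n k i j z \<in> ocell n (k + e) (i * n ^ e + a) (j * n ^ e + b)"
        using zoom_mem_ocell[OF n] by blast
      obtain e' where e': "e = Suc e'" using h by (cases e) auto
      have "hole n R (k + e) (i * n ^ e + a) (j * n ^ e + b)"
        unfolding e' using hole_split[of a n e' b R k i j] hole_less[OF n h] h k e' by auto
      then show False using z l iff by blast
    qed
    then show "z \<in> carpet n R" using l zoom_mem_cell0[OF n] iff by blast
  next
    assume r: "z \<in> carpet n R"
    then have c: "zoom n k i j z \<in> cell n k i j" using iff zoom_mem_cell0[OF n] by blast
    have "zoom n k i j z \<notin> ocell n k' a b" if h: "hole n R k' a b" for k' a b
    proof
      assume z: "zoom n k i j z \<in> ocell n k' a b"
      then obtain e a0 b0 where e: "hole n R e a0 b0" "k' = k + e" "a = i * n ^ e + a0" "b = j * n ^ e + b0"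
        using hole_zoom_cases[OF n k h] c by blast
      then have "z \<in> ocell n e a0 b0" using z zoom_mem_ocell[OF n] by metis
      then show False using r iff e(1) by blast
    qed
    then show "zoom n k i j z \<in> carpet n R \<inter> cell n k i j"
      using c iff kept_subset_unit[OF n k] by blast
  qed
qed

lemma rim_Int_ocell:
  assumes n: "0 < n" and k: "kept n R k i j" and C: "rim_index n R k' a b"
    and ne: "rim n k' a b \<inter> ocell n k i j \<noteq> {}"
  shows "\<exists>e a0 b0. hole n R e a0 b0 \<and> rim n k' a b = zoom n k i j ` rim n e a0 b0"
proof -
  have "ocell n k i j \<subseteq> ocell n 0 0 0"
    using cell_nested(2)[OF n, of 0 k i j] kept_less[OF n k] by simp
  then have "hole n R k' a b"
    using C ne unfolding rim_index_def rim_def by blast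
  then obtain e a0 b0 where "hole n R e a0 b0" "k' = k + e" "a = i * n ^ e + a0" "b = j * n ^ e + b0"
    using hole_zoom_cases[OF n k] ne unfolding rim_def by blast
  then show ?thesis using zoom_rim[OF n] by metis
qed

section \<open>Separation of the holes and peripheral circles of the standard carpet\<close>

locale odd_carpet =
  fixes m d :: nat
  assumes m: "m = 2 * d + 1" and d: "1 \<le> d"
begin

abbreviation "mid \<equiv> {(d, d)}"
abbreviation "S \<equiv> carpet m {(d, d)}"
abbreviation "outer \<equiv> rim m 0 0 0"
abbreviation "middle \<equiv> rim m 1 d d"

lemma m0: "0 < m" using m by simp
lemma mid: "mid \<subseteq> {..<m} \<times> {..<m}" using m by auto
lemma dm: "real m = 2 * real d + 1" using m by simp

lemma compact_S: "compact S" using compact_carpet[OF m0 mid] .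

lemma S_iff: "z \<in> S \<longleftrightarrow> z \<in> cell m 0 0 0 \<and> (\<forall>k a b. hole m mid k a b \<longrightarrow> z \<notin> ocell m k a b)"
  unfolding carpet_eq[OF m0 mid] gaps_def by blast

text \<open>The assumption \<open>1 \<le> d\<close> leaves a margin of \<open>d\<close> squares
  around the middle one. As a consequence closed holes are disjoint from each other and from the
  outer circle, as \<open>connected_minus_frontier\<close> demands.\<close>

lemma hole_in_parent:
  assumes "hole m mid (Suc k) a b"
  shows "cell m (Suc k) a b \<subseteq> ocell m k (a div m) (b div m)"
proof -
  have c: "real (a div m) / real m ^ k < real a / real m ^ Suc k \<and> (real a + 1) / real m ^ Suc k < (real (a div m) + 1) / real m ^ k"
    if "a mod m = d" for a
  proof -
    have "a = a div m * m + d" using that div_mult_mod_eq by metis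
    then have "real a = real (a div m) * m + d" by (metis of_nat_add of_nat_mult)
    then have "real (a div m) * m < real a" "real a + 1 < (real (a div m) + 1) * m"
      using d dm by (simp_all add: algebra_simps)
    moreover have "real (a div m) / real m ^ k = real (a div m) * m / real m ^ Suc k"
      "(real (a div m) + 1) / real m ^ k = (real (a div m) + 1) * m / real m ^ Suc k"
      using m0 by simp_all
    ultimately show ?thesis using m0 by (simp only: divide_strict_right_mono of_nat_0_less_iff zero_less_power)
  qed
  show ?thesis using c[of a] c[of b] assms unfolding cell_def ocell_def by auto
qed

lemma hole_cells_disjoint:
  assumes "hole m mid k a b" "hole m mid k' a' b'" "(k, a, b) \<noteq> (k', a', b')"
  shows "cell m k a b \<inter> cell m k' a' b' = {}"
proof -
  have main: "cell m k a b \<inter> cell m (k + e) a' b' = {}"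
    if h: "hole m mid k a b" "hole m mid (k + e) a' b'" "(k, a, b) \<noteq> (k + e, a', b')" for k a b e a' b'
  proof (rule ccontr)
    assume ne: "\<not> ?thesis"
    obtain k0 where k0: "k = Suc k0" using h(1) by (cases k) auto
    show False
    proof (cases e)
      case 0
      have "ocell m k0 (a div m) (b div m) \<inter> cell m (k0 + 0) (a' div m) (b' div m) \<noteq> {}"
        using ne hole_in_parent[of k0 a b] h cell_nested(1)[OF m0, of k0 1 a' b'] unfolding k0 0 by auto
      then have "a' div m = a div m \<and> b' div m = b div m"
        using cell_Int_ocell_div[OF m0, of k0 "a div m" "b div m" 0 "a' div m" "b' div m"] by auto
      then have "a' = a" "b' = b" using h k0 0 by (metis div_mult_mod_eq hole.simps(2) add_0_right prod.inject singletonD)+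
      then show False using h(3) 0 by simp
    next
      case (Suc e')
      have "hole m mid (Suc (k + e')) a' b'" using h(2) Suc by simp
      then have "cell m k a b \<inter> ocell m (k + e') (a' div m) (b' div m) \<noteq> {}"
        using ne hole_in_parent[of "k + e'" a' b'] Suc by auto
      then have "a' div m div m ^ e' = a \<and> b' div m div m ^ e' = b"
        by (intro cell_Int_ocell_div[OF m0]) blast
      moreover have "kept m mid k (a' div m div m ^ e') (b' div m div m ^ e')"
        using hole_ancestor[of m mid k e' a' b'] h(2) Suc by (simp add: div_mult2_eq)
      ultimately show False using hole_not_kept h(1) by auto
    qed
  qed
  show ?thesis
  proof (cases "k \<le> k'")
    case True
    then obtain e where "k' = k + e" using le_Suc_ex by blast
    then show ?thesis using main assms by blast
  next
    case False
    then obtain e where e: "k = k' + e" using le_Suc_ex nat_le_linear by blast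
    then have "cell m k' a' b' \<inter> cell m k a b = {}" using main[of k' a' b' e a b] assms by metis
    then show ?thesis by blast
  qed
qed

lemma hole_cell_in_open_unit: "hole m mid k a b \<Longrightarrow> cell m k a b \<subseteq> ocell m 0 0 0"
proof -
  assume h: "hole m mid k a b"
  then obtain k0 where k0: "k = Suc k0" by (cases k) auto
  have "kept m mid k0 (a div m) (b div m)" using h k0 by simp
  then have "ocell m k0 (a div m) (b div m) \<subseteq> ocell m 0 0 0"
    using cell_nested(2)[OF m0, of 0 k0 "a div m" "b div m"] kept_less[OF m0] by fastforce
  then show ?thesis using hole_in_parent h k0 by blast
qed

lemma rim_peripheral:
  assumes "rim_index m mid k a b"
  shows "peripheral S (rim m k a b)"
proof -
  obtain H where H: "H \<in> gaps m mid" "frontier H = rim m k a b"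
    using rim_is_frontier_gap[OF m0 assms] by blast
  have out: "closure (- cell m 0 0 0) = - ocell m 0 0 0"
    by (simp add: closure_complement interior_cell)
  have "connected (- \<Union>(gaps m mid) - frontier H)"
  proof (rule connected_minus_frontier[OF gaps_open _ _ H(1)])
    fix H' assume "H' \<in> gaps m mid"
    then obtain k a b where r: "frontier H' = rim m k a b" using frontier_gap[OF m0] by blast
    have hs: "rim m k a b homeomorphic sphere (0::plane) 1" using homeomorphic_rim_sphere[OF m0] .
    moreover have "connected (sphere (0::plane) 1)" by (simp add: connected_sphere)
    ultimately show "connected (frontier H') \<and> frontier H' \<noteq> {}"
      using r homeomorphic_connectedness[OF hs] homeomorphic_empty(1) by (metis sphere_eq_empty homeomorphic_sym not_one_less_zero)
  next
    fix H H' assume HH: "H \<in> gaps m mid" "H' \<in> gaps m mid" "H \<noteq> H'"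
    consider "H = - cell m 0 0 0" "\<exists>k a b. hole m mid k a b \<and> H' = ocell m k a b"
      | "H' = - cell m 0 0 0" "\<exists>k a b. hole m mid k a b \<and> H = ocell m k a b"
      | k a b k' a' b' where "hole m mid k a b" "H = ocell m k a b" "hole m mid k' a' b'" "H' = ocell m k' a' b'"
      using HH unfolding gaps_def by blast
    then show "closure H \<inter> closure H' = {}"
    proof cases
      case 3
      then have "(k, a, b) \<noteq> (k', a', b')" using HH by blast
      then show ?thesis using 3 hole_cells_disjoint closure_ocell[OF m0] by metis
    next
      case 1
      then obtain k a b where h: "hole m mid k a b" "H' = ocell m k a b" by blast
      have "closure H = - ocell m 0 0 0" using 1 out by simp
      moreover have "closure H' = cell m k a b" using h closure_ocell[OF m0] by simp
      ultimately show ?thesis using hole_cell_in_open_unit[OF h(1)] by blast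
    next
      case 2
      then obtain k a b where h: "hole m mid k a b" "H = ocell m k a b" by blast
      have "closure H' = - ocell m 0 0 0" using 2 out by simp
      moreover have "closure H = cell m k a b" using h closure_ocell[OF m0] by simp
      ultimately show ?thesis using hole_cell_in_open_unit[OF h(1)] by blast
    qed
  next
    show "connected (- closure H)"
    proof (cases "H = - cell m 0 0 0")
      case True
      then show ?thesis using out convex_connected[OF convex_ocell] by simp
    next
      case False
      then obtain k a b where "H = ocell m k a b" using H(1) unfolding gaps_def by blast
      then show ?thesis using closure_ocell[OF m0]
          connected_complement_bounded_convex[OF compact_imp_bounded[OF compact_cell] convex_cell] by simp
    qed
  qed
  then show ?thesis
    unfolding peripheral_def carpet_eq[OF m0 mid] H(2)
    using rim_subset_carpet[OF m0 mid assms] homeomorphic_rim_sphere[OF m0] carpet_eq[OF m0 mid] by auto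
qed

lemma peripheral_iff: "peripheral S C \<longleftrightarrow> (\<exists>k a b. rim_index m mid k a b \<and> C = rim m k a b)"
  using rim_peripheral peripheral_carpet_imp[OF m0 mid] by blast

lemma hole_middle: "hole m mid 1 d d"
  using m by simp

lemma peripheral_outer: "peripheral S outer"
  by (rule rim_peripheral) (simp add: rim_index_def)

lemma peripheral_middle: "peripheral S middle"
  by (rule rim_peripheral) (use hole_middle in \<open>simp only: rim_index_def simp_thms\<close>)

text \<open>A single subdivision has to be examined; self-similarity carries the result to all
  levels.\<close>

lemma S_subset_cells: "S \<subseteq> \<Union>{cell m k a b | a b. kept m mid k a b}"
proof (induction k)
  case 0
  then show ?case using S_iff by auto
next
  case (Suc k)
  have one: "\<exists>a<m. real a / m \<le> x \<and> x \<le> (real a + 1) / m" if x: "0 \<le> x" "x \<le> 1" for x :: real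
  proof (cases "x = 1")
    case True
    then show ?thesis using m0 by (intro exI[of _ "m - 1"]) (simp add: of_nat_diff field_simps)
  next
    case False
    have f: "0 \<le> \<lfloor>x * m\<rfloor>" using x by simp
    have "x * m < m" using x False m0 by simp
    then have "\<lfloor>x * m\<rfloor> < int m" by (simp add: floor_less_iff)
    then have "nat \<lfloor>x * m\<rfloor> < m" using f by linarith
    moreover have "real (nat \<lfloor>x * m\<rfloor>) \<le> x * m" "x * m \<le> real (nat \<lfloor>x * m\<rfloor>) + 1"
      using f by simp_all
    ultimately show ?thesis using m0 by (intro exI[of _ "nat \<lfloor>x * m\<rfloor>"]) (simp add: field_simps)
  qed
  have level1: "\<exists>a b. kept m mid 1 a b \<and> z \<in> cell m 1 a b" if z: "z \<in> S" for z
  proof -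
    obtain x y where xy: "z = (x, y)" by (cases z)
    have b: "0 \<le> x" "x \<le> 1" "0 \<le> y" "y \<le> 1" using z S_iff[of z] by (auto simp: cell_0 xy)
    obtain a where a: "a < m" "real a / m \<le> x" "x \<le> (real a + 1) / m" using one[OF b(1,2)] by blast
    obtain c where c: "c < m" "real c / m \<le> y" "y \<le> (real c + 1) / m" using one[OF b(3,4)] by blast
    have k1: "kept m mid 1 a c" if "a < m" "c < m" "(a, c) \<noteq> (d, d)" for a c using that by simp
    show ?thesis
    proof (cases "(a, c) = (d, d)")
      case False
      then show ?thesis using k1[OF a(1) c(1)] a c by (intro exI[of _ a] exI[of _ c]) (simp add: cell_def xy)
    next
      case True
      \<comment> \<open>Rounding has put the point into the removed square, so it lies on the
        boundary of the hole and also belongs to a kept neighbour.\<close>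
      have "z \<notin> ocell m 1 d d" using z S_iff hole_middle by blast
      then consider "x = real d / m" | "x = (real d + 1) / m" | "y = real d / m" | "y = (real d + 1) / m"
        using a c True by (fastforce simp: ocell_def xy)
      then show ?thesis
      proof cases
        case 1
        have "z \<in> cell m 1 (d - 1) d" using 1 c True d m0 by (simp add: cell_def xy of_nat_diff divide_right_mono)
        then show ?thesis using k1[of "d - 1" d] d m by (intro exI) auto
      next
        case 2
        have "z \<in> cell m 1 (d + 1) d" using 2 c True d m0 by (simp add: cell_def xy divide_right_mono add.commute)
        then show ?thesis using k1[of "d + 1" d] d m by (intro exI) auto
      next
        case 3
        have "z \<in> cell m 1 d (d - 1)" using 3 a True d m0 by (simp add: cell_def xy of_nat_diff divide_right_mono)
        then show ?thesis using k1[of d "d - 1"] d m by (intro exI) auto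
      next
        case 4
        have "z \<in> cell m 1 d (d + 1)" using 4 a True d m0 by (simp add: cell_def xy divide_right_mono add.commute)
        then show ?thesis using k1[of d "d + 1"] d m by (intro exI) auto
      qed
    qed
  qed
  show ?case
  proof
    fix z assume z: "z \<in> S"
    then obtain a b where ab: "kept m mid k a b" "z \<in> cell m k a b" using Suc by blast
    then obtain w where w: "w \<in> S" "z = zoom m k a b w" using carpet_Int_cell[OF m0 mid ab(1)] z by blast
    obtain a' b' where ab': "kept m mid 1 a' b'" "w \<in> cell m 1 a' b'" using level1[OF w(1)] by blast
    have "kept m mid (k + 1) (a * m ^ 1 + a') (b * m ^ 1 + b')"
      using kept_split[of a' m 1 b' mid k a b] kept_less[OF m0 ab'(1)] ab(1) ab'(1) by blast
    moreover have "z \<in> cell m (k + 1) (a * m ^ 1 + a') (b * m ^ 1 + b')"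
      using zoom_mem_cell[OF m0] w(2) ab'(2) by blast
    ultimately show "z \<in> \<Union>{cell m (Suc k) a b | a b. kept m mid (Suc k) a b}"
      unfolding Suc_eq_plus1 by blast
  qed
qed

end

section \<open>Covers and energies in the standard carpet\<close>

lemma dist_le_sum_coords: "dist (x::plane) y \<le> \<bar>fst x - fst y\<bar> + \<bar>snd x - snd y\<bar>"
  unfolding dist_prod_def by (simp add: dist_real_def sqrt_sum_squares_le_sum_abs)

lemma cell_dist: "x \<in> cell n k a b \<Longrightarrow> y \<in> cell n k a b \<Longrightarrow> dist x y \<le> 2 / real n ^ k"
proof -
  assume x: "x \<in> cell n k a b" and y: "y \<in> cell n k a b"
  have "\<bar>s - t\<bar> \<le> 1 / real n ^ k" if "real a / real n ^ k \<le> s" "s \<le> (real a + 1) / real n ^ k"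
    "real a / real n ^ k \<le> t" "t \<le> (real a + 1) / real n ^ k" for a :: nat and s t :: real
    using that by (simp add: add_divide_distrib)
  then have "\<bar>fst x - fst y\<bar> \<le> 1 / real n ^ k" "\<bar>snd x - snd y\<bar> \<le> 1 / real n ^ k"
    using x y unfolding cell_def by auto
  then show ?thesis using dist_le_sum_coords[of x y] by simp
qed

lemma cell_eq_cbox:
  "cell n k a b = cbox (real a / real n ^ k, real b / real n ^ k) ((real a + 1) / real n ^ k, (real b + 1) / real n ^ k)"
  by (simp add: cell_def cbox_Pair_eq)

lemma measure_plane_cbox:
  fixes a b c e :: real
  assumes "a \<le> c" "b \<le> e"
  shows "measure lborel (cbox (a, b) (c, e)) = (c - a) * (e - b)"
  using assms by (simp add: content_Pair)

lemma measure_cell: "0 < n \<Longrightarrow> measure lborel (cell n k a b) = (1 / real n ^ k)\<^sup>2"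
  unfolding cell_eq_cbox using grid_step[of n a k] grid_step[of n b k]
  by (subst measure_plane_cbox) (auto simp: power2_eq_square add_divide_distrib)

lemma sum_Un_le:
  fixes f :: "'a \<Rightarrow> real"
  assumes "finite A" "finite B" "\<And>x. 0 \<le> f x"
  shows "sum f (A \<union> B) \<le> sum f A + sum f B"
  using sum.union_inter[OF assms(1,2), of f] sum_nonneg[of "A \<inter> B" f] assms(3) by simp

lemma ocell_eqD: "0 < n \<Longrightarrow> z \<in> ocell n k a b \<Longrightarrow> z \<in> cell n k a' b' \<Longrightarrow> a = a' \<and> b = b'"
  using cell_Int_ocell_div[of n k a b 0 a' b'] by auto

context odd_carpet
begin

definition kept_set :: "nat \<Rightarrow> (nat \<times> nat) set" where
  "kept_set k = {(a, b). kept m mid k a b}"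

lemma finite_kept_set: "finite (kept_set k)"
proof (rule finite_subset)
  show "kept_set k \<subseteq> {..<m ^ k} \<times> {..<m ^ k}" unfolding kept_set_def using kept_less[OF m0] by blast
qed simp

lemma card_kept_set: "card (kept_set k) \<le> (m\<^sup>2 - 1) ^ k"
proof (induction k)
  case 0
  have "kept_set 0 = {(0, 0)}" unfolding kept_set_def by auto
  then show ?case by simp
next
  case (Suc k)
  let ?f = "\<lambda>(a, b). ((a div m, b div m), (a mod m, b mod m))"
  let ?T = "kept_set k \<times> ({..<m} \<times> {..<m} - mid)"
  have "inj_on ?f (kept_set (Suc k))"
    by (rule inj_onI) (auto, (metis div_mult_mod_eq)+)
  moreover have "?f ` kept_set (Suc k) \<subseteq> ?T" unfolding kept_set_def using m0 by auto
  moreover have "finite ?T" using finite_kept_set by simp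
  ultimately have "card (kept_set (Suc k)) \<le> card ?T" by (rule card_inj_on_le)
  also have "\<dots> = card (kept_set k) * (m\<^sup>2 - 1)"
    using mid by (simp add: card_cartesian_product card_Diff_subset power2_eq_square)
  also have "\<dots> \<le> (m\<^sup>2 - 1) ^ Suc k" using Suc by simp
  finally show ?case .
qed

text \<open>The lower left corner of the middle hole of the square. It belongs to \<open>S\<close>
  and, because of \<open>1/3 \<le> d / m < 1/2\<close>, keeps a distance of at least a third of the
  side from the boundary of the square.\<close>

definition ctr :: "nat \<Rightarrow> nat \<Rightarrow> nat \<Rightarrow> plane" where
  "ctr k a b = zoom m k a b (real d / m, real d / m)"

lemma ctr0_in_S: "(real d / m, real d / m) \<in> S"
proof -
  have "(real d / m, real d / m) \<in> rim m 1 d d"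
    using m0 by (auto simp: rim_def cell_def ocell_def divide_right_mono)
  then show ?thesis
    using rim_subset_carpet[OF m0 mid, of 1 d d] hole_middle unfolding rim_index_def by blast
qed

lemma ctr_in:
  assumes "kept m mid k a b"
  shows "ctr k a b \<in> S" "ctr k a b \<in> cell m k a b"
  using carpet_Int_cell[OF m0 mid assms] ctr0_in_S unfolding ctr_def by blast+

lemma ball_ctr:
  assumes "dist (ctr k a b) z < 1 / (4 * real m ^ k)"
  shows "z \<in> ocell m k a b"
proof -
  let ?w = "unzoom m k a b z"
  have z: "z = zoom m k a b ?w" using zoom_unzoom[OF m0] by simp
  have "dist (ctr k a b) z = dist (real d / m, real d / m) ?w / real m ^ k"
    unfolding ctr_def by (subst z) (rule dist_zoom[OF m0])
  then have ds: "dist (real d / m, real d / m) ?w < 1 / 4"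
    using assms m0 by (simp add: field_simps)
  have "1 / 3 \<le> real d / m" "real d / m \<le> 1 / 2" using d dm m0 by (simp_all add: field_simps)
  moreover have "\<bar>real d / m - fst ?w\<bar> < 1 / 4" "\<bar>real d / m - snd ?w\<bar> < 1 / 4"
    using ds dist_fst_le[of "(real d / m, real d / m)" ?w] dist_snd_le[of "(real d / m, real d / m)" ?w]
    by (simp_all add: dist_real_def)
  ultimately have "0 < fst ?w" "fst ?w < 1" "0 < snd ?w" "snd ?w < 1" by linarith+
  then have "?w \<in> ocell m 0 0 0" by (simp add: ocell_def mem_Times_iff)
  then show ?thesis using z zoom_mem_ocell0[OF m0] by metis
qed

text \<open>With a quarter of the side as radius the balls stay in the open squares, so they are
  disjoint and the multiplicity is 1. The bound of two sides for the diameter of a square equals 8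
  radii, hence the constant 8 in \<open>quasi_cover_cells\<close>.\<close>

definition cell_triple :: "nat \<Rightarrow> nat \<times> nat \<Rightarrow> plane set \<times> plane \<times> real" where
  "cell_triple k = (\<lambda>(a, b). (S \<inter> cell m k a b, ctr k a b, 1 / (4 * real m ^ k)))"

lemma cell_triple_props:
  assumes I: "I \<subseteq> kept_set k" and q: "(U, x, r) \<in> cell_triple k ` I"
  shows "U \<subseteq> S" "x \<in> S" "0 \<le> r" "r \<le> 1 / real m ^ k" "U \<subseteq> cball x (8 * r)"
proof -
  obtain a b where ab: "(a, b) \<in> I" "U = S \<inter> cell m k a b" "x = ctr k a b" "r = 1 / (4 * real m ^ k)"
    using q unfolding cell_triple_def by auto
  have k: "kept m mid k a b" using ab(1) I unfolding kept_set_def by auto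
  show "U \<subseteq> S" "x \<in> S" "0 \<le> r" "r \<le> 1 / real m ^ k" using ab ctr_in[OF k] m0 by (auto intro!: divide_left_mono)
  have e: "8 * r = 2 / real m ^ k" using ab(4) by simp
  show "U \<subseteq> cball x (8 * r)"
    unfolding e using ab(2,3) cell_dist[OF ctr_in(2)[OF k]] by auto
qed

lemma cell_triple_mult:
  assumes I: "I \<subseteq> kept_set k"
  shows "card {(U, x, r) \<in> cell_triple k ` I. dist x z < r} \<le> 1"
proof -
  let ?Q = "{(U, x, r) \<in> cell_triple k ` I. dist x z < r}"
  have "q = q'" if q: "q \<in> ?Q" and q': "q' \<in> ?Q" for q q'
  proof -
    obtain a b where ab: "q = cell_triple k (a, b)" "dist (ctr k a b) z < 1 / (4 * real m ^ k)"
      using q unfolding cell_triple_def by auto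
    obtain a' b' where ab': "q' = cell_triple k (a', b')" "dist (ctr k a' b') z < 1 / (4 * real m ^ k)"
      using q' unfolding cell_triple_def by auto
    have "a = a' \<and> b = b'"
      using ball_ctr[OF ab(2)] subsetD[OF ocell_subset_cell ball_ctr[OF ab'(2)]] by (rule ocell_eqD[OF m0])
    then show ?thesis using ab ab' by simp
  qed
  then show ?thesis
    by (cases "finite ?Q") (auto simp: card_le_Suc0_iff_eq simp del: mem_Collect_eq)
qed

lemma quasi_cover_cells: "quasi_cover S 8 1 (1 / real m ^ k) (cell_triple k ` kept_set k)"
  unfolding quasi_cover_def
proof (intro conjI ballI)
  show "finite (cell_triple k ` kept_set k)" using finite_kept_set by simp
  show "S \<subseteq> (\<Union>(U, x, r)\<in>cell_triple k ` kept_set k. U)"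
  proof
    fix z assume z: "z \<in> S"
    then obtain a b where "kept m mid k a b" "z \<in> cell m k a b" using S_subset_cells[of k] by blast
    then have "(a, b) \<in> kept_set k" "z \<in> fst (cell_triple k (a, b))"
      using z unfolding kept_set_def cell_triple_def by auto
    then show "z \<in> (\<Union>(U, x, r)\<in>cell_triple k ` kept_set k. U)" by (auto simp: case_prod_beta)
  qed
  fix q assume q: "q \<in> cell_triple k ` kept_set k"
  obtain U x r where "q = (U, x, r)" by (cases q)
  then show "case q of (U, x, r) \<Rightarrow> U \<subseteq> S \<and> x \<in> S \<and> 0 \<le> r \<and> r \<le> 1 / real m ^ k \<and> U \<subseteq> cball x (8 * r)"
    using cell_triple_props[OF subset_refl, of U x r k] q by simp
qed (rule cell_triple_mult[OF subset_refl])

text \<open>The centre of the smallest of the boxes through a given point lies in all the corresponding balls. This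
  bounds the overlap of the boxes in the plane, hence their total area by that of a neighbourhood of \<open>S\<close>.\<close>

lemma quasi_cover_mass:
  assumes qc: "quasi_cover S lam mu del P" and del: "del \<le> 1 / real m ^ k"
  shows "(\<Sum>(U, x, r)\<in>P. r\<^sup>2) \<le> 57 * mu * ((m\<^sup>2 - 1) / m\<^sup>2) ^ k"
proof -
  note P = quasi_coverD[OF qc]
  define Q where "Q = {q\<in>P. 0 < snd (snd q)}"
  \<comment> \<open>If two such boxes share a point, their centres differ by at most
    \<open>2 * r / 5\<close> in each coordinate, \<open>r\<close> being the larger radius, so their
    distance is at most \<open>4 * r / 5 < r\<close>. A box has area
    \<open>4 / 25 * r\<^sup>2\<close>, a threefold enlarged grid square
    \<open>9 / (m ^ k)\<^sup>2\<close>; the constant 57 is \<open>25 / 4 * 9\<close> rounded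
    up.\<close>
  define B where "B = (\<lambda>(U::plane set, x::plane, r). cbox (fst x - r / 5, snd x - r / 5) (fst x + r / 5, snd x + r / 5))"
  define N where "N = (\<lambda>(a, b). cbox ((real a - 1) / real m ^ k, (real b - 1) / real m ^ k) ((real a + 2) / real m ^ k, (real b + 2) / real m ^ k))"
  have Bco: "fst x - r / 5 \<le> fst p \<and> fst p \<le> fst x + r / 5 \<and> snd x - r / 5 \<le> snd p \<and> snd p \<le> snd x + r / 5"
    if "p \<in> B (U, x, r)" for p U x r
    using that unfolding B_def prod.case cbox_Pair_eq mem_Times_iff by simp
  have fQ: "finite Q" using P(1) unfolding Q_def by simp
  have Bi: "integrable lborel (indicator (B q) :: plane \<Rightarrow> real)" for q
    unfolding B_def case_prod_beta by (intro integrable_real_indicator emeasure_lborel_cbox_finite) auto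
  have Ni: "integrable lborel (indicator (N q) :: plane \<Rightarrow> real)" for q
    unfolding N_def case_prod_beta by (intro integrable_real_indicator emeasure_lborel_cbox_finite) auto
  have mB: "measure lborel (B q) = 4 / 25 * (snd (snd q))\<^sup>2" if "q \<in> Q" for q
  proof -
    have "0 < snd (snd q)" using that unfolding Q_def by simp
    then show ?thesis
      unfolding B_def case_prod_beta by (subst measure_plane_cbox) (simp_all add: power2_eq_square)
  qed
  have mN: "measure lborel (N q) = 9 / (real m ^ k)\<^sup>2" for q
    unfolding N_def case_prod_beta
    by (subst measure_plane_cbox) (auto simp: divide_right_mono diff_divide_distrib[symmetric] power2_eq_square)
  have pw: "(\<Sum>q\<in>Q. indicator (B q) p) \<le> mu * (\<Sum>q\<in>kept_set k. indicator (N q) p :: real)" for p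
  proof -
    define A where "A = {q\<in>Q. p \<in> B q}"
    have fA: "finite A" using fQ unfolding A_def by simp
    have s: "(\<Sum>q\<in>Q. indicator (B q) p :: real) = card A"
      unfolding A_def using fQ by (simp add: indicator_def sum.If_cases Int_def)
    show ?thesis
    proof (cases "A = {}")
      case True then show ?thesis using s by (simp add: sum_nonneg)
    next
      case False
      obtain q0 where q0: "q0 \<in> A" "\<And>q. q \<in> A \<Longrightarrow> snd (snd q0) \<le> snd (snd q)"
        using arg_min_if_finite[OF fA False, of "\<lambda>q. snd (snd q)"] by (metis not_le)
      obtain U0 x0 r0 where q0e: "q0 = (U0, x0, r0)" by (cases q0)
      have P0: "(U0, x0, r0) \<in> P" "p \<in> B (U0, x0, r0)" "0 < r0" using q0 q0e unfolding A_def Q_def by auto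
      have x0: "x0 \<in> S" "r0 \<le> del" using P(3)[OF P0(1)] by auto
      have p0: "\<bar>fst p - fst x0\<bar> \<le> r0 / 5" "\<bar>snd p - snd x0\<bar> \<le> r0 / 5"
        using Bco[OF P0(2)] by linarith+
      have "A \<subseteq> {(U, x, r) \<in> P. dist x x0 < r}"
      proof
        fix q assume q: "q \<in> A"
        obtain U x r where qe: "q = (U, x, r)" by (cases q)
        have h: "(U, x, r) \<in> P" "p \<in> B (U, x, r)" "0 < r" "r0 \<le> r"
          using q q0(2)[OF q] q0e qe unfolding A_def Q_def by auto
        have "\<bar>fst p - fst x\<bar> \<le> r / 5" "\<bar>snd p - snd x\<bar> \<le> r / 5"
          using Bco[OF h(2)] by linarith+
        then have "\<bar>fst x - fst x0\<bar> \<le> 2 * r / 5" "\<bar>snd x - snd x0\<bar> \<le> 2 * r / 5"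
          using p0 h(4) by linarith+
        then have "dist x x0 < r" using dist_le_sum_coords[of x x0] h(3) by linarith
        then show "q \<in> {(U, x, r) \<in> P. dist x x0 < r}" using qe h by simp
      qed
      moreover have "finite {(U, x, r) \<in> P. dist x x0 < r}"
        by (rule finite_subset[OF _ P(1)]) blast
      ultimately have "card A \<le> card {(U, x, r) \<in> P. dist x x0 < r}" by (intro card_mono)
      also have "\<dots> \<le> mu" by (rule P(4)[OF x0(1)])
      finally have cA: "card A \<le> mu" .
      obtain a b where ab: "kept m mid k a b" "x0 \<in> cell m k a b" using S_subset_cells[of k] x0 by blast
      have pc: "\<bar>fst p - fst x0\<bar> \<le> 1 / real m ^ k" "\<bar>snd p - snd x0\<bar> \<le> 1 / real m ^ k" using p0 x0(2) del P0(3) by linarith+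
      have "p \<in> N (a, b)"
        using ab(2) pc unfolding N_def cell_def prod.case mem_Times_iff cbox_Pair_eq
          add_divide_distrib diff_divide_distrib atLeastAtMost_iff box_real fst_conv snd_conv
        by simp linarith
      then have "1 = (indicator (N (a, b)) p :: real)" by simp
      also have "\<dots> \<le> (\<Sum>q\<in>kept_set k. indicator (N q) p)"
        using ab(1) finite_kept_set by (intro member_le_sum) (auto simp: kept_set_def)
      finally have "real mu * 1 \<le> mu * (\<Sum>q\<in>kept_set k. indicat_real (N q) p)"
        by (intro mult_left_mono) auto
      then show ?thesis using s cA by simp
    qed
  qed
  have "(\<Sum>(U, x, r)\<in>P. r\<^sup>2) = (\<Sum>q\<in>P. (snd (snd q))\<^sup>2)" by (simp add: case_prod_beta)
  also have "\<dots> = (\<Sum>q\<in>Q. (snd (snd q))\<^sup>2)"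
  proof (rule sum.mono_neutral_right[OF P(1)])
    show "Q \<subseteq> P" unfolding Q_def by blast
    show "\<forall>q\<in>P - Q. (snd (snd q))\<^sup>2 = 0"
    proof
      fix q assume q: "q \<in> P - Q"
      obtain U x r where qe: "q = (U, x, r)" by (cases q)
      have "0 \<le> r" using P(3)[of U x r] q qe by simp
      moreover have "\<not> 0 < r" using q qe unfolding Q_def by simp
      ultimately show "(snd (snd q))\<^sup>2 = 0" using qe by simp
    qed
  qed
  also have "\<dots> = 25 / 4 * (\<Sum>q\<in>Q. measure lborel (B q))"
    by (simp add: mB sum_distrib_left)
  also have "(\<Sum>q\<in>Q. measure lborel (B q)) = (\<integral>p. (\<Sum>q\<in>Q. indicator (B q) p) \<partial>lborel)"
    using Bi by (simp add: Bochner_Integration.integral_sum)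
  also have "\<dots> \<le> (\<integral>p. mu * (\<Sum>q\<in>kept_set k. indicat_real (N q) p) \<partial>lborel)"
    using Bi Ni pw by (intro integral_mono) auto
  also have "\<dots> = mu * (\<Sum>q\<in>kept_set k. measure lborel (N q))"
    using Ni by (simp add: Bochner_Integration.integral_sum)
  also have "\<dots> = mu * (card (kept_set k) * (9 / (real m ^ k)\<^sup>2))" by (simp add: mN)
  also have "\<dots> \<le> mu * ((real m ^ 2 - 1) ^ k * (9 / (real m ^ k)\<^sup>2))"
  proof -
    have "real (card (kept_set k)) \<le> real ((m\<^sup>2 - 1) ^ k)" using card_kept_set of_nat_mono by blast
    also have "\<dots> = (real m ^ 2 - 1) ^ k" using m0 by (simp add: of_nat_diff)
    finally show ?thesis by (intro mult_left_mono mult_right_mono) auto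
  qed
  also have "\<dots> = 9 * mu * ((real m ^ 2 - 1) / m\<^sup>2) ^ k"
    by (simp add: power_divide power_mult[symmetric] mult.commute)
  finally have "(\<Sum>(U, x, r)\<in>P. r\<^sup>2) \<le> 25 / 4 * (9 * mu * ((real m ^ 2 - 1) / m\<^sup>2) ^ k)" by simp
  also have "\<dots> \<le> 57 * (mu * ((real m ^ 2 - 1) / m\<^sup>2) ^ k)"
  proof -
    have "1 \<le> (real m)\<^sup>2" using m0 by simp
    then have "0 \<le> mu * ((real m ^ 2 - 1) / m\<^sup>2) ^ k" by simp
    then show ?thesis by simp
  qed
  finally show ?thesis using m0 by (simp add: of_nat_diff)
qed

text \<open>Each subdivision multiplies the area by \<open>1 - 1 / m\<^sup>2\<close>, so
  \<open>S\<close> has area zero. It matters that \<open>del\<close> depends only on the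
  multiplicity and on \<open>e\<close>, not on \<open>lam\<close> or on the cover.\<close>

lemma quasi_cover_mass_small:
  assumes "0 < e"
  shows "\<exists>del>0. \<forall>lam P. quasi_cover S lam mu del P \<longrightarrow> (\<Sum>(U, x, r)\<in>P. r\<^sup>2) \<le> e"
proof -
  have "1 \<le> real (m\<^sup>2)" using m0 by simp
  moreover have "\<bar>(M - 1) / M\<bar> < 1" if "1 \<le> M" for M :: real
    using that by (simp add: abs_of_nonneg divide_less_eq)
  ultimately have q: "\<bar>(real (m\<^sup>2) - 1) / real (m\<^sup>2)\<bar> < 1" by blast
  have "(\<lambda>k. 57 * real mu * ((real (m\<^sup>2) - 1) / m\<^sup>2) ^ k) \<longlonglongrightarrow> 57 * real mu * 0"
    by (intro tendsto_intros LIMSEQ_power_zero) (use q in simp)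
  then have "eventually (\<lambda>k. 57 * real mu * ((real (m\<^sup>2) - 1) / m\<^sup>2) ^ k < e) sequentially"
    using assms by (intro order_tendstoD(2)) auto
  then obtain k where k: "57 * real mu * ((real (m\<^sup>2) - 1) / m\<^sup>2) ^ k < e"
    unfolding eventually_sequentially by blast
  have "real (m\<^sup>2 - 1) = real (m\<^sup>2) - 1" using m0 by (simp add: of_nat_diff)
  then have "\<forall>lam P. quasi_cover S lam mu (1 / real m ^ k) P \<longrightarrow> (\<Sum>(U, x, r)\<in>P. r\<^sup>2) \<le> e"
    using quasi_cover_mass[of _ mu "1 / real m ^ k" _ k] k by fastforce
  then show ?thesis using m0 by (intro exI[of _ "1 / real m ^ k"]) auto
qed


section \<open>Lipschitz functions on the standard carpet\<close>

lemma bounded_image_S: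
  fixes u :: "plane \<Rightarrow> real"
  assumes "continuous_on S u" "A \<subseteq> S"
  shows "bounded (u ` A)"
  using compact_imp_bounded[OF compact_continuous_image[OF assms(1) compact_S]] image_mono[OF assms(2), where f = u]
  by (rule bounded_subset)

text \<open>A Lipschitz function oscillates by at most \<open>2 * L * lam * r\<close> on a set of
  the cover, and the sum of the squared radii is small. So every sufficiently fine cover that is
  good for \<open>u\<close> is good for the minimum.\<close>

lemma null_osc_min_lipschitz:
  assumes u: "null_osc S u" and L: "0 \<le> L" "\<And>x y. x \<in> S \<Longrightarrow> y \<in> S \<Longrightarrow> \<bar>f x - f y\<bar> \<le> L * dist x y"
  shows "null_osc S (\<lambda>z. min (u z) (f z))"
proof -
  have cu: "continuous_on S u" using u unfolding null_osc_def by blast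
  have cf: "continuous_on S f"
    using L by (intro lipschitz_on_continuous_on lipschitz_onI) (auto simp: dist_real_def)
  obtain lam mu where lm: "\<And>e. e > 0 \<Longrightarrow>
      \<exists>P. quasi_cover S lam mu e P \<and> (\<Sum>(U, x, r)\<in>P. (osc u U)\<^sup>2) \<le> e"
    using u unfolding null_osc_def by blast
  let ?v = "\<lambda>z. min (u z) (f z)"
  have "\<exists>P. quasi_cover S lam mu e P \<and> (\<Sum>(U, x, r)\<in>P. (osc ?v U)\<^sup>2) \<le> e" if e: "e > 0" for e
  proof -
    define A where "A = (2 * L * lam)\<^sup>2"
    have A: "0 \<le> A" by (simp add: A_def)
    obtain del where del: "del > 0" "\<And>lam P. quasi_cover S lam mu del P \<Longrightarrow>
        (\<Sum>(U, x, r)\<in>P. r\<^sup>2) \<le> e / (2 * (A + 1))"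
      using quasi_cover_mass_small[of "e / (2 * (A + 1))" mu] e A by auto
    define e' where "e' = min del (e / 2)"
    have e': "0 < e'" "e' \<le> del" "e' \<le> e / 2" "e' \<le> e" using del e by (auto simp: e'_def)
    obtain P where P: "quasi_cover S lam mu e' P" "(\<Sum>(U, x, r)\<in>P. (osc u U)\<^sup>2) \<le> e'"
      using lm e'(1) by blast
    have m: "(\<Sum>(U, x, r)\<in>P. r\<^sup>2) \<le> e / (2 * (A + 1))"
      using quasi_cover_mono[OF P(1) order_refl e'(2) order_refl] del(2) by blast
    have "(\<Sum>(U, x, r)\<in>P. (osc ?v U)\<^sup>2) \<le> (\<Sum>(U, x, r)\<in>P. (osc u U)\<^sup>2 + A * r\<^sup>2)"
    proof (rule sum_mono)
      fix q assume q: "q \<in> P"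
      obtain U x r where qe: "q = (U, x, r)" by (cases q)
      have h: "U \<subseteq> S" "x \<in> S" "U \<subseteq> cball x (lam * r)" using quasi_coverD(3)[OF P(1)] q qe by auto
      have bu: "bounded (u ` U)" and bf: "bounded (f ` U)" using bounded_image_S cu cf h by auto
      have "(osc f U)\<^sup>2 \<le> A * r\<^sup>2"
      proof (cases "U = {}")
        case True then show ?thesis using A by (simp add: osc_def)
      next
        case False
        have "osc f U \<le> 2 * L * (lam * r)"
        proof (rule osc_le)
          fix y z assume yz: "y \<in> U" "z \<in> U"
          have "dist y z \<le> dist x y + dist x z" by (metis dist_commute dist_triangle)
          also have "\<dots> \<le> 2 * (lam * r)" using subsetD[OF h(3) yz(1)] subsetD[OF h(3) yz(2)] by simp
          finally have "L * dist y z \<le> L * (2 * (lam * r))" using L(1) by (rule mult_left_mono)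
          then show "\<bar>f y - f z\<bar> \<le> 2 * L * (lam * r)" using L(2)[of y z] yz h(1) by fastforce
        qed (use False in simp)
        then have "(osc f U)\<^sup>2 \<le> (2 * L * (lam * r))\<^sup>2" using osc_nonneg[OF bf] by (rule power_mono)
        then show ?thesis by (simp add: A_def power_mult_distrib)
      qed
      then have "(osc ?v U)\<^sup>2 \<le> (osc u U)\<^sup>2 + A * r\<^sup>2" using osc_min_sq_le[OF bu bf] by linarith
      then show "(case q of (U, x, r) \<Rightarrow> (osc ?v U)\<^sup>2) \<le> (case q of (U, x, r) \<Rightarrow> (osc u U)\<^sup>2 + A * r\<^sup>2)"
        by (simp add: qe)
    qed
    also have "\<dots> = (\<Sum>(U, x, r)\<in>P. (osc u U)\<^sup>2) + A * (\<Sum>(U, x, r)\<in>P. r\<^sup>2)"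
      by (simp add: case_prod_beta sum.distrib sum_distrib_left)
    also have "\<dots> \<le> e / 2 + A * (e / (2 * (A + 1)))"
      using P(2) e'(3) m A by (intro add_mono mult_left_mono) auto
    also have "\<dots> \<le> e"
    proof -
      have "A * (e / (2 * (A + 1))) = e / 2 * (A / (A + 1))" by simp
      also have "\<dots> \<le> e / 2 * 1" using e A by (intro mult_left_mono) auto
      finally have "A * (e / (2 * (A + 1))) \<le> e / 2" by (simp only: mult_1_right)
      then show ?thesis by linarith
    qed
    finally show ?thesis using quasi_cover_mono[OF P(1) order_refl e'(4) order_refl] by blast
  qed
  then show ?thesis unfolding null_osc_def using continuous_on_min[OF cu cf] by blast
qed

text \<open>The content is the existence of arbitrarily fine covers with a common multiplicity.
  Taking the minimum with a Lipschitz function then produces the first nonconstant examples.\<close>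

lemma null_osc_const: "null_osc S (\<lambda>z. c)"
  unfolding null_osc_def
proof (intro conjI exI[of _ "8::real"] exI[of _ "1::nat"] allI impI)
  fix e :: real assume e: "0 < e"
  obtain k where k: "1 / real m ^ k < e"
    using real_arch_pow_inv[OF e, of "1 / real m"] d dm by (auto simp: power_one_over)
  have "(\<Sum>(U, x, r)\<in>cell_triple k ` kept_set k. (osc (\<lambda>z. c) U)\<^sup>2) = 0"
    by (intro sum.neutral) (auto simp: osc_const)
  then show "\<exists>P. quasi_cover S 8 1 e P \<and> (\<Sum>(U, x, r)\<in>P. (osc (\<lambda>z. c) U)\<^sup>2) \<le> e"
    using quasi_cover_mono[OF quasi_cover_cells order_refl _ order_refl] k e
    by (intro exI[of _ "cell_triple k ` kept_set k"]) auto
qed simp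

lemma sum_hole_areas:
  assumes "finite I" "\<And>k a b. (k, a, b) \<in> I \<Longrightarrow> hole m mid k a b"
  shows "(\<Sum>(k, a, b)\<in>I. (1 / real m ^ k)\<^sup>2) \<le> 1"
proof -
  let ?c = "\<lambda>(k, a, b). cell m k a b"
  have sets: "?c ` I \<subseteq> sets lborel" using closed_cell by (auto intro: borel_closed)
  have fin: "emeasure lborel (?c q) \<noteq> \<infinity>" for q
    by (cases q) (simp add: cell_eq_cbox emeasure_lborel_cbox_eq)
  have dj: "disjoint_family_on ?c I"
    unfolding disjoint_family_on_def
  proof (intro ballI impI)
    fix q q' assume q: "q \<in> I" "q' \<in> I" "q \<noteq> q'"
    obtain k a b where "q = (k, a, b)" by (cases q)
    moreover obtain k' a' b' where "q' = (k', a', b')" by (cases q')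
    ultimately have e: "q = (k, a, b)" "q' = (k', a', b')" by auto
    have "hole m mid k a b" "hole m mid k' a' b'" using assms(2) q e by auto
    then show "?c q \<inter> ?c q' = {}" using hole_cells_disjoint[of k a b k' a' b'] q(3) e by simp
  qed
  have "(\<Sum>(k, a, b)\<in>I. (1 / real m ^ k)\<^sup>2) = (\<Sum>q\<in>I. measure lborel (?c q))"
    by (intro sum.cong) (auto simp: measure_cell[OF m0] simp del: power_one_over)
  also have "\<dots> = measure lborel (\<Union>q\<in>I. ?c q)"
    using measure_finite_Union[OF assms(1) sets dj] fin by simp
  also have "\<dots> \<le> measure lborel (cell m 0 0 0)"
  proof (rule measure_mono_fmeasurable)
    show "(\<Union>q\<in>I. ?c q) \<subseteq> cell m 0 0 0" using assms(2) hole_subset_unit[OF m0] by fastforce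
    show "(\<Union>q\<in>I. ?c q) \<in> sets lborel" using assms(1) sets by (intro sets.finite_UN) auto
    show "cell m 0 0 0 \<in> fmeasurable lborel" unfolding cell_eq_cbox by simp
  qed
  also have "\<dots> = 1" by (simp add: measure_cell[OF m0])
  finally show ?thesis .
qed

lemma osc_rim_le:
  assumes L: "0 \<le> L" "\<And>x y. x \<in> rim m k a b \<Longrightarrow> y \<in> rim m k a b \<Longrightarrow> \<bar>f x - f y\<bar> \<le> L * dist x y"
  shows "osc f (rim m k a b) \<le> L * (2 / real m ^ k)"
proof (rule osc_le)
  fix x y assume xy: "x \<in> rim m k a b" "y \<in> rim m k a b"
  have "dist x y \<le> 2 / real m ^ k" using xy by (intro cell_dist) (auto simp: rim_def)
  then show "\<bar>f x - f y\<bar> \<le> L * (2 / real m ^ k)"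
    using L(2)[OF xy] mult_left_mono[OF _ L(1)] by fastforce
qed (use L in simp)

text \<open>A circle of side \<open>s\<close> has oscillation at most \<open>2 * L * s\<close>. The
  outer circle thus contributes at most \<open>4 * L\<^sup>2\<close>, and the holes together
  \<open>4 * L\<^sup>2\<close> times their total area, which is at most 1.\<close>

lemma energy_lipschitz:
  assumes L: "0 \<le> L" "\<And>x y. x \<in> S \<Longrightarrow> y \<in> S \<Longrightarrow> \<bar>f x - f y\<bar> \<le> L * dist x y"
  shows "energy_le S f (8 * L\<^sup>2)"
  unfolding energy_le_def
proof (intro allI impI, elim conjE)
  fix F assume F: "finite F" "F \<subseteq> Collect (peripheral S)"
  let ?r = "\<lambda>(k, a, b). rim m k a b" and ?w = "\<lambda>(k::nat, a::nat, b::nat). (L * (2 / real m ^ k))\<^sup>2"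
  have "F \<subseteq> ?r ` {(k, a, b). rim_index m mid k a b}"
    using F(2) peripheral_iff by fastforce
  then obtain I where I: "I \<subseteq> {(k, a, b). rim_index m mid k a b}" "finite I" "F = ?r ` I"
    using finite_subset_image[OF F(1)] by meson
  have cf: "continuous_on S f"
    using L by (intro lipschitz_on_continuous_on lipschitz_onI) (auto simp: dist_real_def)
  have "(\<Sum>C\<in>F. (osc f C)\<^sup>2) \<le> (\<Sum>q\<in>I. ((\<lambda>C. (osc f C)\<^sup>2) \<circ> ?r) q)"
    unfolding I(3) by (rule sum_image_le[OF I(2)]) simp
  also have "\<dots> \<le> (\<Sum>q\<in>I. ?w q)"
  proof (rule sum_mono)
    fix q assume q: "q \<in> I"
    obtain k a b where e: "q = (k, a, b)" by (cases q)
    have rS: "rim m k a b \<subseteq> S" using rim_subset_carpet[OF m0 mid] I(1) q e by blast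
    have "osc f (rim m k a b) \<le> L * (2 / real m ^ k)"
      using L(2) subsetD[OF rS] by (intro osc_rim_le[OF L(1)]) blast
    then have "(osc f (rim m k a b))\<^sup>2 \<le> (L * (2 / real m ^ k))\<^sup>2"
      by (intro power_mono osc_nonneg bounded_image_S[OF cf rS])
    then show "((\<lambda>C. (osc f C)\<^sup>2) \<circ> ?r) q \<le> ?w q" by (simp add: e)
  qed
  also have "\<dots> \<le> (\<Sum>q\<in>insert (0, 0, 0) (I - {(0, 0, 0)}). ?w q)"
    using I(2) by (intro sum_mono2) auto
  also have "\<dots> = 4 * L\<^sup>2 + (\<Sum>q\<in>I - {(0, 0, 0)}. ?w q)"
    using I(2) by (subst sum.insert) (auto simp: power_mult_distrib)
  also have "(\<Sum>q\<in>I - {(0, 0, 0)}. ?w q) = 4 * L\<^sup>2 * (\<Sum>(k, a, b)\<in>I - {(0, 0, 0)}. (1 / real m ^ k)\<^sup>2)"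
    unfolding sum_distrib_left by (intro sum.cong) (auto simp: power_mult_distrib power_divide)
  also have "\<dots> \<le> 4 * L\<^sup>2 * 1"
    using I(1,2) by (intro mult_left_mono sum_hole_areas) (auto simp: rim_index_def)
  finally show "(\<Sum>C\<in>F. (osc f C)\<^sup>2) \<le> 8 * L\<^sup>2" by simp
qed

section \<open>Transplanting a potential into a grid square\<close>

definition glue :: "nat \<Rightarrow> nat \<Rightarrow> nat \<Rightarrow> (plane \<Rightarrow> real) \<Rightarrow> plane \<Rightarrow> real" where
  "glue k i j u z = (if z \<in> cell m k i j then u (unzoom m k i j z) else 1)"

lemma glue_zoom: "z \<in> cell m 0 0 0 \<Longrightarrow> glue k i j u (zoom m k i j z) = u z"
  by (simp add: glue_def zoom_mem_cell0[OF m0] unzoom_zoom[OF m0])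

lemma glue_outside:
  assumes "\<And>z. z \<in> outer \<Longrightarrow> u z = 1" "z \<notin> ocell m k i j"
  shows "glue k i j u z = 1"
proof (cases "z \<in> cell m k i j")
  case True
  let ?w = "unzoom m k i j z"
  have z: "zoom m k i j ?w = z" using zoom_unzoom[OF m0] .
  have "?w \<in> outer"
    using True assms(2) zoom_mem_cell0[OF m0, of k i j ?w] zoom_mem_ocell0[OF m0, of k i j ?w]
    unfolding z rim_def by blast
  then show ?thesis using True assms(1) by (simp add: glue_def)
qed (simp add: glue_def)

lemma zoom_in_S: "kept m mid k i j \<Longrightarrow> z \<in> S \<Longrightarrow> zoom m k i j z \<in> S"
  using carpet_Int_cell[OF m0 mid, of k i j] by blast

lemma unzoom_in_S:
  assumes "kept m mid k i j" "z \<in> S" "z \<in> cell m k i j"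
  shows "unzoom m k i j z \<in> S"
proof -
  have "z \<in> zoom m k i j ` S" using assms carpet_Int_cell[OF m0 mid assms(1)] by blast
  then show ?thesis using unzoom_zoom[OF m0] by auto
qed

lemma continuous_glue:
  assumes k: "kept m mid k i j" and u: "continuous_on S u" and u1: "\<And>z. z \<in> outer \<Longrightarrow> u z = 1"
  shows "continuous_on S (glue k i j u)"
proof -
  have cl: "closed (S \<inter> cell m k i j)" "closed (S - ocell m k i j)"
    by (intro closed_Int closed_Diff closed_cell open_ocell compact_imp_closed compact_S)+
  have "continuous_on (S \<inter> cell m k i j) (u \<circ> unzoom m k i j)"
    using unzoom_in_S[OF k]
    by (intro continuous_on_compose continuous_unzoom continuous_on_subset[OF u]) auto
  then have 1: "continuous_on (S \<inter> cell m k i j) (glue k i j u)"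
    by (rule continuous_on_eq) (simp add: glue_def)
  have 2: "continuous_on (S - ocell m k i j) (glue k i j u)"
    by (rule continuous_on_eq[of _ "\<lambda>z. 1"]) (use glue_outside[where u = u, OF u1] in auto)
  have "S = (S \<inter> cell m k i j) \<union> (S - ocell m k i j)" using ocell_subset_cell by blast
  then show ?thesis using continuous_on_closed_Un[OF cl 1 2] by simp
qed

text \<open>Balls around points of a grid square that meet a point outside also contain the nearest point of the
  square, so the scaled cover keeps its multiplicity outside the square.\<close>

lemma null_osc_glue:
  assumes k: "kept m mid k i j" and u: "null_osc S u" and u1: "\<And>z. z \<in> outer \<Longrightarrow> u z = 1"
  shows "null_osc S (glue k i j u)"
proof -
  obtain lam mu where lm: "\<And>e. e > 0 \<Longrightarrow>
      \<exists>P. quasi_cover S lam mu e P \<and> (\<Sum>(U, x, r)\<in>P. (osc u U)\<^sup>2) \<le> e" and cu: "continuous_on S u"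
    using u unfolding null_osc_def by blast
  let ?z = "zoom m k i j" and ?s = "real m ^ k" and ?v = "glue k i j u"
  have s: "1 \<le> ?s" "0 < ?s" using m0 by simp_all
  have "\<exists>P. quasi_cover S (max lam 8) (mu + 1) e P \<and> (\<Sum>(U, x, r)\<in>P. (osc ?v U)\<^sup>2) \<le> e" if e: "e > 0" for e
  proof -
    obtain P where P: "quasi_cover S lam mu e P" "(\<Sum>(U, x, r)\<in>P. (osc u U)\<^sup>2) \<le> e" using lm e by blast
    note Pd = quasi_coverD[OF P(1)]
    obtain k1 where k1: "1 / real m ^ k1 < e"
      using real_arch_pow_inv[OF e, of "1 / real m"] d dm by (auto simp: power_one_over)
    define l where "l = k + k1"
    have "1 / real m ^ l \<le> 1 / real m ^ k1"
      using m0 unfolding l_def by (intro divide_left_mono power_increasing) auto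
    then have l: "1 / real m ^ l \<le> e" using k1 by simp
    \<comment> \<open>On these squares the glued function is constantly 1, so they cover the part
      outside the square at no cost. Their balls are disjoint, which accounts for the 1 in
      \<open>mu + 1\<close>.\<close>
    define I where "I = {(a, b) \<in> kept_set l. cell m l a b \<inter> ocell m k i j = {}}"
    have I: "I \<subseteq> kept_set l" unfolding I_def by blast
    let ?F = "\<lambda>(U, x, r). (?z ` U, ?z x, r / ?s)"
    define P1 where "P1 = ?F ` P"
    define P2 where "P2 = cell_triple l ` I"
    have fin: "finite P1" "finite P2"
      using Pd(1) finite_subset[OF I finite_kept_set] unfolding P1_def P2_def by auto
    have cov: "S \<subseteq> (\<Union>(U, x, r)\<in>P1 \<union> P2. U)"
    proof
      fix z assume z: "z \<in> S"
      show "z \<in> (\<Union>(U, x, r)\<in>P1 \<union> P2. U)"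
      proof (cases "z \<in> cell m k i j")
        case True
        then obtain w where w: "w \<in> S" "z = ?z w" using z carpet_Int_cell[OF m0 mid k] by blast
        then obtain q where q: "q \<in> P" "w \<in> fst q" using Pd(2) by fastforce
        have "?F q \<in> P1 \<union> P2" "z \<in> fst (?F q)" using q w(2) unfolding P1_def by (auto simp: case_prod_beta)
        then show ?thesis by (intro UN_I[of "?F q"]) (simp_all add: case_prod_beta)
      next
        case False
        obtain a b where ab: "kept m mid l a b" "z \<in> cell m l a b" using S_subset_cells[of l] z by blast
        have "cell m l a b \<inter> ocell m k i j = {}"
        proof (rule ccontr)
          assume "\<not> ?thesis"
          then have "ocell m k i j \<inter> cell m (k + k1) a b \<noteq> {}" unfolding l_def by blast
          then have "a div m ^ k1 = i \<and> b div m ^ k1 = j" by (intro cell_Int_ocell_div[OF m0]) blast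
          then show False using cell_nested(1)[OF m0, of k k1 a b] ab(2) False unfolding l_def by blast
        qed
        then have "(a, b) \<in> I" using ab(1) unfolding I_def kept_set_def by blast
        then have "cell_triple l (a, b) \<in> P2" "z \<in> fst (cell_triple l (a, b))"
          using z ab(2) unfolding P2_def cell_triple_def by auto
        then show ?thesis by (auto simp: case_prod_beta)
      qed
    qed
    have props: "U \<subseteq> S \<and> x \<in> S \<and> 0 \<le> r \<and> r \<le> e \<and> U \<subseteq> cball x (max lam 8 * r)"
      if q: "(U, x, r) \<in> P1 \<union> P2" for U x r
    proof (cases "(U, x, r) \<in> P2")
      case True
      note c = cell_triple_props[OF I, folded P2_def, OF True]
      have "8 * r \<le> max lam 8 * r" using c(3) by (intro mult_right_mono) auto
      then have "cball x (8 * r) \<subseteq> cball x (max lam 8 * r)" by (rule subset_cball)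
      then show ?thesis using c l by auto
    next
      case False
      then obtain U' x' r' where q': "(U', x', r') \<in> P" "U = ?z ` U'" "x = ?z x'" "r = r' / ?s"
        using q unfolding P1_def by auto
      note c = Pd(3)[OF q'(1)]
      have "r' / ?s \<le> r'" using c s by (simp add: divide_le_eq mult_left_mono[of 1] mult_le_cancel_left1)
      moreover have "?z y \<in> cball (?z x') (max lam 8 * (r' / ?s))" if "y \<in> U'" for y
      proof -
        have "dist (?z x') (?z y) = dist x' y / ?s" by (rule dist_zoom[OF m0])
        also have "\<dots> \<le> (lam * r') / ?s" using c that s by (intro divide_right_mono) auto
        also have "\<dots> \<le> (max lam 8 * r') / ?s"
          using c s by (intro divide_right_mono mult_right_mono) auto
        finally show ?thesis by simp
      qed
      ultimately show ?thesis using c q' s zoom_in_S[OF k] by auto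
    qed
    have mult1: "card {(U, x, r) \<in> P1. dist x z < r} \<le> mu" if z: "z \<in> S" for z
    proof -
      let ?C = "cell m k i j"
      have C: "closed ?C" "convex ?C" "?C \<noteq> {}"
        using closed_cell convex_cell ocell_nonempty[OF m0] ocell_subset_cell by (auto, blast)
      define p where "p = closest_point ?C z"
      have pC: "p \<in> ?C" unfolding p_def using C by (intro closest_point_in_set) auto
      have pS: "p \<in> S"
      proof (cases "z \<in> ?C")
        case True then show ?thesis using z closest_point_self unfolding p_def by metis
      next
        case False
        have ne: "interior ?C \<noteq> {}" using ocell_nonempty[OF m0] by (simp add: interior_cell)
        have "z \<in> affine hull ?C - rel_interior ?C"
          using False affine_hull_nonempty_interior[OF ne] rel_interior_subset by auto
        then have "p \<in> rel_frontier ?C"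
          unfolding p_def by (rule closest_point_in_rel_frontier[OF C(1,3)])
        then have "p \<in> rim m k i j" using ne by (simp add: rel_frontier_nonempty_interior frontier_cell)
        then have "p \<in> ?z ` outer" using zoom_rim[OF m0, of k i j 0 0 0] by simp
        then show ?thesis
          using zoom_in_S[OF k] rim_subset_carpet[OF m0 mid, of 0 0 0] unfolding rim_index_def by blast
      qed
      have closer: "dist y p \<le> dist y z" if "y \<in> ?C" for y
        using closest_point_lipschitz[OF C(2,1,3), of y z] closest_point_self[OF that] unfolding p_def by simp
      obtain w where w: "w \<in> S" "p = ?z w" using pS pC carpet_Int_cell[OF m0 mid k] by blast
      have "{(U, x, r) \<in> P1. dist x z < r} \<subseteq> ?F ` {(U, x, r) \<in> P. dist x w < r}"
      proof
        fix q assume q0: "q \<in> {(U, x, r) \<in> P1. dist x z < r}"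
        then obtain U x r where q: "(U, x, r) \<in> P" "q = (?z ` U, ?z x, r / ?s)" unfolding P1_def by auto
        have "x \<in> S" using Pd(3)[OF q(1)] by blast
        then have "?z x \<in> ?C" using carpet_Int_cell[OF m0 mid k] by blast
        then have "dist (?z x) p < r / ?s" using closer q0 q(2) by fastforce
        then have "dist x w < r" using w(2) s dist_zoom[OF m0, of k i j x w] m0 by (simp add: divide_less_cancel)
        then have "(U, x, r) \<in> {(U, x, r) \<in> P. dist x w < r}" using q(1) by simp
        then show "q \<in> ?F ` {(U, x, r) \<in> P. dist x w < r}" by (rule image_eqI[rotated]) (simp add: q)
      qed
      moreover have "finite {(U, x, r) \<in> P. dist x w < r}" by (rule finite_subset[OF _ Pd(1)]) blast
      ultimately have "card {(U, x, r) \<in> P1. dist x z < r} \<le> card {(U, x, r) \<in> P. dist x w < r}"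
        by (rule surj_card_le[rotated])
      also have "\<dots> \<le> mu" by (rule Pd(4)[OF w(1)])
      finally show ?thesis .
    qed
    have qc: "quasi_cover S (max lam 8) (mu + 1) e (P1 \<union> P2)"
      unfolding quasi_cover_def
    proof (intro conjI ballI)
      fix z assume z: "z \<in> S"
      have eq: "{(U, x, r) \<in> P1 \<union> P2. dist x z < r} = {(U, x, r) \<in> P1. dist x z < r} \<union> {(U, x, r) \<in> P2. dist x z < r}"
        by blast
      have "card {(U, x, r) \<in> P1 \<union> P2. dist x z < r}
          \<le> card {(U, x, r) \<in> P1. dist x z < r} + card {(U, x, r) \<in> P2. dist x z < r}"
        unfolding eq by (rule card_Un_le)
      then show "card {(U, x, r) \<in> P1 \<union> P2. dist x z < r} \<le> mu + 1"
        using mult1[OF z] cell_triple_mult[OF I, of z, folded P2_def] by linarith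
    next
      fix q assume "q \<in> P1 \<union> P2"
      then show "case q of (U, x, r) \<Rightarrow> U \<subseteq> S \<and> x \<in> S \<and> 0 \<le> r \<and> r \<le> e \<and> U \<subseteq> cball x (max lam 8 * r)"
        using props by (cases q) simp
    qed (use fin cov in auto)
    have "(\<Sum>(U, x, r)\<in>P1 \<union> P2. (osc ?v U)\<^sup>2) \<le> (\<Sum>(U, x, r)\<in>P1. (osc ?v U)\<^sup>2) + (\<Sum>(U, x, r)\<in>P2. (osc ?v U)\<^sup>2)"
      by (rule sum_Un_le[OF fin]) (simp add: case_prod_beta)
    also have "(\<Sum>(U, x, r)\<in>P2. (osc ?v U)\<^sup>2) = 0"
    proof (rule sum.neutral, rule ballI)
      fix q assume "q \<in> P2"
      then obtain a b where ab: "(a, b) \<in> I" "q = cell_triple l (a, b)" unfolding P2_def by auto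
      have "osc ?v (S \<inter> cell m l a b) = 0"
      proof (rule osc_const)
        fix z assume "z \<in> S \<inter> cell m l a b"
        then have "z \<notin> ocell m k i j" using ab(1) unfolding I_def by blast
        then show "?v z = 1" using glue_outside[of u] u1 by blast
      qed
      then show "(case q of (U, x, r) \<Rightarrow> (osc ?v U)\<^sup>2) = 0" by (simp add: ab(2) cell_triple_def)
    qed
    also have "(\<Sum>(U, x, r)\<in>P1. (osc ?v U)\<^sup>2) \<le> (\<Sum>q\<in>P. ((\<lambda>(U, x, r). (osc ?v U)\<^sup>2) \<circ> ?F) q)"
      unfolding P1_def by (rule sum_image_le) (use Pd(1) in auto)
    also have "\<dots> = (\<Sum>(U, x, r)\<in>P. (osc u U)\<^sup>2)"
    proof (rule sum.cong)
      fix q assume q: "q \<in> P"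
      obtain U x r where qq: "q = (U, x, r)" by (cases q)
      have "U \<subseteq> S" using Pd(3)[of U x r] q qq by simp
      then have "osc ?v (?z ` U) = osc u U"
        unfolding osc_image using S_iff by (intro osc_cong) (auto intro!: glue_zoom)
      then show "((\<lambda>(U, x, r). (osc ?v U)\<^sup>2) \<circ> ?F) q = (case q of (U, x, r) \<Rightarrow> (osc u U)\<^sup>2)"
        by (simp add: qq)
    qed simp
    finally have "(\<Sum>(U, x, r)\<in>P1 \<union> P2. (osc ?v U)\<^sup>2) \<le> e" using P(2) by linarith
    then show ?thesis using qc by blast
  qed
  then show ?thesis unfolding null_osc_def using continuous_glue[OF k cu u1] by blast
qed

text \<open>Sums of squared oscillations are invariant under scaling, so no factor appears: a circle
  that meets the open square is the copy of a circle of \<open>S\<close>, and on every other circle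
  the glued function is 1.\<close>

lemma energy_glue:
  assumes k: "kept m mid k i j" and u1: "\<And>z. z \<in> outer \<Longrightarrow> u z = 1" and e: "energy_le S u K"
  shows "energy_le S (glue k i j u) K"
  unfolding energy_le_def
proof (intro allI impI, elim conjE)
  fix F assume F: "finite F" "F \<subseteq> Collect (peripheral S)"
  let ?v = "glue k i j u" and ?z = "zoom m k i j"
  define F1 where "F1 = {C\<in>F. C \<inter> ocell m k i j \<noteq> {}}"
  have ex: "\<exists>C'. peripheral S C' \<and> C = ?z ` C'" if C: "C \<in> F1" for C
  proof -
    have "peripheral S C" using C F unfolding F1_def by blast
    then obtain k' a b where r: "rim_index m mid k' a b" "C = rim m k' a b"
      unfolding peripheral_iff by blast
    have "rim m k' a b \<inter> ocell m k i j \<noteq> {}" using C r unfolding F1_def by blast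
    then obtain e' a0 b0 where h: "hole m mid e' a0 b0" "C = ?z ` rim m e' a0 b0"
      using rim_Int_ocell[OF m0 k r(1)] r(2) by blast
    have "peripheral S (rim m e' a0 b0)" using h(1) by (intro rim_peripheral) (simp add: rim_index_def)
    then show ?thesis using h(2) by blast
  qed
  then obtain g where g: "\<And>C. C \<in> F1 \<Longrightarrow> peripheral S (g C) \<and> C = ?z ` g C" by metis
  have inj: "inj_on g F1" using g by (metis inj_onI)
  have "(\<Sum>C\<in>F. (osc ?v C)\<^sup>2) = (\<Sum>C\<in>F1. (osc ?v C)\<^sup>2)"
  proof (rule sum.mono_neutral_right)
    show "\<forall>C\<in>F - F1. (osc ?v C)\<^sup>2 = 0"
    proof
      fix C assume "C \<in> F - F1"
      then have "osc ?v C = 0" by (intro osc_const[of _ _ 1] glue_outside[where u = u, OF u1]) (auto simp: F1_def)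
      then show "(osc ?v C)\<^sup>2 = 0" by simp
    qed
  qed (use F in \<open>auto simp: F1_def\<close>)
  also have "\<dots> = (\<Sum>C\<in>F1. (osc u (g C))\<^sup>2)"
  proof (rule sum.cong)
    fix C assume C: "C \<in> F1"
    have "g C \<subseteq> S" using g[OF C] unfolding peripheral_def by blast
    then have "osc ?v (?z ` g C) = osc u (g C)"
      unfolding osc_image using S_iff by (intro osc_cong) (auto intro!: glue_zoom)
    then show "(osc ?v C)\<^sup>2 = (osc u (g C))\<^sup>2" using g[OF C] by simp
  qed simp
  also have "\<dots> = (\<Sum>C\<in>g ` F1. (osc u C)\<^sup>2)" using inj by (simp add: sum.reindex)
  also have "\<dots> \<le> K"
  proof -
    have "finite (g ` F1)" "g ` F1 \<subseteq> Collect (peripheral S)" using F(1) g unfolding F1_def by auto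
    then show ?thesis using e unfolding energy_le_def by blast
  qed
  finally show "(\<Sum>C\<in>F. (osc ?v C)\<^sup>2) \<le> K" .
qed

end

section \<open>Oscillation along horizontal lines\<close>

text \<open>Sums over holes are written as integrals over \<open>count_space\<close>. This avoids an
  enumeration of the index triples and lets such a sum be interchanged with the integral over the
  heights of lines.\<close>

lemma emeasure_UN_le_nn_integral_count_space:
  assumes I: "countable I" and A: "\<And>i. i \<in> I \<Longrightarrow> A i \<in> sets M"
  shows "emeasure M (\<Union>i\<in>I. A i) \<le> (\<integral>\<^sup>+i. emeasure M (A i) \<partial>count_space I)"
proof -
  have U: "(\<Union>i\<in>I. A i) \<in> sets M" using I A by (intro sets.countable_UN'') auto
  have "emeasure M (\<Union>i\<in>I. A i) = (\<integral>\<^sup>+x. indicator (\<Union>i\<in>I. A i) x \<partial>M)" using U by simp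
  also have "\<dots> \<le> (\<integral>\<^sup>+x. (\<integral>\<^sup>+i. indicator (A i) x \<partial>count_space I) \<partial>M)"
  proof (rule nn_integral_mono)
    fix x
    show "indicator (\<Union>i\<in>I. A i) x \<le> (\<integral>\<^sup>+i. indicator (A i) x \<partial>count_space I)"
    proof (cases "x \<in> (\<Union>i\<in>I. A i)")
      case True
      then obtain i where i: "i \<in> I" "x \<in> A i" by blast
      have "indicator (A i) x \<le> (\<integral>\<^sup>+i. indicator (A i) x \<partial>count_space I)"
        using nn_integral_ge_point[OF i(1), of "\<lambda>i. indicator (A i) x"] .
      then show ?thesis using True i by simp
    qed simp
  qed
  also have "\<dots> = (\<integral>\<^sup>+i. (\<integral>\<^sup>+x. indicator (A i) x \<partial>M) \<partial>count_space I)"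
    using I A by (intro nn_integral_count_space_nn_integral) auto
  also have "\<dots> = (\<integral>\<^sup>+i. emeasure M (A i) \<partial>count_space I)"
    using A by (intro nn_integral_cong) simp
  finally show ?thesis .
qed

text \<open>Energies are bounds on finite families of circles; this is the passage to all holes of a
  tube.\<close>

lemma nn_integral_count_space_le_of_finite_sums:
  fixes f :: "'a \<Rightarrow> ennreal"
  assumes I: "countable I" and b: "\<And>F. finite F \<Longrightarrow> F \<subseteq> I \<Longrightarrow> sum f F \<le> B"
  shows "(\<integral>\<^sup>+i. f i \<partial>count_space I) \<le> B"
proof (cases "finite I")
  case True
  then show ?thesis using b[of I] by (simp add: nn_integral_count_space_finite)
next
  case False
  then have bij: "bij_betw (from_nat_into I) UNIV I" using I by (intro bij_betw_from_nat_into)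
  have "(\<integral>\<^sup>+i. f i \<partial>count_space I) = (\<integral>\<^sup>+n. f (from_nat_into I n) \<partial>count_space UNIV)"
    using nn_integral_bij_count_space[OF bij] by simp
  also have "\<dots> = (\<Sum>n. f (from_nat_into I n))" by (rule nn_integral_count_space_nat)
  also have "\<dots> \<le> B"
  proof (rule suminf_le_const)
    fix n
    have inj: "inj_on (from_nat_into I) {..<n}" using bij by (meson bij_betw_def inj_on_subset subset_UNIV)
    have "(\<Sum>i<n. f (from_nat_into I i)) = sum f (from_nat_into I ` {..<n})"
      by (simp add: sum.reindex[OF inj])
    also have "\<dots> \<le> B" using bij by (intro b) (auto simp: bij_betw_def)
    finally show "(\<Sum>i<n. f (from_nat_into I i)) \<le> B" .
  qed (rule summableI)
  finally show ?thesis .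
qed

lemma diameter_real:
  fixes X :: "real set"
  assumes "bounded X" "X \<noteq> {}"
  shows "Sup X - Inf X \<le> diameter X"
proof -
  have d: "x - y \<le> diameter X" if "x \<in> X" "y \<in> X" for x y
    using diameter_bounded_bound[OF assms(1) that] by (simp add: dist_real_def)
  have "Sup X \<le> diameter X + y" if "y \<in> X" for y
  proof (rule cSup_least[OF assms(2)])
    fix x assume "x \<in> X"
    then show "x \<le> diameter X + y" using d[of x y] that by simp
  qed
  then have "Sup X - diameter X \<le> Inf X" by (intro cInf_greatest[OF assms(2)]) fastforce
  then show ?thesis by simp
qed

text \<open>The interval between infimum and supremum is measurable whatever \<open>A\<close> is,
  and still no longer than the oscillation.\<close>

lemma emeasure_value_range:
  assumes "bounded (w ` A)"
  shows "emeasure lborel (if A = {} then {} else {Inf (w ` A) .. Sup (w ` A)}) \<le> ennreal (osc w A)"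
proof (cases "A = {}")
  case False
  have "Inf (w ` A) \<le> Sup (w ` A)"
    using False assms by (intro cInf_le_cSup) (auto intro: bounded_imp_bdd_above bounded_imp_bdd_below)
  then have "emeasure lborel {Inf (w ` A) .. Sup (w ` A)} = ennreal (Sup (w ` A) - Inf (w ` A))" by simp
  also have "\<dots> \<le> ennreal (osc w A)"
    unfolding osc_def using diameter_real[OF assms] False by (intro ennreal_leI) auto
  finally show ?thesis using False by simp
qed simp

lemma value_rangeI:
  fixes w :: "'a \<Rightarrow> real"
  assumes "bounded (w ` A)" "p \<in> A" "q \<in> A" "w p \<le> y" "y \<le> w q"
  shows "y \<in> (if A = {} then {} else {Inf (w ` A) .. Sup (w ` A)})"
proof -
  have "Inf (w ` A) \<le> w p" "w q \<le> Sup (w ` A)"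
    using cInf_lower[OF imageI[OF assms(2)] bounded_imp_bdd_below[OF assms(1)]]
      cSup_upper[OF imageI[OF assms(3)] bounded_imp_bdd_above[OF assms(1)]] by simp_all
  then show ?thesis using assms by auto
qed

text \<open>The scales at which the first passage below \<open>1 - (1/2) ^ L\<close> happens in one step are
  counted through the first passage index, which decreases strictly at every other scale.\<close>

lemma many_jump_scales:
  fixes e :: "nat \<Rightarrow> real"
  assumes e0: "e 0 \<le> 0" and eN: "1 \<le> e N"
  shows "N \<le> card {L. L < 2 * N \<and> (\<exists>i<N. e i < (1/2) ^ Suc L \<and> (1/2) ^ L \<le> e (Suc i))}"
proof -
  define idx where "idx = (\<lambda>L::nat. LEAST i. (1/2) ^ L \<le> e i)"
  have one: "(1/2::real) ^ L \<le> 1" for L by (simp add: power_le_one)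
  have ex: "(1/2) ^ L \<le> e N" for L using one[of L] eN by linarith
  have idx: "(1/2) ^ L \<le> e (idx L)" "idx L \<le> N" for L
    unfolding idx_def using LeastI[of "\<lambda>i. (1/2) ^ L \<le> e i" N] Least_le[of "\<lambda>i. (1/2) ^ L \<le> e i" N] ex
    by blast+
  have min: "i < idx L \<Longrightarrow> e i < (1/2) ^ L" for i L
    unfolding idx_def using not_less_Least not_le by blast
  have pos: "0 < idx L" for L
  proof (rule ccontr)
    assume "\<not> ?thesis"
    then have "(1/2) ^ L \<le> (0::real)" using idx(1)[of L] e0 by simp
    moreover have "(0::real) < (1/2) ^ L" by simp
    ultimately show False by linarith
  qed
  let ?good = "\<lambda>L. \<exists>i<N. e i < (1/2) ^ Suc L \<and> (1/2) ^ L \<le> e (Suc i)"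
  have step: "idx (Suc L) + (if ?good L then 0 else 1) \<le> idx L" for L
  proof -
    have "(1/2::real) ^ Suc L \<le> (1/2) ^ L" by simp
    then have "(1/2) ^ Suc L \<le> e (idx L)" using idx(1)[of L] by linarith
    then have le: "idx (Suc L) \<le> idx L"
      using Least_le[of "\<lambda>i. (1/2) ^ Suc L \<le> e i" "idx L"] by (simp only: idx_def)
    show ?thesis
    proof (cases "idx (Suc L) = idx L")
      case True
      \<comment> \<open>If both thresholds are first reached at the same index, then the step
        leading to it jumps over the whole interval between them.\<close>
      obtain i where i: "idx L = Suc i" using pos[of L] by (cases "idx L") auto
      have "?good L"
        using i idx[of L] min[of i "Suc L"] True by (intro exI[of _ i]) auto
      then show ?thesis using le by simp
    qed (use le in auto)
  qed
  have "card {L. L < n \<and> \<not> ?good L} + idx n \<le> idx 0" for n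
  proof (induction n)
    case (Suc n)
    have "{L. L < Suc n \<and> \<not> ?good L} = {L. L < n \<and> \<not> ?good L} \<union> (if ?good n then {} else {n})"
      by (auto simp: less_Suc_eq)
    then have "card {L. L < Suc n \<and> \<not> ?good L} \<le> card {L. L < n \<and> \<not> ?good L} + (if ?good n then 0 else 1)"
      using card_Un_le[of "{L. L < n \<and> \<not> ?good L}" "if ?good n then {} else {n}"] by (auto split: if_splits)
    then show ?case using Suc.IH step[of n] by linarith
  qed simp
  from this[of "2 * N"] have bad: "card {L. L < 2 * N \<and> \<not> ?good L} \<le> N"
    using idx(2)[of 0] by linarith
  have "{L. L < 2 * N \<and> ?good L} = {..<2 * N} - {L. L < 2 * N \<and> \<not> ?good L}" by auto
  then have "card {L. L < 2 * N \<and> ?good L} = 2 * N - card {L. L < 2 * N \<and> \<not> ?good L}"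
    by (simp add: card_Diff_subset subset_iff)
  then show ?thesis using bad by linarith
qed

context odd_carpet
begin

abbreviation rimt :: "nat \<times> nat \<times> nat \<Rightarrow> plane set" where
  "rimt h \<equiv> rim m (fst h) (fst (snd h)) (snd (snd h))"

definition crosses :: "nat \<times> nat \<times> nat \<Rightarrow> real \<Rightarrow> bool" where
  "crosses h t \<longleftrightarrow> real (snd (snd h)) / real m ^ fst h < t \<and> t < (real (snd (snd h)) + 1) / real m ^ fst h"

definition between :: "nat \<times> nat \<times> nat \<Rightarrow> real \<Rightarrow> real \<Rightarrow> bool" where
  "between h a b \<longleftrightarrow> a \<le> real (fst (snd h)) / real m ^ fst h \<and> (real (fst (snd h)) + 1) / real m ^ fst h \<le> b"

definition holes :: "(nat \<times> nat \<times> nat) set" where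
  "holes = {(k, a, b). hole m mid k a b}"

lemma holes_iff: "h \<in> holes \<longleftrightarrow> hole m mid (fst h) (fst (snd h)) (snd (snd h))"
  unfolding holes_def by (cases h) simp

lemma rimt_subset_S: "h \<in> holes \<Longrightarrow> rimt h \<subseteq> S"
  by (rule rim_subset_carpet[OF m0 mid]) (simp only: holes_iff rim_index_def simp_thms)

text \<open>Let \<open>x1\<close> be the last point with value at most \<open>y\<close>, and
  \<open>x2\<close> the first point after it with value at least \<open>y\<close>. If the value at
  \<open>x1\<close> is not \<open>y\<close> itself, no point of \<open>S\<close> lies between them.
  The segment is then the chord of one hole, and the circle of this hole takes values on both sides
  of \<open>y\<close>.\<close>

lemma line_values:
  fixes w :: "plane \<Rightarrow> real"
  assumes w: "continuous_on S w" and ab: "a \<le> b" "(a, t) \<in> S" "(b, t) \<in> S" and y: "w (a, t) \<le> y" "y \<le> w (b, t)"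
  shows "(\<exists>x. (x, t) \<in> S \<and> w (x, t) = y) \<or>
    (\<exists>h\<in>holes. crosses h t \<and> between h a b \<and> (\<exists>p\<in>rimt h. \<exists>q\<in>rimt h. w p \<le> y \<and> y \<le> w q))"
proof -
  have cS: "closed S" using compact_imp_closed[OF compact_S] .
  have cl: "closed {x. (x, t) \<in> S \<and> w (x, t) \<le> y}" "closed {x. (x, t) \<in> S \<and> y \<le> w (x, t)}"
  proof -
    have c1: "closed {z\<in>S. w z \<le> y}" "closed {z\<in>S. y \<le> w z}"
      by (rule continuous_on_closed_Collect_le[OF w continuous_on_const cS]
        continuous_on_closed_Collect_le[OF continuous_on_const w cS])+
    have c2: "continuous_on UNIV (\<lambda>x::real. (x, t))" by (intro continuous_intros)
    show "closed {x. (x, t) \<in> S \<and> w (x, t) \<le> y}" "closed {x. (x, t) \<in> S \<and> y \<le> w (x, t)}"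
      using closed_vimage[OF c1(1) c2] closed_vimage[OF c1(2) c2] by (simp_all add: vimage_def)
  qed
  define A where "A = {a..b} \<inter> {x. (x, t) \<in> S \<and> w (x, t) \<le> y}"
  have "compact A" unfolding A_def by (intro compact_Int_closed cl) simp
  moreover have "A \<noteq> {}" using ab y unfolding A_def by auto
  ultimately obtain x1 where x1: "x1 \<in> A" "\<And>x. x \<in> A \<Longrightarrow> x \<le> x1" using compact_attains_sup by metis
  show ?thesis
  proof (cases "w (x1, t) = y")
    case True then show ?thesis using x1 unfolding A_def by blast
  next
    case False
    then have lt: "w (x1, t) < y" using x1 unfolding A_def by auto
    have x1b: "a \<le> x1" "x1 \<le> b" "(x1, t) \<in> S" using x1 unfolding A_def by auto
    define B where "B = {x1..b} \<inter> {x. (x, t) \<in> S \<and> y \<le> w (x, t)}"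
    have "compact B" unfolding B_def by (intro compact_Int_closed cl) simp
    moreover have "B \<noteq> {}" using ab y x1b unfolding B_def by auto
    ultimately obtain x2 where x2: "x2 \<in> B" "\<And>x. x \<in> B \<Longrightarrow> x2 \<le> x" using compact_attains_inf by metis
    have x2b: "x1 \<le> x2" "x2 \<le> b" "(x2, t) \<in> S" "y \<le> w (x2, t)" using x2 unfolding B_def by auto
    have "x1 < x2" using lt x2b by (cases "x1 = x2") auto
    have gap: "(x, t) \<notin> S" if "x1 < x" "x < x2" for x
    proof
      assume xS: "(x, t) \<in> S"
      show False
      proof (cases "w (x, t) \<le> y")
        case True
        then have "x \<in> A" using xS that x1b x2b unfolding A_def by auto
        then show False using x1(2)[of x] that by simp
      next
        case False
        then have "x \<in> B" using xS that x1b x2b unfolding B_def by auto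
        then show False using x2(2)[of x] that by simp
      qed
    qed
    define c where "c = (x1 + x2) / 2"
    have c: "x1 < c" "c < x2" using \<open>x1 < x2\<close> unfolding c_def by auto
    have "(c, t) \<in> cell m 0 0 0"
      using x1b(3) x2b(3) c S_iff[of "(x1, t)"] S_iff[of "(x2, t)"] by (auto simp: cell_0)
    then obtain k i j where h: "hole m mid k i j" "(c, t) \<in> ocell m k i j"
      using gap[OF c] S_iff by blast
    let ?l = "real i / real m ^ k" and ?r = "(real i + 1) / real m ^ k"
    have o: "?l < c" "c < ?r" "real j / real m ^ k < t" "t < (real j + 1) / real m ^ k"
      using h(2) unfolding ocell_def by auto
    have nS: "(x1, t) \<notin> ocell m k i j" "(x2, t) \<notin> ocell m k i j" using x1b(3) x2b(3) S_iff h(1) by blast+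
    have l: "x1 \<le> ?l" and r: "?r \<le> x2" using nS o c unfolding ocell_def by auto
    have rr: "(?l, t) \<in> rim m k i j" "(?r, t) \<in> rim m k i j"
      using o unfolding rim_def cell_def ocell_def by auto
    then have "(?l, t) \<in> S" "(?r, t) \<in> S"
      using rim_subset_carpet[OF m0 mid, of k i j] h(1) unfolding rim_index_def by blast+
    then have "\<not> x1 < ?l" "\<not> ?r < x2" using gap[of ?l] gap[of ?r] o c by auto
    then have "?l = x1" "?r = x2" using l r by auto
    then have "(k, i, j) \<in> holes" "crosses (k, i, j) t" "between (k, i, j) a b"
        "(x1, t) \<in> rimt (k, i, j)" "(x2, t) \<in> rimt (k, i, j)"
      using h(1) o rr x1b x2b unfolding holes_def crosses_def between_def by auto
    then show ?thesis using lt x2b(4) by (metis less_imp_le)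
  qed
qed

text \<open>The estimate is made on the axis of values: the interval from \<open>w (a, t)\<close> to
  \<open>w (b, t)\<close> is covered by the value ranges of the crossed circles and of those sets of
  the cover that the line can meet. A set compared with \<open>B(x, r)\<close> is met only if
  \<open>t\<close> is within \<open>lam * r\<close> of the height of \<open>x\<close>.\<close>

lemma line_osc_le_increasing:
  assumes w: "continuous_on S w" and ab: "a \<le> b" "(a, t) \<in> S" "(b, t) \<in> S" and wab: "w (a, t) \<le> w (b, t)"
    and P: "quasi_cover S lam mu del P"
  shows "ennreal (w (b, t) - w (a, t)) \<le>
    (\<integral>\<^sup>+h. ennreal (osc w (rimt h)) \<partial>count_space {h\<in>holes. crosses h t \<and> between h a b}) +
    (\<Sum>(U, x, r)\<in>P. ennreal (osc w U) * indicator {snd x - lam * r .. snd x + lam * r} t)"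
proof -
  note Pd = quasi_coverD[OF P]
  let ?V = "\<lambda>A. if A = {} then {} else {Inf (w ` A) .. Sup (w ` A)}"
  let ?X = "{h\<in>holes. crosses h t \<and> between h a b}"
  let ?Y = "{q\<in>P. \<bar>t - snd (fst (snd q))\<bar> \<le> lam * snd (snd q)}"
  have bX: "bounded (w ` rimt h)" if "h \<in> ?X" for h
    using that by (intro bounded_image_S[OF w] rimt_subset_S) auto
  have bY: "bounded (w ` fst q)" if "q \<in> P" for q
    using that Pd(3)[of "fst q" "fst (snd q)" "snd (snd q)"] by (intro bounded_image_S[OF w]) auto
  have fY: "finite ?Y" using Pd(1) by simp
  have "{w (a, t) .. w (b, t)} \<subseteq> (\<Union>h\<in>?X. ?V (rimt h)) \<union> (\<Union>q\<in>?Y. ?V (fst q))"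
  proof
    fix y assume "y \<in> {w (a, t) .. w (b, t)}"
    then consider x where "(x, t) \<in> S" "w (x, t) = y"
      | h p q where "h \<in> ?X" "p \<in> rimt h" "q \<in> rimt h" "w p \<le> y" "y \<le> w q"
      using line_values[OF w ab, of y] by auto
    then show "y \<in> (\<Union>h\<in>?X. ?V (rimt h)) \<union> (\<Union>q\<in>?Y. ?V (fst q))"
    proof cases
      case 1
      then obtain q where q: "q \<in> P" "(x, t) \<in> fst q" using Pd(2) by fastforce
      have "dist (fst (snd q)) (x, t) \<le> lam * snd (snd q)"
        using q Pd(3)[of "fst q" "fst (snd q)" "snd (snd q)"] by auto
      then have "\<bar>t - snd (fst (snd q))\<bar> \<le> lam * snd (snd q)"
        using dist_snd_le[of "fst (snd q)" "(x, t)"] by (simp add: dist_real_def abs_minus_commute)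
      then have "q \<in> ?Y" using q(1) by simp
      moreover have "y \<in> ?V (fst q)"
        using value_rangeI[where w = w and A = "fst q" and p = "(x, t)" and q = "(x, t)" and y = y] bY[OF q(1)] q(2) 1 by auto
      ultimately show ?thesis by blast
    next
      case 2
      then have "y \<in> ?V (rimt h)" using value_rangeI[OF bX[OF 2(1)]] by blast
      then show ?thesis using 2(1) by blast
    qed
  qed
  then have "emeasure lborel {w (a, t) .. w (b, t)}
      \<le> emeasure lborel ((\<Union>h\<in>?X. ?V (rimt h)) \<union> (\<Union>q\<in>?Y. ?V (fst q)))"
    using fY by (intro emeasure_mono sets.Un sets.countable_UN'' sets.finite_UN) auto
  also have "\<dots> \<le> emeasure lborel (\<Union>h\<in>?X. ?V (rimt h)) + emeasure lborel (\<Union>q\<in>?Y. ?V (fst q))"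
    using fY by (intro emeasure_subadditive sets.countable_UN'' sets.finite_UN) auto
  also have "emeasure lborel (\<Union>h\<in>?X. ?V (rimt h)) \<le> (\<integral>\<^sup>+h. emeasure lborel (?V (rimt h)) \<partial>count_space ?X)"
    by (rule emeasure_UN_le_nn_integral_count_space) auto
  also have "\<dots> \<le> (\<integral>\<^sup>+h. ennreal (osc w (rimt h)) \<partial>count_space ?X)"
    by (intro nn_integral_mono emeasure_value_range bX) simp
  also have "emeasure lborel (\<Union>q\<in>?Y. ?V (fst q)) \<le> (\<Sum>q\<in>?Y. emeasure lborel (?V (fst q)))"
    using fY by (intro emeasure_subadditive_finite) auto
  also have "\<dots> \<le> (\<Sum>q\<in>?Y. ennreal (osc w (fst q)))"
    by (intro sum_mono emeasure_value_range bY) simp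
  also have "\<dots> = (\<Sum>q\<in>?Y. ennreal (osc w (fst q)) * indicator {snd (fst (snd q)) - lam * snd (snd q) .. snd (fst (snd q)) + lam * snd (snd q)} t)"
    by (intro sum.cong) (auto simp: indicator_def abs_le_iff)
  also have "\<dots> \<le> (\<Sum>q\<in>P. ennreal (osc w (fst q)) * indicator {snd (fst (snd q)) - lam * snd (snd q) .. snd (fst (snd q)) + lam * snd (snd q)} t)"
    using Pd(1) by (intro sum_mono2) auto
  finally show ?thesis using wab by (simp add: case_prod_beta add_mono)
qed

end

section \<open>Energy inside a tube\<close>

lemma borel_measurable_nn_integral_count_space:
  fixes f :: "'i \<Rightarrow> 'a \<Rightarrow> ennreal"
  assumes I: "countable I" and f: "\<And>i. i \<in> I \<Longrightarrow> f i \<in> borel_measurable M"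
  shows "(\<lambda>x. \<integral>\<^sup>+i. f i x \<partial>count_space I) \<in> borel_measurable M"
proof (cases "finite I")
  case True
  then show ?thesis using f by (simp add: nn_integral_count_space_finite)
next
  case False
  then have bij: "bij_betw (from_nat_into I) UNIV I" using I by (intro bij_betw_from_nat_into)
  have "(\<integral>\<^sup>+i. f i x \<partial>count_space I) = (\<Sum>n. f (from_nat_into I n) x)" for x
    using nn_integral_bij_count_space[OF bij, of "\<lambda>i. f i x"] by (simp add: nn_integral_count_space_nat)
  moreover have "from_nat_into I n \<in> I" for n using bij by (auto simp: bij_betw_def)
  ultimately show ?thesis using f by simp
qed

context odd_carpet
begin

lemma line_osc_le:
  assumes w: "continuous_on S w" and ab: "a \<le> b" "(a, t) \<in> S" "(b, t) \<in> S"
    and P: "quasi_cover S lam mu del P"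
  shows "ennreal (w (a, t) - w (b, t)) \<le>
    (\<integral>\<^sup>+h. ennreal (osc w (rimt h)) \<partial>count_space {h\<in>holes. crosses h t \<and> between h a b}) +
    (\<Sum>(U, x, r)\<in>P. ennreal (osc w U) * indicator {snd x - lam * r .. snd x + lam * r} t)"
proof (cases "w (b, t) \<le> w (a, t)")
  case True
  have o: "osc (\<lambda>z. - w z) A = osc w A" for A
    unfolding osc_alt by (simp add: abs_minus_commute)
  show ?thesis
    using line_osc_le_increasing[of "\<lambda>z. - w z", OF _ ab _ P] w True
    by (simp add: o continuous_on_minus)
qed (simp add: ennreal_neg)

lemma digit: "r < m \<Longrightarrow> (m * z + r) div m = z \<and> (m * z + r) mod m = r"
  by simp

text \<open>The rows at level \<open>Suc k\<close> with leading digit \<open>d\<close> and further digits \<open>0\<close> or \<open>2 * d\<close>: left of the middle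
  hole they meet no hole of level at most \<open>Suc k\<close>, because at no position both coordinates have the digit \<open>d\<close>.\<close>

primrec rows :: "nat \<Rightarrow> nat set" where
  "rows 0 = {d}"
| "rows (Suc k) = (\<lambda>y. m * y) ` rows k \<union> (\<lambda>y. m * y + 2 * d) ` rows k"

lemma rows_div: "y \<in> rows k \<Longrightarrow> y div m ^ k = d"
proof (induction k arbitrary: y)
  case (Suc k)
  then obtain z where z: "z \<in> rows k" "y = m * z \<or> y = m * z + 2 * d" by auto
  have "y div m = z" using z(2) digit[of 0 z] digit[of "2 * d" z] m by auto
  then show ?case using Suc.IH[OF z(1)] by (simp add: div_mult2_eq)
qed simp

lemma card_rows: "finite (rows k) \<and> card (rows k) = 2 ^ k"
proof (induction k)
  case (Suc k)
  have i: "inj_on (\<lambda>y. m * y) (rows k)" "inj_on (\<lambda>y. m * y + 2 * d) (rows k)"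
    using m0 by (auto intro: inj_onI)
  have "(\<lambda>y. m * y) ` rows k \<inter> (\<lambda>y. m * y + 2 * d) ` rows k = {}"
  proof -
    have "m * y \<noteq> m * z + 2 * d" for y z
    proof
      assume "m * y = m * z + 2 * d"
      then have "(m * y) mod m = (m * z + 2 * d) mod m" by simp
      moreover have "2 * d < m" using m by simp
      ultimately show False using digit[of "2 * d" z] d by simp
    qed
    then show ?thesis by blast
  qed
  then show ?case using Suc i by (simp add: card_Un_disjoint card_image)
qed simp

lemma kept_row: "y \<in> rows k \<Longrightarrow> x < d * m ^ k \<Longrightarrow> kept m mid (Suc k) x y"
proof (induction k arbitrary: x y)
  case 0
  then have "x < d" "d < m" using m by auto
  then show ?case using 0 by simp
next
  case (Suc k)
  then obtain z where z: "z \<in> rows k" "y = m * z \<or> y = m * z + 2 * d" by auto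
  have y: "y div m = z" "y mod m \<noteq> d" using z(2) digit[of 0 z] digit[of "2 * d" z] m d by auto
  have "x div m < d * m ^ k" using Suc.prems(2) m0 by (simp add: div_less_iff_less_mult mult_ac)
  then have "kept m mid (Suc k) (x div m) z" using Suc.IH z(1) by blast
  then show ?case using y by (subst kept.simps(2)) simp
qed

definition row :: "nat \<Rightarrow> nat \<Rightarrow> real set" where
  "row k y = {real y / real m ^ Suc k <..< (real y + 1) / real m ^ Suc k}"

text \<open>The level \<open>k\<close> fixes the width of the rows, but the circles of every tube
  lie in the same \<open>tube_box\<close>. Thus a cutoff function can be chosen before
  \<open>k\<close>.\<close>

definition tube :: "nat \<Rightarrow> (nat \<times> nat \<times> nat) set" where
  "tube k = {h\<in>holes. \<exists>i<d * m ^ k. \<exists>y\<in>rows k. cell m (fst h) (fst (snd h)) (snd (snd h)) \<subseteq> cell m (Suc k) i y}"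

lemma kept_rim_subset_S:
  assumes "kept m mid k i j" shows "rim m k i j \<subseteq> S"
proof -
  have "outer \<subseteq> S" by (rule rim_subset_carpet[OF m0 mid]) (simp add: rim_index_def)
  then have "zoom m k i j ` outer \<subseteq> S" using zoom_in_S[OF assms] by blast
  then show ?thesis using zoom_rim[OF m0, of k i j 0 0 0] by simp
qed

lemma row_points:
  assumes "y \<in> rows k" "i < d * m ^ k" "t \<in> row k y"
  shows "(real i / real m ^ Suc k, t) \<in> S" "((real i + 1) / real m ^ Suc k, t) \<in> S"
proof -
  have "(real i / real m ^ Suc k, t) \<in> rim m (Suc k) i y" "((real i + 1) / real m ^ Suc k, t) \<in> rim m (Suc k) i y"
    using assms(3) grid_step[OF m0, of i "Suc k"]
    unfolding rim_def cell_def ocell_def row_def by (auto simp del: power_Suc)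
  then show "(real i / real m ^ Suc k, t) \<in> S" "((real i + 1) / real m ^ Suc k, t) \<in> S"
    using kept_rim_subset_S[OF kept_row[OF assms(1,2)]] by blast+
qed

text \<open>The square \<open>(i, y)\<close> is kept, so a hole that overlaps it is of a finer level
  and hence one of its descendants. The midpoint of the chord is a common point.\<close>

lemma crossing_in_tube:
  assumes y: "y \<in> rows k" and i: "i < d * m ^ k" and t: "t \<in> row k y" and h: "h \<in> holes" "crosses h t"
    "between h (real i / real m ^ Suc k) ((real i + 1) / real m ^ Suc k)"
  shows "h \<in> tube k"
proof -
  obtain k' a b where he: "h = (k', a, b)" by (cases h)
  have hh: "hole m mid k' a b" using h(1) by (simp add: holes_def he)
  define x where "x = (real a + 1 / 2) / real m ^ k'"
  have mp: "0 < real m ^ k'" using m0 by simp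
  have x: "real a / real m ^ k' < x" "x < (real a + 1) / real m ^ k'"
    unfolding x_def using mp by (simp_all add: divide_strict_right_mono)
  have xo: "(x, t) \<in> ocell m k' a b" using x h(2) by (simp add: he crosses_def ocell_def)
  have xc: "(x, t) \<in> cell m (Suc k) i y"
    using x h(3) t by (auto simp: he between_def cell_def row_def simp del: power_Suc)
  have "\<exists>e. k' = Suc k + e"
  proof (rule ccontr)
    assume "\<not> ?thesis"
    then have "k' \<le> Suc k" by (metis le_add_diff_inverse nat_le_linear)
    then obtain e where "Suc k = k' + e" using le_Suc_ex by blast
    then have "cell m (Suc k) i y \<inter> ocell m k' a b = {}"
      using kept_cell_hole_disjoint[OF m0, of mid k' e i y a b] kept_row[OF y i] hh by metis
    then show False using xo xc by blast
  qed
  then obtain e where e: "k' = Suc k + e" by blast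
  have "cell m (Suc k) i y \<inter> ocell m (Suc k + e) a b \<noteq> {}" using xo xc e by blast
  then have "a div m ^ e = i \<and> b div m ^ e = y" by (intro cell_Int_ocell_div[OF m0]) blast
  then have "cell m k' a b \<subseteq> cell m (Suc k) i y" using cell_nested(1)[OF m0, of "Suc k" e a b] e by simp
  then show ?thesis using h(1) y i unfolding tube_def he by auto
qed

definition side :: "nat \<times> nat \<times> nat \<Rightarrow> real" where
  "side h = 1 / real m ^ fst h"

lemma side_pos: "0 < side h"
  using m0 by (simp add: side_def)

text \<open>Chords of different holes on one line are disjoint, and a chord is as long as the side
  of its hole.\<close>

lemma crossing_sides:
  assumes ab: "a \<le> b"
  shows "(\<integral>\<^sup>+h. ennreal (side h) \<partial>count_space {h\<in>holes. crosses h t \<and> between h a b}) \<le> ennreal (b - a)"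
proof -
  let ?X = "{h\<in>holes. crosses h t \<and> between h a b}"
  let ?I = "\<lambda>h. {real (fst (snd h)) / real m ^ fst h <..< (real (fst (snd h)) + 1) / real m ^ fst h}"
  have "disjoint_family_on ?I ?X"
    unfolding disjoint_family_on_def
  proof (intro ballI impI)
    fix h h' assume h: "h \<in> ?X" "h' \<in> ?X" "h \<noteq> h'"
    obtain k a b where e: "h = (k, a, b)" by (cases h)
    obtain k' a' b' where e': "h' = (k', a', b')" by (cases h')
    have "ocell m k a b \<inter> ocell m k' a' b' = {}"
      using h e e' by (intro hole_disjoint[OF m0, of mid]) (auto simp: holes_def)
    then have "(x, t) \<notin> ocell m k a b \<or> (x, t) \<notin> ocell m k' a' b'" for x by blast
    then show "?I h \<inter> ?I h' = {}" using h unfolding e e' crosses_def ocell_def by fastforce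
  qed
  then have "(\<integral>\<^sup>+h. emeasure lborel (?I h) \<partial>count_space ?X) = emeasure lborel (\<Union>h\<in>?X. ?I h)"
    by (intro emeasure_UN_countable[symmetric]) auto
  also have "\<dots> \<le> emeasure lborel {a..b}"
    by (intro emeasure_mono) (force simp: between_def)+
  also have "\<dots> = ennreal (b - a)" using ab by simp
  finally have "(\<integral>\<^sup>+h. emeasure lborel (?I h) \<partial>count_space ?X) \<le> ennreal (b - a)" .
  moreover have "emeasure lborel (?I h) = ennreal (side h)" for h
    using grid_step[OF m0, of "fst (snd h)" "fst h"] by (simp add: side_def add_divide_distrib)
  ultimately show ?thesis by simp
qed

text \<open>A linearised Cauchy-Schwarz inequality. With \<open>w\<close> the width of a grid square
  and \<open>l\<close> the lengths of the chords in it, the terms \<open>l / (4 * w)\<close> add up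
  to at most 1/4.\<close>

lemma am_gm_weight:
  fixes q w l :: real
  assumes "0 < w" "0 < l"
  shows "q \<le> w * q\<^sup>2 / l + l / (4 * w)"
proof -
  have "0 \<le> (2 * w * q - l)\<^sup>2 / (4 * w * l)" using assms by simp
  also have "\<dots> = w * q\<^sup>2 / l + l / (4 * w) - q"
    using assms by (simp add: power2_eq_square field_simps)
  finally show ?thesis by simp
qed

text \<open>After cutting at \<open>1 - eps\<close> and dividing by \<open>eps\<close>, the jump has
  height at least 1/2, whatever the scale. The weighted inequality consumes 1/4 of it and 1/4
  remains. The division also puts the factor \<open>2 ^ L\<close> on the error of the cover.\<close>

lemma jump_estimate:
  assumes u: "continuous_on S u" and P: "quasi_cover S lam mu del P"
    and y: "y \<in> rows k" and i: "i < d * m ^ k" and t: "t \<in> row k y"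
    and j1: "1 - u (real i / real m ^ Suc k, t) < (1/2) ^ Suc L"
    and j2: "(1/2) ^ L \<le> 1 - u ((real i + 1) / real m ^ Suc k, t)"
  shows "ennreal (1/4) \<le> (\<integral>\<^sup>+h. ennreal (1 / real m ^ Suc k *
        (osc (\<lambda>z. max (u z) (1 - (1/2) ^ L)) (rimt h) / (1/2) ^ L)\<^sup>2 / side h) * indicator {t. crosses h t} t \<partial>count_space (tube k))
      + ennreal (2 ^ L) * (\<Sum>(U, x, r)\<in>P. ennreal (osc u U) * indicator {snd x - lam * r .. snd x + lam * r} t)"
proof -
  define eps where "eps = (1/2::real) ^ L"
  define g where "g = (\<lambda>z. max (u z) (1 - eps))"
  define w where "w = 1 / real m ^ Suc k"
  let ?a = "real i / real m ^ Suc k" and ?b = "(real i + 1) / real m ^ Suc k"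
  let ?X = "{h\<in>holes. crosses h t \<and> between h ?a ?b}"
  let ?err = "\<lambda>u. (\<Sum>(U, x, r)\<in>P. ennreal (osc u U) * indicator {snd x - lam * r .. snd x + lam * r} t)"
  let ?F = "\<lambda>h. ennreal (w * (osc g (rimt h) / eps)\<^sup>2 / side h)"
  have eps: "0 < eps" "1 / eps = 2 ^ L" unfolding eps_def by (simp_all add: power_one_over)
  have w: "0 < w" unfolding w_def using m0 by simp
  have ba: "?b - ?a = w" unfolding w_def by (simp add: diff_divide_distrib[symmetric])
  have cg: "continuous_on S g" unfolding g_def using u by (intro continuous_on_max) auto
  have fin: "finite P" using quasi_coverD(1)[OF P] .
  have errle: "?err g \<le> ?err u"
  proof (rule sum_mono)
    fix q assume q: "q \<in> P"
    obtain U x r where qe: "q = (U, x, r)" by (cases q)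
    have "U \<subseteq> S" using quasi_coverD(3)[OF P] q qe by blast
    then have "osc g U \<le> osc u U" unfolding g_def by (intro osc_max_const_le bounded_image_S[OF u])
    then show "(case q of (U, x, r) \<Rightarrow> ennreal (osc g U) * indicator {snd x - lam * r .. snd x + lam * r} t)
        \<le> (case q of (U, x, r) \<Rightarrow> ennreal (osc u U) * indicator {snd x - lam * r .. snd x + lam * r} t)"
      by (simp add: qe ennreal_leI mult_right_mono)
  qed
  have "eps / 2 \<le> g (?a, t) - g (?b, t)"
    using j1 j2 unfolding g_def eps_def by (simp add: max_def)
  then have "ennreal (eps / 2) \<le> ennreal (g (?a, t) - g (?b, t))" by (rule ennreal_leI)
  also have "\<dots> \<le> (\<integral>\<^sup>+h. ennreal (osc g (rimt h)) \<partial>count_space ?X) + ?err g"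
    using row_points[OF y i t] by (intro line_osc_le[OF cg _ _ _ P]) (auto simp: divide_right_mono)
  also have "\<dots> \<le> (\<integral>\<^sup>+h. ennreal (osc g (rimt h)) \<partial>count_space ?X) + ?err u"
    using errle by (intro add_left_mono)
  finally have m1: "ennreal (1 / eps) * ennreal (eps / 2)
      \<le> ennreal (1 / eps) * ((\<integral>\<^sup>+h. ennreal (osc g (rimt h)) \<partial>count_space ?X) + ?err u)"
    by (rule mult_left_mono) simp
  have m2: "ennreal (1 / eps) * ((\<integral>\<^sup>+h. ennreal (osc g (rimt h)) \<partial>count_space ?X) + ?err u)
      = (\<integral>\<^sup>+h. ennreal (osc g (rimt h) / eps) \<partial>count_space ?X) + ennreal (2 ^ L) * ?err u"
  proof -
    have "ennreal (1 / eps) * (\<integral>\<^sup>+h. ennreal (osc g (rimt h)) \<partial>count_space ?X)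
        = (\<integral>\<^sup>+h. ennreal (1 / eps) * ennreal (osc g (rimt h)) \<partial>count_space ?X)"
      by (rule nn_integral_cmult[symmetric]) simp
    also have "\<dots> = (\<integral>\<^sup>+h. ennreal (osc g (rimt h) / eps) \<partial>count_space ?X)"
      using eps(1) by (intro nn_integral_cong) (simp add: ennreal_mult'[symmetric])
    finally show ?thesis using eps(2) by (simp add: distrib_left)
  qed
  have m3: "ennreal (1 / eps) * ennreal (eps / 2) = ennreal (1/4) + ennreal (1/4)"
    using eps(1) by (simp add: ennreal_mult'[symmetric] ennreal_plus[symmetric] del: ennreal_plus)
  have "(\<integral>\<^sup>+h. ennreal (osc g (rimt h) / eps) \<partial>count_space ?X)
      \<le> (\<integral>\<^sup>+h. ?F h + ennreal (1 / (4 * w)) * ennreal (side h) \<partial>count_space ?X)"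
  proof (rule nn_integral_mono)
    fix h
    have "ennreal (osc g (rimt h) / eps) \<le> ennreal (w * (osc g (rimt h) / eps)\<^sup>2 / side h + 1 / (4 * w) * side h)"
      using am_gm_weight[OF w side_pos[of h], of "osc g (rimt h) / eps"] by (intro ennreal_leI) simp
    also have "\<dots> = ?F h + ennreal (1 / (4 * w)) * ennreal (side h)"
      using w side_pos[of h] by (subst ennreal_plus) (simp_all add: ennreal_mult'[symmetric])
    finally show "ennreal (osc g (rimt h) / eps) \<le> ?F h + ennreal (1 / (4 * w)) * ennreal (side h)" .
  qed
  also have "\<dots> = (\<integral>\<^sup>+h. ?F h \<partial>count_space ?X) + ennreal (1 / (4 * w)) * (\<integral>\<^sup>+h. ennreal (side h) \<partial>count_space ?X)"
    by (simp add: nn_integral_add nn_integral_cmult)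
  also have "\<dots> \<le> (\<integral>\<^sup>+h. ?F h \<partial>count_space ?X) + ennreal (1 / (4 * w)) * ennreal w"
    using crossing_sides[of ?a ?b t] w ba by (intro add_left_mono mult_left_mono) simp_all
  also have "ennreal (1 / (4 * w)) * ennreal w = ennreal (1/4)"
    using w by (simp add: ennreal_mult'[symmetric])
  finally have m4: "(\<integral>\<^sup>+h. ennreal (osc g (rimt h) / eps) \<partial>count_space ?X)
      \<le> (\<integral>\<^sup>+h. ?F h \<partial>count_space ?X) + ennreal (1/4)" .
  have "ennreal (1/4) + ennreal (1/4)
      \<le> (\<integral>\<^sup>+h. ennreal (osc g (rimt h) / eps) \<partial>count_space ?X) + ennreal (2 ^ L) * ?err u"
    using m1 unfolding m2 m3 .
  also have "\<dots> \<le> ((\<integral>\<^sup>+h. ?F h \<partial>count_space ?X) + ennreal (1/4)) + ennreal (2 ^ L) * ?err u"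
    by (rule add_right_mono[OF m4])
  also have "\<dots> = ennreal (1/4) + ((\<integral>\<^sup>+h. ?F h \<partial>count_space ?X) + ennreal (2 ^ L) * ?err u)"
    by (simp only: ac_simps)
  finally have m5: "ennreal (1/4) \<le> (\<integral>\<^sup>+h. ?F h \<partial>count_space ?X) + ennreal (2 ^ L) * ?err u"
    by (subst (asm) ennreal_add_left_cancel_le) simp
  have m6: "(\<integral>\<^sup>+h. ?F h \<partial>count_space ?X) \<le> (\<integral>\<^sup>+h. ?F h * indicator {t. crosses h t} t \<partial>count_space (tube k))"
  proof -
    have "(\<integral>\<^sup>+h. ?F h \<partial>count_space ?X) = (\<integral>\<^sup>+h. ?F h * indicator ?X h \<partial>count_space UNIV)"
      by (rule nn_integral_count_space_indicator) simp
    also have "\<dots> \<le> (\<integral>\<^sup>+h. ?F h * indicator {t. crosses h t} t * indicator (tube k) h \<partial>count_space UNIV)"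
      using crossing_in_tube[OF y i t] by (intro nn_integral_mono) (auto simp: indicator_def)
    also have "\<dots> = (\<integral>\<^sup>+h. ?F h * indicator {t. crosses h t} t \<partial>count_space (tube k))"
      by (rule nn_integral_count_space_indicator[symmetric]) simp
    finally show ?thesis .
  qed
  show ?thesis using order_trans[OF m5 add_right_mono[OF m6]] unfolding g_def w_def eps_def .
qed

text \<open>Along each line of the tube \<open>u\<close> falls from 1 to 0 in \<open>N\<close> steps of width \<open>w\<close>; at half of the \<open>2 * N\<close> scales
  the first passage is a single jump, which costs energy \<open>1 / (4 * w)\<close> per unit of height. As the rows have
  total height \<open>2 ^ k * w\<close>, one scale collects at least \<open>2 ^ k / 8\<close> in the limit of fine covers.\<close>

lemma tube_energy:
  assumes u: "null_osc S u" and u1: "\<And>z. z \<in> outer \<Longrightarrow> u z = 1" and u0: "\<And>z. z \<in> middle \<Longrightarrow> u z = 0"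
  shows "\<exists>L<2 * (d * m ^ k). \<exists>F. finite F \<and> F \<subseteq> tube k \<and>
    2 ^ k / 8 - 1 \<le> (\<Sum>h\<in>F. (osc (\<lambda>z. max (u z) (1 - (1/2) ^ L)) (rimt h) / (1/2) ^ L)\<^sup>2)"
proof (rule ccontr)
  define N where "N = d * m ^ k"
  define w where "w = 1 / real m ^ Suc k"
  \<comment> \<open>The 1 pays for the errors of the cover: since
    \<open>N / 4 * (2 ^ k * w) = 2 * N * w * (B + 1)\<close>, a total error below
    \<open>2 * N * w\<close> leads to a contradiction.\<close>
  define B where "B = 2 ^ k / (8::real) - 1"
  define o2 where "o2 = (\<lambda>L h. (osc (\<lambda>z. max (u z) (1 - (1/2) ^ L)) (rimt h) / (1/2) ^ L)\<^sup>2)"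
  assume "\<not> ?thesis"
  then have neg: "sum (o2 L) F < B" if "L < 2 * N" "finite F" "F \<subseteq> tube k" for L F
    using that unfolding N_def B_def o2_def by (meson not_le)
  have N: "0 < N" using d m0 by (simp add: N_def)
  have w: "0 < w" using m0 by (simp add: w_def)
  have B: "0 < B" using neg[of 0 "{}"] N by simp
  have ct: "countable (tube k)" by simp
  have cu: "continuous_on S u" using u unfolding null_osc_def by blast
  obtain lam mu where lm: "\<And>e. e > 0 \<Longrightarrow>
      \<exists>P. quasi_cover S lam mu e P \<and> (\<Sum>(U, x, r)\<in>P. (osc u U)\<^sup>2) \<le> e"
    using u unfolding null_osc_def by blast
  define lam' where "lam' = max 0 lam"
  \<comment> \<open>One cover serves all \<open>2 * N\<close> scales. \<open>C\<close> collects the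
    factors \<open>2 ^ L\<close> of their errors, and \<open>e1\<close> is the accuracy that keeps
    the total below \<open>2 * N * w\<close>.\<close>
  define C where "C = (\<Sum>L<2 * N. (2::real) ^ L)"
  have C: "0 \<le> C" and lam': "0 \<le> lam'" by (simp_all add: C_def lam'_def sum_nonneg)
  define e1 where "e1 = N * w / (2 * C * lam' + 1)"
  have CL: "0 \<le> C * lam'" using C lam' by simp
  have e1: "0 < e1" using N w CL by (simp add: e1_def)
  have e1b: "C * (2 * lam' * e1) < 2 * N * w"
  proof -
    have "C * (2 * lam' * e1) = N * w * (2 * C * lam' / (2 * C * lam' + 1))" by (simp add: e1_def)
    also have "\<dots> \<le> N * w * 1" using CL w by (intro mult_left_mono) auto
    also have "\<dots> < 2 * N * w" using N w by simp
    finally show ?thesis .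
  qed
  obtain del where del: "del > 0" "\<And>lam P. quasi_cover S lam mu del P \<Longrightarrow> (\<Sum>(U, x, r)\<in>P. r\<^sup>2) \<le> e1"
    using quasi_cover_mass_small[OF e1, of mu] by blast
  obtain P where P0: "quasi_cover S lam mu (min del e1) P" "(\<Sum>(U, x, r)\<in>P. (osc u U)\<^sup>2) \<le> min del e1"
    using lm[of "min del e1"] del(1) e1 by auto
  have P: "quasi_cover S lam' mu del P"
    by (rule quasi_cover_mono[OF P0(1)]) (auto simp: lam'_def)
  note Pd = quasi_coverD[OF P]
  have r2: "(\<Sum>(U, x, r)\<in>P. r\<^sup>2) \<le> e1" by (rule del(2)[OF P])
  define err where "err = (\<lambda>t. \<Sum>(U, x, r)\<in>P. ennreal (osc u U) * indicator {snd x - lam' * r .. snd x + lam' * r} t)"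
  define H where "H = (\<lambda>L t. (\<integral>\<^sup>+h. ennreal (w * o2 L h / side h) * indicator {t. crosses h t} t \<partial>count_space (tube k)))"
  have line: "ennreal (N / 4) \<le> (\<Sum>L<2 * N. H L t + ennreal (2 ^ L) * err t)" if y: "y \<in> rows k" and t: "t \<in> row k y" for y t
  proof -
    define e where "e = (\<lambda>i::nat. 1 - u (real i / real m ^ Suc k, t))"
    have z0: "(0, t) \<in> S" using row_points(1)[OF y _ t, of 0] N by (simp add: N_def)
    then have "(0, t) \<in> outer" using S_iff[of "(0, t)"] by (simp add: rim_def ocell_def)
    then have e0: "e 0 \<le> 0" using u1 by (simp add: e_def)
    \<comment> \<open>\<open>N\<close> squares of width \<open>w\<close> reach exactly from the left
      side of the outer circle to that of the middle one.\<close>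
    have Nd: "real N / real m ^ Suc k = real d / m" using m0 by (simp add: N_def)
    have "real d / m \<le> t \<and> t \<le> (real d + 1) / m"
      using grid_nested[OF m0, where c = y and e = k and k = 1] rows_div[OF y] t unfolding row_def by auto
    then have "(real d / m, t) \<in> middle" using m0 by (simp add: rim_def cell_def ocell_def divide_right_mono)
    then have eN: "1 \<le> e N" using u0 Nd by (simp add: e_def del: power_Suc)
    let ?G = "{L. L < 2 * N \<and> (\<exists>i<N. e i < (1/2) ^ Suc L \<and> (1/2) ^ L \<le> e (Suc i))}"
    have fG: "finite ?G" by simp
    have "ennreal (N / 4) \<le> ennreal (card ?G / 4)"
      using many_jump_scales[of e N, OF e0 eN] by (intro ennreal_leI) simp
    also have "\<dots> = (\<Sum>L\<in>?G. ennreal (1 / 4))"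
      by (simp add: ennreal_of_nat_eq_real_of_nat ennreal_mult'[symmetric])
    also have "\<dots> \<le> (\<Sum>L\<in>?G. H L t + ennreal (2 ^ L) * err t)"
    proof (rule sum_mono)
      fix L assume "L \<in> ?G"
      then obtain i where i: "i < N" "e i < (1/2) ^ Suc L" "(1/2) ^ L \<le> e (Suc i)" by blast
      have "ennreal (1/4) \<le> (\<integral>\<^sup>+h. ennreal (1 / real m ^ Suc k *
        (osc (\<lambda>z. max (u z) (1 - (1/2) ^ L)) (rimt h) / (1/2) ^ L)\<^sup>2 / side h) * indicator {t. crosses h t} t \<partial>count_space (tube k))
          + ennreal (2 ^ L) * (\<Sum>(U, x, r)\<in>P. ennreal (osc u U) * indicator {snd x - lam' * r .. snd x + lam' * r} t)"
        using i by (intro jump_estimate[OF cu P y _ t]) (simp_all add: N_def e_def add.commute del: power_Suc)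
      then show "ennreal (1 / 4) \<le> H L t + ennreal (2 ^ L) * err t"
        unfolding H_def err_def w_def o2_def .
    qed
    also have "\<dots> \<le> (\<Sum>L<2 * N. H L t + ennreal (2 ^ L) * err t)" by (rule sum_mono2) auto
    finally show ?thesis .
  qed
  have mc: "(\<lambda>t. c * indicator {t. crosses h t} t) \<in> borel_measurable lborel" for c :: ennreal and h
  proof -
    have "{t. crosses h t} \<in> sets lborel" unfolding crosses_def by simp
    then show ?thesis by (intro borel_measurable_times_ennreal borel_measurable_const borel_measurable_indicator)
  qed
  have mH: "H L \<in> borel_measurable lborel" for L
    unfolding H_def by (intro borel_measurable_nn_integral_count_space[OF ct] mc)
  have merr: "err \<in> borel_measurable lborel" unfolding err_def by (simp add: case_prod_beta)
  have IH: "(\<integral>\<^sup>+t. H L t \<partial>lborel) \<le> ennreal (w * B)" if L: "L < 2 * N" for L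
  proof -
    have "(\<integral>\<^sup>+t. H L t \<partial>lborel) = (\<integral>\<^sup>+h. (\<integral>\<^sup>+t. ennreal (w * o2 L h / side h) * indicator {t. crosses h t} t \<partial>lborel) \<partial>count_space (tube k))"
      unfolding H_def by (rule nn_integral_count_space_nn_integral[OF ct mc])
    also have "\<dots> = (\<integral>\<^sup>+h. ennreal (w * o2 L h) \<partial>count_space (tube k))"
    proof (rule nn_integral_cong)
      fix h
      have "{t. crosses h t} = {real (snd (snd h)) / real m ^ fst h <..< (real (snd (snd h)) + 1) / real m ^ fst h}"
        unfolding crosses_def by auto
      then have "emeasure lborel {t. crosses h t} = ennreal (side h)"
        using grid_step[OF m0, of "snd (snd h)" "fst h"] by (simp add: side_def add_divide_distrib)
      moreover have "{t. crosses h t} \<in> sets lborel" unfolding crosses_def by simp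
      ultimately have "(\<integral>\<^sup>+t. ennreal (w * o2 L h / side h) * indicator {t. crosses h t} t \<partial>lborel)
          = ennreal (w * o2 L h / side h) * ennreal (side h)"
        by (simp add: nn_integral_cmult_indicator)
      also have "\<dots> = ennreal (w * o2 L h)"
        using side_pos[of h] w by (subst ennreal_mult'[symmetric]) (simp_all add: o2_def)
      finally show "(\<integral>\<^sup>+t. ennreal (w * o2 L h / side h) * indicator {t. crosses h t} t \<partial>lborel) = ennreal (w * o2 L h)" .
    qed
    also have "\<dots> \<le> ennreal (w * B)"
    proof (rule nn_integral_count_space_le_of_finite_sums[OF ct])
      fix F assume F: "finite F" "F \<subseteq> tube k"
      have "(\<Sum>h\<in>F. ennreal (w * o2 L h)) = ennreal (w * sum (o2 L) F)"
        using w by (subst sum_ennreal) (auto simp: o2_def sum_distrib_left)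
      also have "\<dots> \<le> ennreal (w * B)"
        using neg[OF L F] w by (intro ennreal_leI mult_left_mono) auto
      finally show "(\<Sum>h\<in>F. ennreal (w * o2 L h)) \<le> ennreal (w * B)" .
    qed
    finally show ?thesis .
  qed
  have Ierr: "(\<integral>\<^sup>+t. err t \<partial>lborel) \<le> ennreal (2 * lam' * e1)"
  proof -
    have on: "0 \<le> osc u U" if "(U, x, r) \<in> P" for U x r
      using Pd(3)[OF that] bounded_image_S[OF cu] osc_nonneg by blast
    have "(\<integral>\<^sup>+t. err t \<partial>lborel) = (\<Sum>q\<in>P. (\<integral>\<^sup>+t. ennreal (osc u (fst q)) *
        indicator {snd (fst (snd q)) - lam' * snd (snd q) .. snd (fst (snd q)) + lam' * snd (snd q)} t \<partial>lborel))"
      unfolding err_def case_prod_beta by (rule nn_integral_sum) simp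
    also have "\<dots> = (\<Sum>q\<in>P. ennreal (osc u (fst q) * (2 * lam' * snd (snd q))))"
    proof (rule sum.cong)
      fix q assume q: "q \<in> P"
      have r: "0 \<le> snd (snd q)" using Pd(3)[of "fst q" "fst (snd q)" "snd (snd q)"] q by simp
      have o: "0 \<le> osc u (fst q)" using on[of "fst q" "fst (snd q)" "snd (snd q)"] q by simp
      have lr: "0 \<le> lam' * snd (snd q)" using r lam' by simp
      have "(\<integral>\<^sup>+t. ennreal (osc u (fst q)) *
        indicator {snd (fst (snd q)) - lam' * snd (snd q) .. snd (fst (snd q)) + lam' * snd (snd q)} t \<partial>lborel)
         = ennreal (osc u (fst q)) * ennreal (2 * lam' * snd (snd q))"
        using lr by (subst nn_integral_cmult_indicator) (simp_all add: algebra_simps)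
      then show "(\<integral>\<^sup>+t. ennreal (osc u (fst q)) *
        indicator {snd (fst (snd q)) - lam' * snd (snd q) .. snd (fst (snd q)) + lam' * snd (snd q)} t \<partial>lborel)
         = ennreal (osc u (fst q) * (2 * lam' * snd (snd q)))"
        using o by (simp add: ennreal_mult')
    qed simp
    also have "\<dots> = ennreal (\<Sum>q\<in>P. osc u (fst q) * (2 * lam' * snd (snd q)))"
    proof (rule sum_ennreal)
      fix q assume q: "q \<in> P"
      then show "0 \<le> osc u (fst q) * (2 * lam' * snd (snd q))"
        using on[of "fst q" "fst (snd q)" "snd (snd q)"] Pd(3)[of "fst q" "fst (snd q)" "snd (snd q)"] lam' by simp
    qed
    also have "\<dots> \<le> ennreal (2 * lam' * e1)"
    proof (rule ennreal_leI)
      \<comment> \<open>The mixed terms are split into squares: those of the oscillations are small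
        by the choice of the cover, those of the radii because \<open>S\<close> has area
        zero.\<close>
      have "(\<Sum>q\<in>P. osc u (fst q) * (2 * lam' * snd (snd q))) \<le> (\<Sum>q\<in>P. lam' * ((osc u (fst q))\<^sup>2 + (snd (snd q))\<^sup>2))"
      proof (rule sum_mono)
        fix q
        have "2 * (osc u (fst q) * snd (snd q)) \<le> (osc u (fst q))\<^sup>2 + (snd (snd q))\<^sup>2"
          using sum_squares_bound[of "osc u (fst q)" "snd (snd q)"] by (simp add: mult.assoc)
        then have "lam' * (2 * (osc u (fst q) * snd (snd q))) \<le> lam' * ((osc u (fst q))\<^sup>2 + (snd (snd q))\<^sup>2)"
          using lam' by (rule mult_left_mono)
        then show "osc u (fst q) * (2 * lam' * snd (snd q)) \<le> lam' * ((osc u (fst q))\<^sup>2 + (snd (snd q))\<^sup>2)"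
          by (simp only: ac_simps)
      qed
      also have "\<dots> = lam' * ((\<Sum>(U, x, r)\<in>P. (osc u U)\<^sup>2) + (\<Sum>(U, x, r)\<in>P. r\<^sup>2))"
        by (simp add: case_prod_beta sum_distrib_left[symmetric] sum.distrib)
      also have "\<dots> \<le> lam' * (e1 + e1)" using P0(2) r2 lam' by (intro mult_left_mono add_mono) auto
      finally show "(\<Sum>q\<in>P. osc u (fst q) * (2 * lam' * snd (snd q))) \<le> 2 * lam' * e1" by simp
    qed
    finally show ?thesis .
  qed
  let ?J = "\<Union>y\<in>rows k. row k y"
  have fr: "finite (rows k)" and cr: "card (rows k) = 2 ^ k" using card_rows by auto
  have mrow: "row k y \<in> sets lborel" for y :: nat unfolding row_def by simp
  have erow: "emeasure lborel (row k y) = ennreal w" for y :: nat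
    using grid_step[OF m0, of y "Suc k"] unfolding row_def w_def by (simp add: add_divide_distrib del: power_Suc)
  have drow: "disjoint_family_on (row k) (rows k)"
    unfolding disjoint_family_on_def
  proof (intro ballI impI)
    fix y y' :: nat assume "y \<noteq> y'"
    then have "\<not> (t \<in> row k y \<and> t \<in> row k y')" for t
      using grid_div[OF m0, of y "Suc k" y' 0] unfolding row_def by (auto simp del: power_Suc)
    then show "row k y \<inter> row k y' = {}" by blast
  qed
  have eJ: "emeasure lborel ?J = ennreal (2 ^ k * w)"
  proof -
    have "emeasure lborel ?J = (\<Sum>y\<in>rows k. emeasure lborel (row k y))"
      using mrow by (intro sum_emeasure[symmetric] drow fr) auto
    also have "\<dots> = of_nat (2 ^ k) * ennreal w" by (simp add: erow cr)
    also have "\<dots> = ennreal (2 ^ k * w)" using w by (simp add: ennreal_of_nat_eq_real_of_nat ennreal_mult'[symmetric])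
    finally show ?thesis .
  qed
  have "ennreal (N / 4 * (2 ^ k * w)) = ennreal (N / 4) * emeasure lborel ?J"
    unfolding eJ by (subst ennreal_mult'[symmetric]) simp_all
  also have "\<dots> = (\<integral>\<^sup>+t. ennreal (N / 4) * indicator ?J t \<partial>lborel)"
    using mrow fr by (intro nn_integral_cmult_indicator[symmetric] sets.finite_UN) auto
  also have "\<dots> \<le> (\<integral>\<^sup>+t. (\<Sum>L<2 * N. H L t + ennreal (2 ^ L) * err t) \<partial>lborel)"
    using line by (intro nn_integral_mono) (auto simp: indicator_def)
  also have "\<dots> = (\<Sum>L<2 * N. (\<integral>\<^sup>+t. H L t \<partial>lborel) + ennreal (2 ^ L) * (\<integral>\<^sup>+t. err t \<partial>lborel))"
    using mH merr by (simp add: nn_integral_sum nn_integral_add nn_integral_cmult)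
  also have "\<dots> \<le> (\<Sum>L<2 * N. ennreal (w * B) + ennreal (2 ^ L) * ennreal (2 * lam' * e1))"
    using IH Ierr by (intro sum_mono add_mono mult_left_mono) auto
  also have "\<dots> = (\<Sum>L<2 * N. ennreal (w * B + 2 ^ L * (2 * lam' * e1)))"
    using w B lam' e1 by (intro sum.cong refl, subst ennreal_plus) (simp_all add: ennreal_mult')
  also have "\<dots> = ennreal (\<Sum>L<2 * N. w * B + 2 ^ L * (2 * lam' * e1))"
    using w B lam' e1 by (intro sum_ennreal) simp
  also have "(\<Sum>L<2 * N. w * B + 2 ^ L * (2 * lam' * e1)) = 2 * N * (w * B) + C * (2 * lam' * e1)"
    by (simp add: sum.distrib C_def sum_distrib_right)
  finally have "N / 4 * (2 ^ k * w) \<le> 2 * N * (w * B) + C * (2 * lam' * e1)"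
    using w B C lam' e1 by (subst (asm) ennreal_le_iff) auto
  then have "N / 4 * (2 ^ k * w) < 2 * N * (w * B) + 2 * N * w" using e1b by linarith
  then show False by (simp add: B_def algebra_simps)
qed

end

section \<open>The outer and the middle circle form the only maximal pair\<close>

lemma kept_flip:
  assumes n: "0 < n" and R: "\<And>i j. i < n \<Longrightarrow> (n - 1 - i, j) \<in> R \<longleftrightarrow> (i, j) \<in> R"
  shows "a < n ^ k \<Longrightarrow> kept n R k (n ^ k - 1 - a) b \<longleftrightarrow> kept n R k a b"
    and "a < n ^ k \<Longrightarrow> hole n R k (n ^ k - 1 - a) b \<longleftrightarrow> hole n R k a b"
proof -
  \<comment> \<open>Subtraction from \<open>n ^ k - 1\<close> replaces each digit by its complement
    to \<open>n - 1\<close>, so a symmetry of the pattern \<open>R\<close> acts on every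
    level.\<close>
  have dm: "(n ^ Suc k - 1 - a) div n = n ^ k - 1 - a div n \<and> (n ^ Suc k - 1 - a) mod n = n - 1 - a mod n
      \<and> a div n < n ^ k \<and> a mod n < n"
    if "a < n ^ Suc k" for a k
  proof -
    have q: "a div n < n ^ k" using that n by (simp add: div_less_iff_less_mult mult.commute)
    have r: "a mod n < n" using n by simp
    obtain p where p: "n ^ k = Suc (a div n + p)" using q less_iff_Suc_add by auto
    obtain s where s: "n = Suc (a mod n + s)" using r less_iff_Suc_add by auto
    have "n ^ Suc k = n * (a div n) + n * p + n" using p by (simp add: algebra_simps)
    moreover have "a = n * (a div n) + a mod n" by simp
    ultimately have "n ^ Suc k - 1 - a = n * p + s" using s by linarith
    moreover have "s < n" using s by linarith
    ultimately have "(n ^ Suc k - 1 - a) div n = p \<and> (n ^ Suc k - 1 - a) mod n = s" by simp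
    then show ?thesis using p s q r by linarith
  qed
  show kept: "a < n ^ k \<Longrightarrow> kept n R k (n ^ k - 1 - a) b \<longleftrightarrow> kept n R k a b" for k a b
  proof (induction k arbitrary: a b)
    case (Suc k)
    then show ?case using dm[OF Suc.prems] R by (simp del: power_Suc)
  qed simp
  show "a < n ^ k \<Longrightarrow> hole n R k (n ^ k - 1 - a) b \<longleftrightarrow> hole n R k a b"
  proof (cases k)
    case (Suc k')
    assume "a < n ^ k"
    then show ?thesis using dm[of a k'] R kept[of "a div n" k' "b div n"] Suc by (simp del: power_Suc)
  qed simp
qed

lemma kept_transpose:
  assumes R: "\<And>i j. (j, i) \<in> R \<longleftrightarrow> (i, j) \<in> R"
  shows "kept n R k b a \<longleftrightarrow> kept n R k a b" and "hole n R k b a \<longleftrightarrow> hole n R k a b"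
proof -
  show kept: "kept n R k b a \<longleftrightarrow> kept n R k a b" for k a b
    by (induction k arbitrary: a b) (use R in auto)
  show "hole n R k b a \<longleftrightarrow> hole n R k a b"
    by (cases k) (use kept R in auto)
qed

definition mirror :: "plane \<Rightarrow> plane" where
  "mirror z = (1 - fst z, snd z)"

definition transposition :: "plane \<Rightarrow> plane" where
  "transposition z = (snd z, fst z)"

lemma dist_mirror: "dist (mirror x) (mirror y) = dist x y"
  by (simp add: mirror_def dist_prod_def dist_real_def abs_minus_commute)

lemma dist_transposition: "dist (transposition x) (transposition y) = dist x y"
  by (simp add: transposition_def dist_prod_def add.commute)

lemma mirror_mirror: "mirror (mirror z) = z"
  by (simp add: mirror_def)

lemma transposition_transposition: "transposition (transposition z) = z"
  by (simp add: transposition_def)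

lemma flip_coord:
  fixes x :: real
  assumes n: "0 < n" and a: "a < n ^ k"
  shows "real (n ^ k - 1 - a) / real n ^ k = 1 - (real a + 1) / real n ^ k"
    "(real (n ^ k - 1 - a) + 1) / real n ^ k = 1 - real a / real n ^ k"
proof -
  have e: "real (n ^ k - 1 - a) = real n ^ k - 1 - real a"
    using a by (simp add: of_nat_diff)
  show "real (n ^ k - 1 - a) / real n ^ k = 1 - (real a + 1) / real n ^ k"
    "(real (n ^ k - 1 - a) + 1) / real n ^ k = 1 - real a / real n ^ k"
    unfolding e using n by (simp_all add: field_simps)
qed

lemma mirror_mem:
  assumes "0 < n" "a < n ^ k"
  shows "mirror z \<in> cell n k (n ^ k - 1 - a) b \<longleftrightarrow> z \<in> cell n k a b"
    "mirror z \<in> ocell n k (n ^ k - 1 - a) b \<longleftrightarrow> z \<in> ocell n k a b"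
  unfolding cell_def ocell_def mem_Times_iff flip_coord[OF assms] mirror_def fst_conv snd_conv
    atLeastAtMost_iff greaterThanLessThan_iff by auto

lemma transposition_mem:
  "transposition z \<in> cell n k b a \<longleftrightarrow> z \<in> cell n k a b"
  "transposition z \<in> ocell n k b a \<longleftrightarrow> z \<in> ocell n k a b"
  unfolding cell_def ocell_def transposition_def mem_Times_iff by auto

lemma carpet_iff:
  assumes "0 < n" "R \<subseteq> {..<n} \<times> {..<n}"
  shows "z \<in> carpet n R \<longleftrightarrow> z \<in> cell n 0 0 0 \<and> (\<forall>k a b. hole n R k a b \<longrightarrow> z \<notin> ocell n k a b)"
  unfolding carpet_eq[OF assms] gaps_def by blast

lemma mirror_carpet:
  assumes n: "0 < n" and R: "R \<subseteq> {..<n} \<times> {..<n}"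
    and sym: "\<And>i j. i < n \<Longrightarrow> (n - 1 - i, j) \<in> R \<longleftrightarrow> (i, j) \<in> R"
    and z: "z \<in> carpet n R"
  shows "mirror z \<in> carpet n R"
  unfolding carpet_iff[OF n R]
proof (intro conjI allI impI)
  show "mirror z \<in> cell n 0 0 0"
    using z mirror_mem(1)[OF n, of 0 0 z 0] carpet_iff[OF n R] by simp
  fix k a b assume h: "hole n R k a b"
  have a: "a < n ^ k" using hole_less[OF n h] by simp
  have "hole n R k (n ^ k - 1 - a) b" using kept_flip(2)[OF n sym a] h by blast
  then have "z \<notin> ocell n k (n ^ k - 1 - a) b" using z carpet_iff[OF n R] by blast
  then show "mirror z \<notin> ocell n k a b"
    using mirror_mem(2)[OF n a, of "mirror z" b] mirror_mirror by metis
qed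

lemma transposition_carpet:
  assumes n: "0 < n" and R: "R \<subseteq> {..<n} \<times> {..<n}"
    and sym: "\<And>i j. (j, i) \<in> R \<longleftrightarrow> (i, j) \<in> R" and z: "z \<in> carpet n R"
  shows "transposition z \<in> carpet n R"
  unfolding carpet_iff[OF n R]
proof (intro conjI allI impI)
  show "transposition z \<in> cell n 0 0 0"
    using z transposition_mem(1) carpet_iff[OF n R] by blast
  fix k a b assume "hole n R k a b"
  then have "hole n R k b a" using kept_transpose(2)[of R, OF sym] by blast
  then have "z \<notin> ocell n k b a" using z carpet_iff[OF n R] by blast
  then show "transposition z \<notin> ocell n k a b" using transposition_mem(2) by blast
qed

lemma isometry_homeomorphism:
  fixes g :: "'a::metric_space \<Rightarrow> 'a"
  assumes "\<And>x y. dist (g x) (g y) = dist x y" "\<And>x. x \<in> S \<Longrightarrow> g x \<in> S" "\<And>x. g (g x) = x"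
  shows "homeomorphism S S g g" "weak_qs S g"
proof -
  have "continuous_on S g" unfolding continuous_on_iff using assms(1) by metis
  moreover have "g ` S = S"
  proof (intro equalityI subsetI)
    fix x assume "x \<in> S"
    then show "x \<in> g ` S" using assms(2)[of x] assms(3)[of x] by (intro image_eqI[of _ _ "g x"]) simp_all
  qed (use assms(2) in auto)
  ultimately show "homeomorphism S S g g" using assms(3) by (simp add: homeomorphism_def)
  show "weak_qs S g" unfolding weak_qs_def assms(1) by blast
qed

section \<open>The energy saving near the left or right side of a square\<close>

context odd_carpet
begin

lemma mirror_S: "z \<in> S \<Longrightarrow> mirror z \<in> S"
  by (rule mirror_carpet[OF m0 mid]) (use m in auto)

lemmas mirror_homeo = isometry_homeomorphism(1)[where S = S, OF dist_mirror mirror_S mirror_mirror]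
lemmas mirror_qs = isometry_homeomorphism(2)[where S = S, OF dist_mirror mirror_S mirror_mirror]

text \<open>The box between the left side of the unit square and the middle hole. In its copy the
  cutoff will be 1, so \<open>C1\<close> has to stay away from it.\<close>

definition tube_box :: "plane set" where
  "tube_box = {0 .. real d / m} \<times> {real d / m .. (real d + 1) / m}"

lemma tube_rim_subset: "h \<in> tube k \<Longrightarrow> rimt h \<subseteq> tube_box"
proof -
  assume "h \<in> tube k"
  then obtain i y where iy: "i < d * m ^ k" "y \<in> rows k" "cell m (fst h) (fst (snd h)) (snd (snd h)) \<subseteq> cell m (Suc k) i y"
    unfolding tube_def by blast
  have "real (i + 1) \<le> real (d * m ^ k)" using iy(1) by linarith
  then have "(real i + 1) / real m ^ Suc k \<le> real (d * m ^ k) / real m ^ Suc k"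
    by (intro divide_right_mono) auto
  also have "\<dots> = real d / m" using m0 by simp
  finally have x: "(real i + 1) / real m ^ Suc k \<le> real d / m" .
  have "real d / m \<le> real y / real m ^ Suc k" "(real y + 1) / real m ^ Suc k \<le> (real d + 1) / m"
    using grid_nested[OF m0, where c = y and e = k and k = 1] rows_div[OF iy(2)] by simp_all
  then have "cell m (Suc k) i y \<subseteq> tube_box"
    using x unfolding cell_def tube_box_def by (intro Sigma_mono) (auto simp del: power_Suc intro: order_trans[rotated])
  then show ?thesis using iy(3) unfolding rim_def by blast
qed

lemma rim_nonempty: "rim m k a b \<noteq> {}"
proof -
  have "(real a / real m ^ k, real b / real m ^ k) \<in> rim m k a b"
    using grid_step[OF m0, of a k] grid_step[OF m0, of b k] by (simp add: rim_def cell_def ocell_def)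
  then show ?thesis by blast
qed

lemma inj_on_rimt: "inj_on rimt holes"
proof (rule inj_onI)
  fix h h' assume h: "h \<in> holes" "h' \<in> holes" and e: "rimt h = rimt h'"
  obtain z where "z \<in> rimt h" using rim_nonempty by blast
  then have "cell m (fst h) (fst (snd h)) (snd (snd h)) \<inter> cell m (fst h') (fst (snd h')) (snd (snd h')) \<noteq> {}"
    using e unfolding rim_def by blast
  then have "(fst h, fst (snd h), snd (snd h)) = (fst h', fst (snd h'), snd (snd h'))"
    using hole_cells_disjoint h unfolding holes_iff by blast
  then show "h = h'" by (simp add: prod_eq_iff)
qed

lemma zoom_rim_peripheral:
  assumes k: "kept m mid k i j" and h: "h \<in> holes"
  shows "peripheral S (zoom m k i j ` rimt h)"
proof -
  obtain e a b where he: "h = (e, a, b)" by (cases h)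
  have hh: "hole m mid e a b" using h he by (simp add: holes_def)
  obtain e' where e': "e = Suc e'" using hh by (cases e) auto
  have "hole m mid (k + Suc e') (i * m ^ Suc e' + a) (j * m ^ Suc e' + b)"
    using hole_split[of a m e' b mid k i j] hole_less[OF m0 hh] hh k unfolding e' by blast
  then have "peripheral S (rim m (k + e) (i * m ^ e + a) (j * m ^ e + b))"
    unfolding e' by (intro rim_peripheral) (simp only: rim_index_def simp_thms)
  then show ?thesis using zoom_rim[OF m0, of k i j e a b] he by simp
qed

text \<open>Lowering the extremal potential of a copy of \<open>S\<close> to \<open>1 - eps\<close> along the tube saves energy \<open>eps\<^sup>2 * 2 ^ k' / 8\<close>
  and costs \<open>eps\<^sup>2 * E\<close> for the cutoff function, where \<open>E\<close> does not depend on \<open>k'\<close>.\<close>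

lemma adm_improve:
  assumes k: "kept m mid k i j" and C1: "closed C1" "C1 \<inter> ocell m k i j = {}"
    "C1 \<inter> zoom m k i j ` tube_box = {}"
  shows "\<exists>del>0. \<forall>K. adm S outer middle K \<longrightarrow> adm S C1 (zoom m k i j ` middle) (K - del)"
proof -
  let ?z = "zoom m k i j"
  define T where "T = ?z ` tube_box"
  have "compact tube_box" unfolding tube_box_def by (intro compact_Times) auto
  then have T: "compact T" unfolding T_def by (intro compact_continuous_image continuous_zoom m0)
  have "(0, real d / m) \<in> tube_box" unfolding tube_box_def by (simp add: divide_right_mono)
  then have Tne: "T \<noteq> {}" unfolding T_def by blast
  obtain r where r: "0 < r" "\<And>x y. x \<in> T \<Longrightarrow> y \<in> C1 \<Longrightarrow> r \<le> dist x y"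
    using separate_compact_closed[OF T C1(1)] C1(3) unfolding T_def by blast
  \<comment> \<open>Here \<open>r\<close> bounds the distance between the copied box and
    \<open>C1\<close> from below, so the cutoff is 1 on the box and 0 on \<open>C1\<close>, with
    Lipschitz constant \<open>1 / r\<close>.\<close>
  define ph where "ph = (\<lambda>z. max 0 (1 - infdist z T / r))"
  have ph01: "0 \<le> ph z" "ph z \<le> 1" for z
    using infdist_nonneg[of z T] r(1) unfolding ph_def by simp_all
  have phT: "ph z = 1" if "z \<in> T" for z using that unfolding ph_def by simp
  have phC: "ph z = 0" if "z \<in> C1" for z
  proof -
    obtain x where "x \<in> T" "infdist z T = dist z x"
      using infdist_attains_inf[OF compact_imp_closed[OF T] Tne] by blast
    then have "r \<le> infdist z T" using r(2)[of x z] that by (simp add: dist_commute)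
    then show ?thesis using r(1) unfolding ph_def by simp
  qed
  have phL: "\<bar>ph x - ph y\<bar> \<le> dist x y / r" for x y
  proof -
    have "\<bar>ph x - ph y\<bar> \<le> \<bar>infdist x T / r - infdist y T / r\<bar>" unfolding ph_def by (simp add: max_def abs_if)
    also have "\<dots> = \<bar>infdist x T - infdist y T\<bar> / r" using r(1) by (simp add: diff_divide_distrib[symmetric])
    also have "\<dots> \<le> dist x y / r" using r(1) infdist_triangle_abs by (intro divide_right_mono) auto
    finally show ?thesis .
  qed
  \<comment> \<open>This is the bound of \<open>energy_lipschitz\<close> for the constant
    \<open>1 / r\<close>. The choice of \<open>k'\<close> lifts the gain
    \<open>2 ^ k' / 8 - 1\<close> above \<open>E + 1\<close>, so that a net saving of
    \<open>eps\<^sup>2\<close> remains.\<close>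
  define E where "E = 8 / r\<^sup>2"
  obtain k' where k': "8 * (E + 2) < 2 ^ k'" using real_arch_pow[of 2] by auto
  define N where "N = d * m ^ k'"
  \<comment> \<open>The scale \<open>L\<close> varies with the potential, but
    \<open>L < 2 * N\<close> bounds \<open>eps\<^sup>2\<close> from below by a number that depends
    on the geometry alone.\<close>
  define del where "del = ((1/2::real) ^ (2 * N))\<^sup>2"
  have del: "0 < del" unfolding del_def by simp
  have "adm S C1 (?z ` middle) (K - del)" if a: "adm S outer middle K" for K
  proof -
    obtain u where u: "null_osc S u" "energy_le S u K" and u1: "\<And>z. z \<in> outer \<Longrightarrow> u z = 1"
      and u0: "\<And>z. z \<in> middle \<Longrightarrow> u z = 0"
      using a unfolding adm_def by auto
    obtain L F where L: "L < 2 * N" and F: "finite F" "F \<subseteq> tube k'" and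
      gain: "2 ^ k' / 8 - 1 \<le> (\<Sum>h\<in>F. (osc (\<lambda>z. max (u z) (1 - (1/2) ^ L)) (rimt h) / (1/2) ^ L)\<^sup>2)"
      using tube_energy[OF u(1) u1 u0, of k'] unfolding N_def by blast
    define eps where "eps = (1/2::real) ^ L"
    have eps: "0 < eps" "eps \<le> 1" unfolding eps_def by (simp_all add: power_le_one)
    have epsdel: "del \<le> eps\<^sup>2"
      unfolding del_def eps_def using L by (intro power_mono power_decreasing) auto
    define v0 where "v0 = glue k i j u"
    define f where "f = (\<lambda>z. 1 - eps * ph z)"
    define v where "v = (\<lambda>z. min (v0 z) (f z))"
    define g where "g = (\<lambda>C. osc (\<lambda>z. max (v0 z) (1 - eps)) C)"
    define FF where "FF = (\<lambda>h. ?z ` rimt h) ` F"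
    have Fh: "F \<subseteq> holes" using F(2) unfolding tube_def by blast
    have fL: "\<bar>f x - f y\<bar> \<le> eps / r * dist x y" for x y
    proof -
      have "\<bar>f x - f y\<bar> = eps * \<bar>ph x - ph y\<bar>"
      proof -
        have "f x - f y = eps * (ph y - ph x)" by (simp add: f_def algebra_simps)
        then show ?thesis using eps(1) by (simp add: abs_mult abs_minus_commute)
      qed
      also have "\<dots> \<le> eps * (dist x y / r)" using eps(1) phL by (intro mult_left_mono) auto
      finally show ?thesis by simp
    qed
    have L0: "0 \<le> eps / r" using eps r by simp
    have v0: "null_osc S v0" "energy_le S v0 K"
      unfolding v0_def by (rule null_osc_glue[OF k u(1)] energy_glue[OF k _ u(2)]; use u1 in blast)+
    have v: "null_osc S v" unfolding v_def by (rule null_osc_min_lipschitz[OF v0(1) L0 fL])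
    have fen: "energy_le S f (eps\<^sup>2 * E)"
      using energy_lipschitz[OF L0 fL] by (simp add: E_def power_divide mult.commute)
    have cv0: "continuous_on S v0" using v0(1) unfolding null_osc_def by blast
    have cf: "continuous_on S f"
      using L0 fL by (intro lipschitz_on_continuous_on lipschitz_onI) (auto simp: dist_real_def)
    have gsum: "eps\<^sup>2 * (E + 1) \<le> (\<Sum>C\<in>FF. (g C)\<^sup>2)"
    proof -
      have inj: "inj_on (\<lambda>h. ?z ` rimt h) F"
      proof (rule inj_onI)
        fix h h' assume h: "h \<in> F" "h' \<in> F" "?z ` rimt h = ?z ` rimt h'"
        have "inj ?z" using unzoom_zoom[OF m0] by (metis injI)
        then have "rimt h = rimt h'" using h(3) by (simp add: inj_image_eq_iff)
        then show "h = h'" using inj_on_rimt h Fh by (meson inj_onD subsetD)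
      qed
      have "(g (?z ` rimt h))\<^sup>2 = eps\<^sup>2 * (osc (\<lambda>z. max (u z) (1 - (1/2) ^ L)) (rimt h) / (1/2) ^ L)\<^sup>2" if "h \<in> F" for h
      proof -
        have "rimt h \<subseteq> cell m 0 0 0" using rimt_subset_S[of h] that Fh S_iff by blast
        then have "osc ((\<lambda>z. max (v0 z) (1 - eps)) \<circ> ?z) (rimt h) = osc (\<lambda>z. max (u z) (1 - eps)) (rimt h)"
          unfolding v0_def by (intro osc_cong) (auto simp: glue_zoom subset_iff)
        then have "g (?z ` rimt h) = osc (\<lambda>z. max (u z) (1 - eps)) (rimt h)"
          unfolding g_def osc_image .
        then show ?thesis using eps(1) unfolding eps_def[symmetric] by (simp add: power_divide)
      qed
      then have "(\<Sum>C\<in>FF. (g C)\<^sup>2) = eps\<^sup>2 * (\<Sum>h\<in>F. (osc (\<lambda>z. max (u z) (1 - (1/2) ^ L)) (rimt h) / (1/2) ^ L)\<^sup>2)"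
        unfolding FF_def by (simp add: sum.reindex[OF inj] sum_distrib_left)
      also have "\<dots> \<ge> eps\<^sup>2 * (E + 1)" using gain k' by (intro mult_left_mono) auto
      finally show ?thesis .
    qed
    have en: "energy_le S v (K - del)"
      unfolding energy_le_def
    proof (intro allI impI, elim conjE)
      fix G assume G: "finite G" "G \<subseteq> Collect (peripheral S)"
      \<comment> \<open>The given family may lack the circles of the tube. Adding them can only
        increase the sum for \<open>v\<close>, and it brings in the saving.\<close>
      define D where "D = G \<union> FF"
      have "FF \<subseteq> Collect (peripheral S)"
        unfolding FF_def using zoom_rim_peripheral[OF k] Fh by blast
      then have D: "finite D" "D \<subseteq> Collect (peripheral S)"
        using G F(1) unfolding D_def FF_def by auto
      have pt: "(osc v C)\<^sup>2 \<le> (osc v0 C)\<^sup>2 + (osc f C)\<^sup>2 - (if C \<in> FF then (g C)\<^sup>2 else 0)" if C: "C \<in> D" for C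
      proof -
        have CS: "C \<subseteq> S" using C D(2) unfolding peripheral_def by blast
        have b: "bounded (v0 ` C)" "bounded (f ` C)" using bounded_image_S cv0 cf CS by auto
        show ?thesis
        proof (cases "C \<in> FF")
          case False then show ?thesis using osc_min_sq_le[OF b] unfolding v_def by simp
        next
          case True
          then obtain h where h: "h \<in> F" "C = ?z ` rimt h" unfolding FF_def by blast
          \<comment> \<open>On these circles the cutoff is 1, so \<open>v\<close> is
            \<open>v0\<close> cut at the constant height \<open>1 - eps\<close>.\<close>
          have "C \<subseteq> T" using h tube_rim_subset F(2) unfolding T_def by blast
          then have "osc v C = osc (\<lambda>z. min (v0 z) (1 - eps)) C"
            unfolding v_def f_def using phT by (intro osc_cong) auto
          then have "(osc v C)\<^sup>2 + (g C)\<^sup>2 \<le> (osc v0 C)\<^sup>2"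
            using osc_min_max_const[OF b(1), of "1 - eps"] unfolding g_def by simp
          then show ?thesis using True by (simp add: add_increasing2 le_diff_eq)
        qed
      qed
      have "(\<Sum>C\<in>G. (osc v C)\<^sup>2) \<le> (\<Sum>C\<in>D. (osc v C)\<^sup>2)"
        using D(1) unfolding D_def by (intro sum_mono2) auto
      also have "\<dots> \<le> (\<Sum>C\<in>D. (osc v0 C)\<^sup>2 + (osc f C)\<^sup>2 - (if C \<in> FF then (g C)\<^sup>2 else 0))"
        by (rule sum_mono) (rule pt)
      also have "\<dots> = (\<Sum>C\<in>D. (osc v0 C)\<^sup>2) + (\<Sum>C\<in>D. (osc f C)\<^sup>2) - (\<Sum>C\<in>D. if C \<in> FF then (g C)\<^sup>2 else 0)"
        by (simp add: sum.distrib sum_subtractf)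
      also have "(\<Sum>C\<in>D. if C \<in> FF then (g C)\<^sup>2 else 0) = (\<Sum>C\<in>FF. (g C)\<^sup>2)"
        using D(1) unfolding D_def by (simp add: sum.inter_restrict[symmetric] Int_absorb1)
      also have "(\<Sum>C\<in>D. (osc v0 C)\<^sup>2) + (\<Sum>C\<in>D. (osc f C)\<^sup>2) - (\<Sum>C\<in>FF. (g C)\<^sup>2)
          \<le> K + eps\<^sup>2 * E - eps\<^sup>2 * (E + 1)"
        using v0(2) fen D gsum unfolding energy_le_def by (intro diff_mono add_mono) auto
      also have "\<dots> = K - eps\<^sup>2" by (simp add: algebra_simps)
      also have "\<dots> \<le> K - del" using epsdel by simp
      finally show "(\<Sum>C\<in>G. (osc v C)\<^sup>2) \<le> K - del" .
    qed
    have "v z = 1" if "z \<in> C1" for z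
    proof -
      have "z \<notin> ocell m k i j" using that C1(2) by blast
      then have "v0 z = 1" unfolding v0_def using glue_outside[of u z k i j] u1 by blast
      then show ?thesis using phC[OF that] by (simp add: v_def f_def)
    qed
    moreover have "v z = 0" if "z \<in> ?z ` middle" for z
    proof -
      obtain w where w: "w \<in> middle" "z = ?z w" using \<open>z \<in> ?z ` middle\<close> by blast
      have "middle \<subseteq> S" using peripheral_middle unfolding peripheral_def by blast
      then have "v0 z = 0" unfolding v0_def w(2) using w(1) u0[of w] S_iff[of w] by (subst glue_zoom) blast+
      moreover have "0 \<le> f z" unfolding f_def using eps ph01[of z] mult_mono[of eps 1 "ph z" 1] by simp
      ultimately show ?thesis by (simp add: v_def)
    qed
    ultimately show ?thesis unfolding adm_def using v en by blast
  qed
  then show ?thesis using del by blast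
qed

lemma coarse_rim_avoids_open_cell:
  assumes "k = k1 + e" shows "rim m k1 a b \<inter> ocell m k i j = {}"
proof (rule ccontr)
  assume ne: "\<not> ?thesis"
  then have "cell m k1 a b \<inter> ocell m (k1 + e) i j \<noteq> {}" unfolding assms rim_def by blast
  then have "i div m ^ e = a \<and> j div m ^ e = b" by (intro cell_Int_ocell_div[OF m0]) blast
  then have "ocell m k i j \<subseteq> ocell m k1 a b" using cell_nested(2)[OF m0, of k1 e i j] assms by simp
  then show False using ne unfolding rim_def by blast
qed

lemma tube_box_in_unit: "tube_box \<subseteq> cell m 0 0 0"
proof -
  have "real d / m \<le> 1" "(real d + 1) / m \<le> 1" using dm m0 by (simp_all add: field_simps)
  then show ?thesis unfolding tube_box_def cell_0
    by (intro Sigma_mono) (auto intro: order_trans[of _ "real d / m"] order_trans[of _ _ "1::real"])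
qed

text \<open>A circle of a coarser or equal level runs along grid lines and can touch the closed
  square \<open>(i, j)\<close> only in its sides. The box reaches the boundary of the square only in
  the left side, away from the corners; so that side lies on a vertical side of the circle, and the
  square lies in the rows that the circle spans. The mirrored box gives the same for the right
  side.\<close>

lemma grid_line_through_tube_end:
  assumes kk: "k = k1 + e" and w: "w \<in> tube_box \<or> mirror w \<in> tube_box" and z: "zoom m k i j w \<in> rim m k1 a b"
  shows "b * m ^ e \<le> j \<and> j < (b + 1) * m ^ e \<and>
    (w \<in> tube_box \<longrightarrow> i = a * m ^ e \<or> i = (a + 1) * m ^ e) \<and>
    (mirror w \<in> tube_box \<longrightarrow> i + 1 = a * m ^ e \<or> i + 1 = (a + 1) * m ^ e)"
proof -
  obtain x y where xy: "w = (x, y)" by (cases w)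
  have b0: "0 < real d / m" "(real d + 1) / m < 1" "real d / m < 1" using d dm m0 by (simp_all add: field_simps)
  then have y: "0 < y" "y < 1" and xx: "0 \<le> x" "x \<le> 1" and
    l: "w \<in> tube_box \<Longrightarrow> x < 1" and r: "mirror w \<in> tube_box \<Longrightarrow> 0 < x"
    using w unfolding tube_box_def xy mirror_def by auto
  have p: "0 < real m ^ e" "0 < real m ^ k1" using m0 by simp_all
  have pw: "real m ^ k = real m ^ k1 * real m ^ e" by (simp add: kk power_add)
  have le: "real c / real m ^ k1 \<le> (real g + s) / real m ^ k \<longleftrightarrow> real (c * m ^ e) \<le> real g + s"
    "(real g + s) / real m ^ k \<le> (real c + 1) / real m ^ k1 \<longleftrightarrow> real g + s \<le> real ((c + 1) * m ^ e)"
    "real c / real m ^ k1 < (real g + s) / real m ^ k \<longleftrightarrow> real (c * m ^ e) < real g + s"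
    "(real g + s) / real m ^ k < (real c + 1) / real m ^ k1 \<longleftrightarrow> real g + s < real ((c + 1) * m ^ e)"
    for c g :: nat and s :: real
  proof -
    have M: "0 < real m ^ k" using m0 by simp
    have X: "real c / real m ^ k1 = real (c * m ^ e) / real m ^ k"
      and Y: "(real c + 1) / real m ^ k1 = real ((c + 1) * m ^ e) / real m ^ k"
      unfolding pw using p by (simp_all add: field_simps)
    have dl: "v / real m ^ k \<le> t / real m ^ k \<longleftrightarrow> v \<le> t" "v / real m ^ k < t / real m ^ k \<longleftrightarrow> v < t" for v t :: real
    proof -
      have "v / M \<le> t / M \<longleftrightarrow> v \<le> t" "v / M < t / M \<longleftrightarrow> v < t" if "0 < M" for M :: real
        using that by (simp_all add: divide_le_cancel divide_less_cancel)
      then show "v / real m ^ k \<le> t / real m ^ k \<longleftrightarrow> v \<le> t" "v / real m ^ k < t / real m ^ k \<longleftrightarrow> v < t"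
        using M by blast+
    qed
    show "real c / real m ^ k1 \<le> (real g + s) / real m ^ k \<longleftrightarrow> real (c * m ^ e) \<le> real g + s"
      "(real g + s) / real m ^ k \<le> (real c + 1) / real m ^ k1 \<longleftrightarrow> real g + s \<le> real ((c + 1) * m ^ e)"
      "real c / real m ^ k1 < (real g + s) / real m ^ k \<longleftrightarrow> real (c * m ^ e) < real g + s"
      "(real g + s) / real m ^ k < (real c + 1) / real m ^ k1 \<longleftrightarrow> real g + s < real ((c + 1) * m ^ e)"
      unfolding X Y dl by (rule refl)+
  qed
  have c: "real (a * m ^ e) \<le> real i + x" "real i + x \<le> real ((a + 1) * m ^ e)"
    "real (b * m ^ e) \<le> real j + y" "real j + y \<le> real ((b + 1) * m ^ e)"
    using z unfolding rim_def cell_def zoom_def xy by (auto simp only: Diff_iff mem_Times_iff fst_conv snd_conv atLeastAtMost_iff le)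
  have nc: "\<not> (real (a * m ^ e) < real i + x \<and> real i + x < real ((a + 1) * m ^ e) \<and>
    real (b * m ^ e) < real j + y \<and> real j + y < real ((b + 1) * m ^ e))"
    using z unfolding rim_def ocell_def zoom_def xy
    by (simp only: Diff_iff mem_Times_iff fst_conv snd_conv greaterThanLessThan_iff le) blast
  have "real (b * m ^ e) < real (j + 1)" "real j < real ((b + 1) * m ^ e)" using c y by linarith+
  then have jb: "b * m ^ e \<le> j" "j + 1 \<le> (b + 1) * m ^ e" unfolding of_nat_less_iff by linarith+
  then have "real (b * m ^ e) \<le> real j" "real (j + 1) \<le> real ((b + 1) * m ^ e)" unfolding of_nat_le_iff by blast+
  then have "real (b * m ^ e) < real j + y" "real j + y < real ((b + 1) * m ^ e)" using y by simp_all
  then have "real i + x \<le> real (a * m ^ e) \<or> real ((a + 1) * m ^ e) \<le> real i + x" using nc by linarith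
  then have e: "real i + x = real (a * m ^ e) \<or> real i + x = real ((a + 1) * m ^ e)" using c by linarith
  have int: "real i + x = real c \<Longrightarrow> x < 1 \<Longrightarrow> i = c" "real i + x = real c \<Longrightarrow> 0 < x \<Longrightarrow> i + 1 = c" for c :: nat
  proof -
    assume h: "real i + x = real c" "x < 1"
    then have "real i \<le> real c" "real c < real (i + 1)" using xx by simp_all
    then show "i = c" unfolding of_nat_le_iff of_nat_less_iff by simp
  next
    assume h: "real i + x = real c" "0 < x"
    then have "real i < real c" "real c \<le> real (i + 1)" using xx by simp_all
    then show "i + 1 = c" unfolding of_nat_le_iff of_nat_less_iff by simp
  qed
  show ?thesis using jb e int l r by (metis Suc_eq_plus1 Suc_le_eq)
qed

text \<open>The reflection is an isometry of \<open>S\<close> that preserves the middle circle, so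
  the improvement for the reflected square and circle can be transferred back.\<close>

lemma adm_improve_mirrored:
  assumes k: "kept m mid k i j" and C1: "C1 \<subseteq> S" "closed C1" "C1 \<inter> ocell m k i j = {}"
    "C1 \<inter> zoom m k i j ` mirror ` tube_box = {}"
  shows "\<exists>del>0. \<forall>K. adm S outer middle K \<longrightarrow> adm S C1 (zoom m k i j ` middle) (K - del)"
proof -
  have i: "i < m ^ k" using kept_less[OF m0 k] by simp
  define i' where "i' = m ^ k - 1 - i"
  have k': "kept m mid k i' j"
  proof -
    have "(m - 1 - a, b) \<in> mid \<longleftrightarrow> (a, b) \<in> mid" if "a < m" for a b using m that by auto
    then show ?thesis using kept_flip(1)[OF m0 _ i, of mid j] k unfolding i'_def by blast
  qed
  have mz: "mirror (zoom m k i' j z) = zoom m k i j (mirror z)" for z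
  proof -
    have "real i' = real m ^ k - 1 - real i" unfolding i'_def using i by (simp add: of_nat_diff)
    then show ?thesis using m0 by (simp add: mirror_def zoom_def field_simps)
  qed
  have mzi: "mirror ` zoom m k i' j ` A = zoom m k i j ` mirror ` A" for A
    unfolding image_image mz ..
  have mm: "mirror ` mirror ` A = A" for A by (simp add: image_image mirror_mirror)
  have cl: "closed (mirror ` C1)"
  proof -
    have "compact C1" using C1(1,2) compact_S by (metis closed_Int_compact inf.absorb_iff2 inf_commute)
    moreover have "continuous_on C1 mirror" unfolding continuous_on_iff dist_mirror by blast
    ultimately show ?thesis using compact_continuous_image compact_imp_closed by blast
  qed
  have o: "mirror ` C1 \<inter> ocell m k i' j = {}"
    using C1(3) mirror_mem(2)[OF m0 i] unfolding i'_def by blast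
  have t: "mirror ` C1 \<inter> zoom m k i' j ` tube_box = {}"
  proof (rule ccontr)
    assume "\<not> ?thesis"
    then obtain z w where "z \<in> C1" "w \<in> tube_box" "mirror z = zoom m k i' j w" by blast
    then have "z = zoom m k i j (mirror w)" using mz mirror_mirror by metis
    then show False using C1(4) \<open>z \<in> C1\<close> \<open>w \<in> tube_box\<close> by blast
  qed
  obtain del where del: "0 < del" "\<And>K. adm S outer middle K \<Longrightarrow> adm S (mirror ` C1) (zoom m k i' j ` middle) (K - del)"
    using adm_improve[OF k' cl o t] by blast
  have "adm S C1 (zoom m k i j ` middle) (K - del)" if a: "adm S outer middle K" for K
  proof -
    have mS: "middle \<subseteq> S" using peripheral_middle unfolding peripheral_def by blast
    have s: "mirror ` C1 \<subseteq> S" "zoom m k i' j ` middle \<subseteq> S"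
      using C1(1) mirror_S zoom_in_S[OF k'] mS by blast+
    have "adm S (mirror ` mirror ` C1) (mirror ` zoom m k i' j ` middle) (K - del)"
      by (rule adm_transfer[OF mirror_homeo compact_S mirror_qs s del(2)[OF a]])
    moreover have "mirror ` middle = middle"
    proof -
      have dd: "d < m ^ 1" "m ^ 1 - 1 - d = d" using m by simp_all
      have mem: "mirror z \<in> middle \<longleftrightarrow> z \<in> middle" for z
        using mirror_mem[OF m0 dd(1), of z d] unfolding dd(2) rim_def by blast
      show ?thesis
      proof (intro equalityI subsetI)
        fix z assume "z \<in> middle"
        then have "mirror z \<in> middle" using mem by blast
        then show "z \<in> mirror ` middle" by (rule image_eqI[rotated]) (simp add: mirror_mirror)
      qed (use mem in auto)
    qed
    ultimately show ?thesis unfolding mm mzi by simp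
  qed
  then show ?thesis using del(1) by blast
qed

lemma compact_rim: "compact (rim m k a b)"
  unfolding rim_def using compact_cell open_ocell by (rule compact_diff)

lemma adm_strict:
  assumes C: "peripheral S C1" "peripheral S C2" "C1 \<noteq> C2" and n1: "\<not> (C1 = outer \<and> C2 = middle)"
    and n2: "\<not> (C1 = middle \<and> C2 = outer)"
  shows "\<exists>del>0. \<forall>K. adm S outer middle K \<longrightarrow> adm S C1 C2 (K - del)"
proof -
  have main: "\<exists>del>0. \<forall>K. adm S outer middle K \<longrightarrow> adm S C1 C2 (K - del)"
    if r1: "rim_index m mid k1 a1 b1" and r2: "rim_index m mid k2 a2 b2" and le: "k1 \<le> k2"
      and C1: "C1 = rim m k1 a1 b1" and C2: "C2 = rim m k2 a2 b2" and ne: "C1 \<noteq> C2"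
      and n1: "\<not> (C1 = outer \<and> C2 = middle)" for C1 C2 k1 a1 b1 k2 a2 b2
  proof -
    have "hole m mid k2 a2 b2" using r1 r2 le ne C1 C2 unfolding rim_index_def by (cases k2) auto
    then obtain k where k2: "k2 = Suc k" and kept: "kept m mid k (a2 div m) (b2 div m)" and md: "a2 mod m = d" "b2 mod m = d"
      by (cases k2) auto
    define i j where "i = a2 div m" and "j = b2 div m"
    have k: "kept m mid k i j" using kept unfolding i_def j_def .
    have "a2 = i * m ^ 1 + d" "b2 = j * m ^ 1 + d" using md unfolding i_def j_def by (metis div_mult_mod_eq power_one_right)+
    then have C2z: "C2 = zoom m k i j ` middle" using zoom_rim[OF m0, of k i j 1 d d] C2 k2 by simp
    have C1S: "C1 \<subseteq> S" unfolding C1 by (rule rim_subset_carpet[OF m0 mid r1])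
    have C1c: "closed C1" unfolding C1 by (rule compact_imp_closed[OF compact_rim])
    have free: "C1 \<inter> ocell m k i j = {} \<and> (C1 \<inter> zoom m k i j ` tube_box = {} \<or> C1 \<inter> zoom m k i j ` mirror ` tube_box = {})"
    proof (cases "k1 \<le> k")
      case True
      then obtain e where e: "k = k1 + e" using le_Suc_ex by blast
      have d1: "C1 \<inter> ocell m k i j = {}" unfolding C1 by (rule coarse_rim_avoids_open_cell[OF e])
      have "C1 \<inter> zoom m k i j ` tube_box = {} \<or> C1 \<inter> zoom m k i j ` mirror ` tube_box = {}"
      proof (rule ccontr)
        assume "\<not> ?thesis"
        then obtain w w' where w: "w \<in> tube_box" "zoom m k i j w \<in> rim m k1 a1 b1"
          and w': "w' \<in> tube_box" "zoom m k i j (mirror w') \<in> rim m k1 a1 b1" unfolding C1 by blast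
        have l: "b1 * m ^ e \<le> j" "j < (b1 + 1) * m ^ e" "i = a1 * m ^ e \<or> i = (a1 + 1) * m ^ e"
          using grid_line_through_tube_end[OF e _ w(2)] w(1) by auto
        have r: "i + 1 = a1 * m ^ e \<or> i + 1 = (a1 + 1) * m ^ e"
          using grid_line_through_tube_end[OF e _ w'(2)] w'(1) mirror_mirror by auto
        \<comment> \<open>Both vertical sides of the small square lie on the vertical sides of
          \<open>C1\<close>, which are \<open>X = m ^ e\<close> squares apart; only
          \<open>X = 1\<close> is possible. Then \<open>C1\<close> bounds the small square itself,
          which is kept and hence no hole, so \<open>C1\<close> is the outer circle.\<close>
        have "X = 1 \<and> i = a1" if "i = a1 * X \<or> i = (a1 + 1) * X" "i + 1 = a1 * X \<or> i + 1 = (a1 + 1) * X" for X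
          using that by auto
        then have "m ^ e = 1 \<and> i = a1" using l(3) r by blast
        moreover have "e = 0"
        proof (rule ccontr)
          assume "e \<noteq> 0"
          moreover have "1 < m" using m d by simp
          ultimately have "1 < m ^ e" by (intro one_less_power) auto
          then show False using \<open>m ^ e = 1 \<and> i = a1\<close> by simp
        qed
        ultimately have "k = k1" "i = a1" "j = b1" using e l by auto
        then have "kept m mid k1 a1 b1" using k by simp
        then have "k1 = 0 \<and> a1 = 0 \<and> b1 = 0" using r1 hole_not_kept unfolding rim_index_def by blast
        then have "C1 = outer" "C2 = middle" using C1 C2 \<open>k = k1\<close> \<open>i = a1\<close> \<open>j = b1\<close> C2z zoom_rim[OF m0, of 0 0 0 1 d d] by auto
        then show False using n1 by blast
      qed
      then show ?thesis using d1 by blast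
    next
      case False
      then have k1: "k1 = Suc k" using le k2 by simp
      have h1: "hole m mid (Suc k) a1 b1" using r1 k1 unfolding rim_index_def by auto
      \<comment> \<open>Different holes of equal level lie inside different open parents, so here
        \<open>C1\<close> does not even touch the small square.\<close>
      have sub: "C1 \<subseteq> ocell m k (a1 div m) (b1 div m)"
        using hole_in_parent[OF h1] unfolding C1 k1 rim_def by blast
      have dj: "ocell m k (a1 div m) (b1 div m) \<inter> cell m k i j = {}"
      proof (rule ccontr)
        assume "\<not> ?thesis"
        then have "a1 div m = i \<and> b1 div m = j" using ocell_eqD[OF m0] by blast
        moreover have "a1 mod m = d" "b1 mod m = d" using h1 by auto
        ultimately have "a1 = a2" "b1 = b2" using md unfolding i_def j_def by (metis div_mult_mod_eq)+
        then show False using ne C1 C2 k1 k2 by simp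
      qed
      have "zoom m k i j ` tube_box \<subseteq> cell m k i j" using tube_box_in_unit zoom_mem_cell0[OF m0] by blast
      then show ?thesis using sub dj ocell_subset_cell by blast
    qed
    then show ?thesis unfolding C2z
      using adm_improve[OF k C1c] adm_improve_mirrored[OF k C1S C1c] by blast
  qed
  obtain k1 a1 b1 k2 a2 b2 where r: "rim_index m mid k1 a1 b1" "C1 = rim m k1 a1 b1"
    "rim_index m mid k2 a2 b2" "C2 = rim m k2 a2 b2"
    using C(1,2) unfolding peripheral_iff by blast
  show ?thesis
  proof (cases "k1 \<le> k2")
    case True
    then show ?thesis using main[OF r(1,3) True r(2,4) C(3) n1] by blast
  next
    case False
    then have "k2 \<le> k1" by simp
    then obtain del where "0 < del" "\<And>K. adm S outer middle K \<Longrightarrow> adm S C2 C1 (K - del)"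
      using main[OF r(3,1) _ r(4,2) C(3)[symmetric]] n2 by blast
    then show ?thesis using adm_swap by blast
  qed
qed

text \<open>This starts the descent. The factor 3 is right because \<open>1 / 3 \<le> d / m\<close>
  puts the two circles at distance at least 1/3.\<close>

lemma adm_outer_middle: "\<exists>K. adm S outer middle K"
proof -
  let ?f = "\<lambda>z. 3 * infdist z middle" and ?u = "\<lambda>z. min 1 (3 * infdist z middle)"
  have fL: "\<bar>?f x - ?f y\<bar> \<le> 3 * dist x y" for x y
    using infdist_triangle_abs[of x middle y] by (simp add: abs_le_iff)
  have uL: "\<bar>?u x - ?u y\<bar> \<le> 3 * dist x y" for x y
    using fL[of x y] by linarith
  have "null_osc S ?u" using null_osc_min_lipschitz[OF null_osc_const[of 1], of 3 ?f] fL by simp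
  moreover have "energy_le S ?u (8 * 3\<^sup>2)" using energy_lipschitz[of 3 ?u] uL by simp
  moreover have "?u z = 0" if "z \<in> middle" for z using that by simp
  moreover have "?u z = 1" if z: "z \<in> outer" for z
  proof -
    obtain w where w: "w \<in> middle" "infdist z middle = dist z w"
      using infdist_attains_inf[OF compact_imp_closed[OF compact_rim] rim_nonempty] by blast
    have b: "1 / 3 \<le> real d / m" "(real d + 1) / m \<le> 2 / 3" using d dm m0 by (simp_all add: field_simps)
    have wc: "1 / 3 \<le> fst w" "fst w \<le> 2 / 3" "1 / 3 \<le> snd w" "snd w \<le> 2 / 3"
    proof -
      have "real d / m \<le> fst w" "fst w \<le> (real d + 1) / m" "real d / m \<le> snd w" "snd w \<le> (real d + 1) / m"
        using w(1) unfolding rim_def cell_def by auto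
      then show "1 / 3 \<le> fst w" "fst w \<le> 2 / 3" "1 / 3 \<le> snd w" "snd w \<le> 2 / 3" using b by linarith+
    qed
    have "fst z \<le> 0 \<or> 1 \<le> fst z \<or> snd z \<le> 0 \<or> 1 \<le> snd z"
      using z by (auto simp: rim_def ocell_def mem_Times_iff)
    then have "1 / 3 \<le> \<bar>fst z - fst w\<bar> \<or> 1 / 3 \<le> \<bar>snd z - snd w\<bar>" using wc by linarith
    then have "1 / 3 \<le> dist z w" using dist_fst_le[of z w] dist_snd_le[of z w] by (auto simp: dist_real_def)
    then show ?thesis using w(2) by simp
  qed
  ultimately show ?thesis unfolding adm_def by blast
qed

end

section \<open>Conjugating the rotation\<close>

text \<open>An injective continuous function on an interval is strictly monotone, so a zero at a
  positive \<open>t\<close> would force a negative value at one of its two sides.\<close>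

lemma homeomorphism_atLeast_0:
  fixes eta :: "real \<Rightarrow> real"
  assumes "homeomorphism {0..} {0..} eta theta"
  shows "continuous_on {0..} eta" "eta 0 = 0"
proof -
  show c: "continuous_on {0..} eta" using assms by (simp add: homeomorphism_def)
  have im: "eta ` {0..} = {0..}" and inv: "\<And>x. 0 \<le> x \<Longrightarrow> theta (eta x) = x"
    using assms by (auto simp: homeomorphism_def)
  have nn: "0 \<le> eta x" if "0 \<le> x" for x using im that by auto
  have "0 \<in> eta ` {0..}" using im by simp
  then obtain t where t: "0 \<le> t" "eta t = 0" by auto
  have "t = 0"
  proof (rule ccontr)
    assume "t \<noteq> 0"
    then have "0 < t" using t by simp
    have "inj_on eta {0..t + 1}" using inv by (metis atLeastAtMost_iff inj_onI)
    moreover have "continuous_on {0..t + 1} eta" by (rule continuous_on_subset[OF c]) auto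
    ultimately have "eta 0 < eta t \<and> eta t < eta (t + 1) \<or> eta (t + 1) < eta t \<and> eta t < eta 0"
      using continuous_inj_imp_mono[of 0 t "t + 1" eta] \<open>0 < t\<close> by auto
    then show False using nn[of 0] nn[of "t + 1"] t by auto
  qed
  then show "eta 0 = 0" using t by simp
qed

text \<open>The distortion inequality is applied twice. Near 0, where \<open>eta\<close> is small,
  it shows that a bounded ratio in \<open>S\<close> comes from a ratio of at most
  \<open>1 / tau\<close> in \<open>F\<close>. The isometry keeps this ratio, and the bound of
  \<open>eta\<close> on \<open>{0..1 / tau}\<close> returns to \<open>S\<close>.\<close>

lemma weak_qs_conjugate:
  assumes f: "quasisymmetric_homeomorphism F S f" and hom: "homeomorphism F S f f'"
    and r: "\<And>x y. dist (r x) (r y) = dist x y" "\<And>x. x \<in> F \<Longrightarrow> r x \<in> F"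
  shows "weak_qs S (f \<circ> r \<circ> f')"
proof -
  obtain eta theta where et: "homeomorphism {0..} {0..} eta theta" and
    q: "\<And>x y z. x \<in> F \<Longrightarrow> y \<in> F \<Longrightarrow> z \<in> F \<Longrightarrow> x \<noteq> z \<Longrightarrow>
      dist (f x) (f y) / dist (f x) (f z) \<le> eta (dist x y / dist x z)"
    using f unfolding quasisymmetric_homeomorphism_def by blast
  note e = homeomorphism_atLeast_0[OF et]
  have f': "f' y \<in> F" "f (f' y) = y" if "y \<in> S" for y using hom that by (auto simp: homeomorphism_def)
  have inj: "f x \<noteq> f y" if "x \<in> F" "y \<in> F" "x \<noteq> y" for x y using hom that by (metis homeomorphism_def)
  show ?thesis
    unfolding weak_qs_def
  proof
    fix lam :: real
    define la where "la = max lam 1"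
    have la: "1 \<le> la" "lam \<le> la" by (simp_all add: la_def)
    obtain tau where tau: "0 < tau" "\<And>t. 0 \<le> t \<Longrightarrow> t < tau \<Longrightarrow> eta t < 1 / la"
    proof -
      have "\<forall>e>0. \<exists>d>0. \<forall>t\<in>{0..}. dist t 0 < d \<longrightarrow> dist (eta t) (eta 0) < e"
        using e(1) unfolding continuous_on_iff by (meson atLeast_iff order_refl)
      moreover have "0 < 1 / la" using la by simp
      ultimately obtain d where "d > 0" "\<forall>t\<in>{0..}. dist t 0 < d \<longrightarrow> dist (eta t) (eta 0) < 1 / la" by blast
      then show ?thesis using that[of d] e(2) by (auto simp: dist_real_def abs_less_iff)
    qed
    have "compact (eta ` {0..1 / tau})"
      by (intro compact_continuous_image continuous_on_subset[OF e(1)]) auto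
    then have "bounded (eta ` {0..1 / tau})" by (rule compact_imp_bounded)
    then obtain b where "\<forall>v\<in>eta ` {0..1 / tau}. norm v \<le> b" unfolding bounded_iff by blast
    then have b: "\<And>t. 0 \<le> t \<Longrightarrow> t \<le> 1 / tau \<Longrightarrow> \<bar>eta t\<bar> \<le> b" by simp
    have b0: "0 \<le> b" using b[of 0] tau(1) e(2) by simp
    show "\<exists>H. \<forall>x\<in>S. \<forall>y\<in>S. \<forall>z\<in>S. dist x y \<le> lam * dist x z \<longrightarrow>
      dist ((f \<circ> r \<circ> f') x) ((f \<circ> r \<circ> f') y) \<le> H * dist ((f \<circ> r \<circ> f') x) ((f \<circ> r \<circ> f') z)"
    proof (intro exI[of _ b] ballI impI)
      fix x y z assume xyz: "x \<in> S" "y \<in> S" "z \<in> S" and le: "dist x y \<le> lam * dist x z"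
      let ?x = "f' x" and ?y = "f' y" and ?z = "f' z"
      show "dist ((f \<circ> r \<circ> f') x) ((f \<circ> r \<circ> f') y) \<le> b * dist ((f \<circ> r \<circ> f') x) ((f \<circ> r \<circ> f') z)"
      proof (cases "x = y")
        case True then show ?thesis using b0 by simp
      next
        case xy: False
        then have xz: "x \<noteq> z" using le by auto
        have ne: "?x \<noteq> ?y" "?x \<noteq> ?z" using f' xyz xy xz by metis+
        have d0: "0 < dist x y" "0 < dist x z" "0 < dist ?x ?y" "0 < dist ?x ?z" using xy xz ne by simp_all
        let ?t = "dist ?x ?z / dist ?x ?y"
        have "dist x y \<le> la * dist x z"
          using le mult_right_mono[OF la(2), of "dist x z"] by simp
        then have "1 / la \<le> dist x z / dist x y" using la d0 by (simp add: field_simps)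
        also have "\<dots> \<le> eta ?t" using q[of ?x ?z ?y] f' xyz ne by simp
        finally have "tau \<le> ?t" using tau(2)[of ?t] d0 by (meson divide_nonneg_pos less_imp_le not_le)
        then have "1 / ?t \<le> 1 / tau" using tau(1) by (intro divide_left_mono mult_pos_pos) auto
        then have t: "dist ?x ?y / dist ?x ?z \<le> 1 / tau" by simp
        have rne: "r ?x \<noteq> r ?z" using r(1)[of ?x ?z] ne(2) by auto
        have rF: "r ?x \<in> F" "r ?y \<in> F" "r ?z \<in> F" using r(2) f'(1) xyz by auto
        have "dist (f (r ?x)) (f (r ?y)) / dist (f (r ?x)) (f (r ?z)) \<le> eta (dist ?x ?y / dist ?x ?z)"
          using q[OF rF rne] by (simp add: r(1))
        also have "\<dots> \<le> b" using b[of "dist ?x ?y / dist ?x ?z"] t d0 by (simp add: abs_le_iff)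
        finally show ?thesis using inj[OF rF(1,3) rne] by (simp add: divide_le_eq)
      qed
    qed
  qed
qed

text \<open>The images of the two lower corners lie in the square again, and this alone centres it
  horizontally.\<close>

lemma half_turn_invariant_rim:
  assumes n: "0 < n" and sym: "(\<lambda>z. (1 - fst z, 1 - snd z)) ` rim n k a b = rim n k a b"
  shows "2 * a + 1 = n ^ k"
proof -
  have p: "0 < real n ^ k" using n by simp
  have corner: "(real a / real n ^ k, real b / real n ^ k) \<in> rim n k a b"
    "((real a + 1) / real n ^ k, real b / real n ^ k) \<in> rim n k a b"
    using grid_step[OF n, of a k] grid_step[OF n, of b k] by (simp_all add: rim_def cell_def ocell_def)
  have "(1 - real a / real n ^ k, 1 - real b / real n ^ k) \<in> cell n k a b"
    "(1 - (real a + 1) / real n ^ k, 1 - real b / real n ^ k) \<in> cell n k a b"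
    using imageI[OF corner(1), of "\<lambda>z. (1 - fst z, 1 - snd z)"] imageI[OF corner(2), of "\<lambda>z. (1 - fst z, 1 - snd z)"]
    unfolding sym by (simp_all add: rim_def)
  then have "1 - real a / real n ^ k \<le> (real a + 1) / real n ^ k" "real a / real n ^ k \<le> 1 - (real a + 1) / real n ^ k"
    unfolding cell_def by simp_all
  then have "real n ^ k = 2 * real a + 1" using p by (simp add: field_simps)
  then have "real (n ^ k) = real (2 * a + 1)" by simp
  then show ?thesis unfolding of_nat_eq_iff by simp
qed

text \<open>\<open>2 * (a mod n) + 1\<close> is a multiple of \<open>n\<close> strictly between 0
  and \<open>2 * n\<close>. So the last digit of a centred index is the middle digit.\<close>

lemma center_digit:
  fixes a n :: nat
  assumes n: "0 < n" and dvd: "n dvd 2 * a + 1"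
  shows "2 * (a mod n) + 1 = n"
proof -
  have "a = n * (a div n) + a mod n" by simp
  then have "2 * a + 1 = n * (2 * (a div n)) + (2 * (a mod n) + 1)" by linarith
  then have "n dvd 2 * (a mod n) + 1" using dvd by (metis dvd_add_right_iff dvd_triv_left)
  then obtain q where q: "2 * (a mod n) + 1 = n * q" by (elim dvdE)
  have "n * q < n * 2" using q mod_less_divisor[OF n, of a] by linarith
  then have "q < 2" by simp
  moreover have "q \<noteq> 0"
  proof
    assume "q = 0"
    then show False using q by simp
  qed
  ultimately have "q = 1" by linarith
  then show ?thesis using q by simp
qed

theorem theorem1:
  fixes n p m :: nat
  assumes "n \<ge> 5" and "1 \<le> p" and "real p < real n / 2 - 1"
    and "odd m" and "m \<ge> 3"
  shows "\<not> quasisymmetrically_equivalent (four_hole_carpet n p) (standard_carpet m)"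
proof
  assume "quasisymmetrically_equivalent (four_hole_carpet n p) (standard_carpet m)"
  then obtain f where f: "quasisymmetric_homeomorphism (four_hole_carpet n p) (standard_carpet m) f"
    unfolding quasisymmetrically_equivalent_def by blast
  define d where "d = (m - 1) div 2"
  obtain c where c: "m = 2 * c + 1" using assms(4) by (rule oddE)
  then have "d = c" "1 \<le> c" using assms(5) by (simp_all add: d_def)
  then interpret odd_carpet m d using c by (intro odd_carpet.intro) simp_all
  define R where "R = {p, n - (p + 1)} \<times> {p, n - (p + 1)}"
  define F where "F = carpet n R"
  have p: "2 * p + 2 < n" using assms(3) by linarith
  have n: "0 < n" using assms(1) by simp
  have R: "R \<subseteq> {..<n} \<times> {..<n}" using p unfolding R_def by auto
  have FS: "four_hole_carpet n p = F" "standard_carpet m = S"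
    unfolding four_hole_carpet_def standard_carpet_def F_def R_def d_def by simp_all
  obtain f' where hom: "homeomorphism F S f f'" using f unfolding quasisymmetric_homeomorphism_def FS by blast
  have ff: "\<And>x. x \<in> F \<Longrightarrow> f' (f x) = x" "\<And>y. y \<in> S \<Longrightarrow> f (f' y) = y" "f ` F = S" "f' ` S = F"
    using hom by (auto simp: homeomorphism_def)
  have "(n - 1 - i = p \<or> n - 1 - i = n - (p + 1)) \<longleftrightarrow> (i = p \<or> i = n - (p + 1))" if "i < n" for i
  proof -
    obtain q where q: "n = Suc (i + q)" using less_imp_Suc_add[OF \<open>i < n\<close>] by blast
    obtain r where r: "n = Suc (2 * p + 2 + r)" using less_imp_Suc_add[OF p] by blast
    have "n - 1 - i = q" "n - (p + 1) = p + 2 + r" "i + q = 2 * p + 2 + r" using q r by simp_all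
    then show ?thesis by auto
  qed
  then have "(n - 1 - i, j) \<in> R \<longleftrightarrow> (i, j) \<in> R" if "i < n" for i j
    unfolding R_def mem_Times_iff fst_conv snd_conv insert_iff empty_iff using that by blast
  then have mF: "mirror z \<in> F" if "z \<in> F" for z
    using mirror_carpet[OF n R] that unfolding F_def by blast
  have tF: "transposition z \<in> F" if "z \<in> F" for z
  proof -
    have "(j, i) \<in> R \<longleftrightarrow> (i, j) \<in> R" for i j unfolding R_def by blast
    then show ?thesis using transposition_carpet[OF n R] that unfolding F_def by blast
  qed
  \<comment> \<open>The quarter-turn is a product of two reflections that respect the pattern
    \<open>R\<close>; the inverse is the product in reverse order.\<close>
  define rot where "rot = mirror \<circ> transposition"
  define irot where "irot = transposition \<circ> mirror"
  have inv: "rot (irot z) = z" "irot (rot z) = z" for z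
    by (simp_all add: rot_def irot_def mirror_mirror transposition_transposition)
  have iso: "dist (rot x) (rot y) = dist x y" "dist (irot x) (irot y) = dist x y" for x y
    by (simp_all add: rot_def irot_def dist_mirror dist_transposition)
  have rF: "rot z \<in> F" "irot z \<in> F" if "z \<in> F" for z
    using that mF tF by (simp_all add: rot_def irot_def)
  define g where "g = f \<circ> rot \<circ> f'"
  define h where "h = f \<circ> irot \<circ> f'"
  have qs: "weak_qs S g" "weak_qs S h"
    unfolding g_def h_def
    using weak_qs_conjugate[OF f[unfolded FS] hom] iso rF by blast+
  have gh: "homeomorphism S S g h"
  proof -
    have "homeomorphism F F rot irot"
    proof (rule homeomorphismI)
      show "continuous_on F rot" "continuous_on F irot" unfolding continuous_on_iff iso by blast+
    qed (use inv rF in auto)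
    then have "homeomorphism S S (f \<circ> (rot \<circ> f')) ((f \<circ> irot) \<circ> f')"
      using homeomorphism_compose[OF homeomorphism_compose[OF homeomorphism_symD[OF hom]] hom] by (simp add: comp_assoc)
    then show ?thesis unfolding g_def h_def by (simp add: comp_assoc)
  qed
  have OM: "outer \<subseteq> S" "middle \<subseteq> S" "outer \<noteq> middle"
  proof -
    show "outer \<subseteq> S" "middle \<subseteq> S" using peripheral_outer peripheral_middle unfolding peripheral_def by blast+
    have "middle \<subseteq> ocell m 0 0 0" using hole_cell_in_open_unit[OF hole_middle] unfolding rim_def by blast
    then show "outer \<noteq> middle" using rim_nonempty[of 1 d d] unfolding rim_def[of m 0] by blast
  qed
  have gper: "peripheral S (g ` outer)" "peripheral S (g ` middle)"
    using peripheral_image[OF gh] peripheral_outer peripheral_middle by blast+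
  have hg: "h ` g ` A = A" if "A \<subseteq> S" for A
  proof -
    have "\<And>z. z \<in> S \<Longrightarrow> h (g z) = z" using gh by (auto simp: homeomorphism_def)
    then show ?thesis using that by (force simp: image_image)
  qed
  have gne: "g ` outer \<noteq> g ` middle" using hg OM by metis
  have "(g ` outer = outer \<and> g ` middle = middle) \<or> (g ` outer = middle \<and> g ` middle = outer)"
  proof (rule ccontr)
    assume "\<not> ?thesis"
    then obtain del where del: "0 < del" "\<And>K. adm S outer middle K \<Longrightarrow> adm S (g ` outer) (g ` middle) (K - del)"
      using adm_strict[OF gper gne] by blast
    have step: "adm S outer middle (K - del)" if "adm S outer middle K" for K
    proof -
      have "adm S (h ` g ` outer) (h ` g ` middle) (K - del)"
        using gper by (intro adm_transfer[OF homeomorphism_symD[OF gh] compact_S qs(2) _ _ del(2)[OF that]])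
          (auto simp: peripheral_def)
      then show ?thesis using hg OM by simp
    qed
    obtain K where K: "adm S outer middle K" using adm_outer_middle by blast
    \<comment> \<open>The map \<open>h\<close> carries the improved pair back to
      \<open>(outer, middle)\<close>, so the saving repeats. The empty family of circles has energy
      0, which bounds every admissible constant from below.\<close>
    have iter: "adm S outer middle (K - real N * del)" for N
    proof (induction N)
      case (Suc N)
      then show ?case using step[OF Suc] by (simp add: algebra_simps)
    qed (use K in simp)
    obtain N where "K < real N * del" using reals_Archimedean3[OF del(1)] by blast
    moreover have "0 \<le> K - real N * del"
      using iter[of N] unfolding adm_def energy_le_def by (metis empty_subsetI finite.emptyI sum.empty)
    ultimately show False by simp
  qed
  then have gg: "g ` g ` outer = outer" "g ` g ` middle = middle" by (elim disjE conjE; simp only:)+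
  have fixed: "f' ` A = rim n 0 0 0" if A: "peripheral S A" "g ` g ` A = A" for A
  proof -
    have AS: "A \<subseteq> S" using A(1) unfolding peripheral_def by blast
    have fA: "f' ` A \<subseteq> F" using AS ff(4) by blast
    have "f' ` g ` g ` A = (\<lambda>z. rot (rot z)) ` f' ` A"
    proof -
      have "f' (g (g y)) = rot (rot (f' y))" if "y \<in> A" for y
      proof -
        have "f' y \<in> F" using that fA by blast
        then show ?thesis using ff(1) rF by (simp add: g_def)
      qed
      then show ?thesis by (simp add: image_image)
    qed
    then have sym: "(\<lambda>z. rot (rot z)) ` f' ` A = f' ` A" using A(2) by simp
    have "peripheral F (f' ` A)" by (rule peripheral_image[OF homeomorphism_symD[OF hom] A(1)])
    then obtain k a b where r: "rim_index n R k a b" "f' ` A = rim n k a b"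
      using peripheral_carpet_imp[OF n R] unfolding F_def by blast
    have rr: "rot (rot z) = (1 - fst z, 1 - snd z)" for z
      by (simp add: rot_def mirror_def transposition_def)
    \<comment> \<open>Because of \<open>2 * p + 2 < n\<close>, neither of the digits
      \<open>p\<close> and \<open>n - (p + 1)\<close> is the middle digit.\<close>
    have "\<not> hole n R k a b"
    proof
      assume hole: "hole n R k a b"
      then obtain k' where k': "k = Suc k'" by (cases k) auto
      have "2 * a + 1 = n ^ k"
        using half_turn_invariant_rim[OF n] sym r(2) unfolding rr by simp
      then have "n dvd 2 * a + 1" by (simp add: k')
      then have "2 * (a mod n) + 1 = n" by (rule center_digit[OF n])
      moreover have "a mod n = p \<or> a mod n = n - (p + 1)" using hole unfolding k' R_def hole.simps by blast
      ultimately show False using p by linarith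
    qed
    then show ?thesis using r unfolding rim_index_def by auto
  qed
  have "f' ` outer = f' ` middle"
    using fixed[OF peripheral_outer gg(1)] fixed[OF peripheral_middle gg(2)] by simp
  then have "f ` f' ` outer = f ` f' ` middle" by simp
  moreover have "f ` f' ` A = A" if "A \<subseteq> S" for A using that ff(2) by (force simp: image_image)
  ultimately show False using OM by auto
qed

end
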